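(* Let $\Omega \subset \mathbb{R}^N$ be a bounded Lipschitz domain, and let $\lambda_1^1(\Omega)$ denote the first eigenvalue of the Dirichlet Laplacian $-\Delta$ on $\Omega$. Then $\lambda_1^L(\Omega) \le \log \lambda_1^1(\Omega)$. Moreover, if $\lambda_1^1(\Omega) \le 1$, then $L_\Delta$ does not satisfy the maximum principle on $\Omega$.
   Context: $N\ge1$; $c_N= \pi^{-N/2}\Gamma(N/2)$, $\rho_N=2 \log 2 + \psi(\frac{N}{2}) -\gamma$, with $\psi=\Gamma'/\Gamma$ and $\gamma=-\Gamma'(1)$. Set $$\mathcal{E}_L(u,w)=\frac{c_N}{2}\iint_{|x-y|\le1}\frac{(u(x)-u(y))(w(x)-w(y))}{|x-y|^N}\,dx\,dy-c_N\iint_{|x-y|\ge1}\frac{u(x)w(y)}{|x-y|^N}\,dx\,dy+\rho_N\int_{\mathbb{R}^N}uw\,dx ,$$ with integrals over $x,y\in\mathbb{R}^N$. $\mathbb{H}(\Omega)$ is the space of measurable $u:\mathbb{R}^N\to\mathbb{R}$ with $u\equiv0$ on $\mathbb{R}^N\setminus\Omega$ and $\iint_{|x-y|\le1}\frac{(u(x)-u(y))^2}{|x-y|^N}\,dx\,dy<\infty$ (it is contained in $L^2(\Omega)$, and $\mathcal{E}_L$ is well defined on it). $\lambda_1^L(\Omega)=\min\{\mathcal{E}_L(u,u):u\in\mathbb{H}(\Omega),\ \|u\|_{L^2(\Omega)}=1\}$ is the first Dirichlet eigenvalue of the logarithmic Laplacian $L_\Delta$. $L^1_0(\mathbb{R}^N)$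 is the space of locally integrable $u:\mathbb{R}^N\to\mathbb{R}$ with $\int_{\mathbb{R}^N}\frac{|u(x)|}{(1+|x|)^N}\,dx<\infty$. $\mathcal{V}(\Omega)$ is the space of $u\in L^1_0(\mathbb{R}^N)$ with $\iint_{x,y\in\Omega,\,|x-y|\le1}\frac{(u(x)-u(y))^2}{|x-y|^N}\,dx\,dy+\int_\Omega u^2\,dx<\infty$; $\mathcal{E}_L(u,\phi)$ is well defined for $u\in\mathcal{V}(\Omega)$, $\phi\in C_c^\infty(\Omega)$. For $u\in\mathcal{V}(\Omega)$, $L_\Delta u\ge0$ in $\Omega$ (in weak sense) means $\mathcal{E}_L(u,\phi)\ge0$ for all nonnegative $\phi\in C_c^\infty(\Omega)$. $L_\Delta$ satisfies the maximum principle on $\Omega$ if for every $u\in\mathcal{V}(\Omega)$ with $L_\Delta u\ge0$ in $\Omega$ and $u\ge0$ in $\mathbb{R}^N\setminus\Omega$ we have $u\ge0$ a.e. in $\mathbb{R}^N$. *)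

theory Defs
  imports "HOL-Analysis.Analysis"
begin

text \<open>
  Functions on \<open>\<real>\<^sup>N\<close> are functions on \<^typ>\<open>real ^ 'n\<close> with \<open>N = CARD('n)\<close>. Measurability and
  integrals are with respect to Lebesgue measure; an iterated integral \<open>\<integral>\<integral> \<dots> dx dy\<close> is an
  integral with respect to Lebesgue measure on \<^typ>\<open>(real ^ 'n) \<times> (real ^ 'n)\<close>. The condition
  \<open>\<integral>\<integral> \<dots> < \<infinity>\<close> for a nonnegative measurable integrand is expressed as integrability. On the
  diagonal, integrands divided by \<open>\<bar>x - y\<bar>\<^sup>N\<close> take the value \<open>0\<close> (division by zero), which is
  immaterial because the diagonal is a null set.
\<close>

subsection \<open>Domains and test functions\<close>

text \<open>
  Near each boundary point the set is the region strictly above a Lipschitz graph, in the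
  direction of a unit vector \<open>e\<close>; the graph is over the hyperplane orthogonal to \<open>e\<close>
  (which is \<open>{0}\<close> when \<open>N = 1\<close>).
\<close>

definition lipschitz_boundary :: "(real ^ 'n) set \<Rightarrow> bool" where
  "lipschitz_boundary \<Omega> \<longleftrightarrow>
    (\<forall>p\<in>frontier \<Omega>. \<exists>r>0. \<exists>e. \<exists>L. \<exists>h :: real ^ 'n \<Rightarrow> real.
       norm e = 1 \<and> L-lipschitz_on {z. z \<bullet> e = 0} h \<and>
       \<Omega> \<inter> ball p r = {x \<in> ball p r. x \<bullet> e > h (x - (x \<bullet> e) *\<^sub>R e)})"

definition bounded_lipschitz_domain :: "(real ^ 'n) set \<Rightarrow> bool" where
  "bounded_lipschitz_domain \<Omega> \<longleftrightarrow>
    open \<Omega> \<and> connected \<Omega> \<and> \<Omega> \<noteq> {} \<and> bounded \<Omega> \<and> lipschitz_boundary \<Omega>"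

definition grad :: "(real ^ 'n \<Rightarrow> real) \<Rightarrow> real ^ 'n \<Rightarrow> real ^ 'n" where
  "grad f x = (\<chi> i. frechet_derivative f (at x) (axis i 1))"

primrec C_k :: "nat \<Rightarrow> (real ^ 'n \<Rightarrow> real) \<Rightarrow> bool" where
  "C_k 0 f \<longleftrightarrow> continuous_on UNIV f"
| "C_k (Suc k) f \<longleftrightarrow> (\<forall>x. f differentiable (at x)) \<and> (\<forall>i. C_k k (\<lambda>x. grad f x $ i))"

definition Cc_infinity :: "(real ^ 'n) set \<Rightarrow> (real ^ 'n \<Rightarrow> real) set" where
  "Cc_infinity \<Omega> =
    {\<phi>. (\<forall>k. C_k k \<phi>) \<and> compact (closure {x. \<phi> x \<noteq> 0}) \<and> closure {x. \<phi> x \<noteq> 0} \<subseteq> \<Omega>}"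

subsection \<open>The Dirichlet Laplacian\<close>

definition L2 :: "(real ^ 'n) set \<Rightarrow> (real ^ 'n \<Rightarrow> 'b::euclidean_space) set" where
  "L2 \<Omega> = {f. set_borel_measurable lebesgue \<Omega> f \<and>
              set_integrable lebesgue \<Omega> (\<lambda>x. (norm (f x))\<^sup>2)}"

definition L2_norm :: "(real ^ 'n) set \<Rightarrow> (real ^ 'n \<Rightarrow> 'b::euclidean_space) \<Rightarrow> real" where
  "L2_norm \<Omega> f = sqrt (set_lebesgue_integral lebesgue \<Omega> (\<lambda>x. (norm (f x))\<^sup>2))"

definition weak_gradient ::
    "(real ^ 'n) set \<Rightarrow> (real ^ 'n \<Rightarrow> real) \<Rightarrow> (real ^ 'n \<Rightarrow> real ^ 'n) \<Rightarrow> bool" where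
  "weak_gradient \<Omega> u g \<longleftrightarrow>
    (\<forall>\<phi>\<in>Cc_infinity \<Omega>.
       set_lebesgue_integral lebesgue \<Omega> (\<lambda>x. u x *\<^sub>R grad \<phi> x)
       = - set_lebesgue_integral lebesgue \<Omega> (\<lambda>x. \<phi> x *\<^sub>R g x))"

text \<open>
  \<open>H10_grad \<Omega> u g\<close>: the function \<open>u\<close> belongs to \<open>H\<^sub>0\<^sup>1(\<Omega>)\<close>, the closure of \<open>C\<^sub>c\<^sup>\<infinity>(\<Omega>)\<close> in
  the Sobolev space \<open>H\<^sup>1(\<Omega>)\<close>, and \<open>g\<close> is its weak gradient.
\<close>

definition H10_grad ::
    "(real ^ 'n) set \<Rightarrow> (real ^ 'n \<Rightarrow> real) \<Rightarrow> (real ^ 'n \<Rightarrow> real ^ 'n) \<Rightarrow> bool" where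
  "H10_grad \<Omega> u g \<longleftrightarrow>
    u \<in> L2 \<Omega> \<and> g \<in> L2 \<Omega> \<and> weak_gradient \<Omega> u g \<and>
    (\<exists>\<phi> :: nat \<Rightarrow> real ^ 'n \<Rightarrow> real.
       (\<forall>k. \<phi> k \<in> Cc_infinity \<Omega>) \<and>
       (\<lambda>k. L2_norm \<Omega> (\<lambda>x. \<phi> k x - u x)) \<longlonglongrightarrow> 0 \<and>
       (\<lambda>k. L2_norm \<Omega> (\<lambda>x. grad (\<phi> k) x - g x)) \<longlonglongrightarrow> 0)"

text \<open>Weak formulation of \<open>- \<Delta> u = \<mu> u\<close> in \<open>\<Omega>\<close>, \<open>u = 0\<close> on the boundary.\<close>

definition dirichlet_eigenvalue :: "(real ^ 'n) set \<Rightarrow> real \<Rightarrow> bool" where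
  "dirichlet_eigenvalue \<Omega> \<mu> \<longleftrightarrow>
    (\<exists>u g. H10_grad \<Omega> u g \<and> \<not> (AE x in lebesgue. x \<in> \<Omega> \<longrightarrow> u x = 0) \<and>
       (\<forall>\<phi>\<in>Cc_infinity \<Omega>.
          set_lebesgue_integral lebesgue \<Omega> (\<lambda>x. g x \<bullet> grad \<phi> x)
          = \<mu> * set_lebesgue_integral lebesgue \<Omega> (\<lambda>x. u x * \<phi> x)))"

text \<open>The smallest eigenvalue; the infimum is attained for bounded nonempty open \<open>\<Omega>\<close>.\<close>

definition first_dirichlet_eigenvalue :: "(real ^ 'n) set \<Rightarrow> real" where
  "first_dirichlet_eigenvalue \<Omega> = Inf {\<mu>. dirichlet_eigenvalue \<Omega> \<mu>}"

subsection \<open>The logarithmic Laplacian\<close>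

definition c_const :: "nat \<Rightarrow> real" where
  "c_const N = pi powr (- real N / 2) * Gamma (real N / 2)"

definition rho_const :: "nat \<Rightarrow> real" where
  "rho_const N = 2 * ln 2 + Digamma (real N / 2) - euler_mascheroni"

definition near_pairs :: "((real ^ 'n) \<times> (real ^ 'n)) set" where
  "near_pairs = {(x, y). dist x y \<le> 1}"

definition far_pairs :: "((real ^ 'n) \<times> (real ^ 'n)) set" where
  "far_pairs = {(x, y). dist x y \<ge> 1}"

definition E_L :: "(real ^ 'n \<Rightarrow> real) \<Rightarrow> (real ^ 'n \<Rightarrow> real) \<Rightarrow> real" where
  "E_L u w =
     c_const CARD('n) / 2 *
       set_lebesgue_integral lebesgue near_pairs
         (\<lambda>(x, y). (u x - u y) * (w x - w y) / dist x y ^ CARD('n))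
     - c_const CARD('n) *
       set_lebesgue_integral lebesgue far_pairs
         (\<lambda>(x, y). u x * w y / dist x y ^ CARD('n))
     + rho_const CARD('n) * integral\<^sup>L lebesgue (\<lambda>x. u x * w x)"

definition H_space :: "(real ^ 'n) set \<Rightarrow> (real ^ 'n \<Rightarrow> real) set" where
  "H_space \<Omega> =
    {u. u \<in> borel_measurable lebesgue \<and> (\<forall>x. x \<notin> \<Omega> \<longrightarrow> u x = 0) \<and>
        set_integrable lebesgue near_pairs
          (\<lambda>(x, y). (u x - u y)\<^sup>2 / dist x y ^ CARD('n))}"

text \<open>The infimum below is a minimum for bounded nonempty open \<open>\<Omega>\<close>.\<close>

definition first_log_eigenvalue :: "(real ^ 'n) set \<Rightarrow> real" where
  "first_log_eigenvalue \<Omega> = Inf {E_L u u | u. u \<in> H_space \<Omega> \<and> L2_norm \<Omega> u = 1}"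

definition L10 :: "(real ^ 'n \<Rightarrow> real) set" where
  "L10 =
    {u. (\<forall>K. compact K \<longrightarrow> set_integrable lebesgue K u) \<and>
        integrable lebesgue (\<lambda>x. \<bar>u x\<bar> / (1 + norm x) ^ CARD('n))}"

definition V_space :: "(real ^ 'n) set \<Rightarrow> (real ^ 'n \<Rightarrow> real) set" where
  "V_space \<Omega> =
    {u. u \<in> L10 \<and>
        set_integrable lebesgue (near_pairs \<inter> \<Omega> \<times> \<Omega>)
          (\<lambda>(x, y). (u x - u y)\<^sup>2 / dist x y ^ CARD('n)) \<and>
        set_integrable lebesgue \<Omega> (\<lambda>x. (u x)\<^sup>2)}"

definition weakly_log_superharmonic :: "(real ^ 'n) set \<Rightarrow> (real ^ 'n \<Rightarrow> real) \<Rightarrow> bool" where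
  "weakly_log_superharmonic \<Omega> u \<longleftrightarrow>
    (\<forall>\<phi>\<in>Cc_infinity \<Omega>. (\<forall>x. \<phi> x \<ge> 0) \<longrightarrow> E_L u \<phi> \<ge> 0)"

definition log_maximum_principle :: "(real ^ 'n) set \<Rightarrow> bool" where
  "log_maximum_principle \<Omega> \<longleftrightarrow>
    (\<forall>u\<in>V_space \<Omega>. weakly_log_superharmonic \<Omega> u \<and> (\<forall>x. x \<notin> \<Omega> \<longrightarrow> u x \<ge> 0)
       \<longrightarrow> (AE x in lebesgue. u x \<ge> 0))"

end

theory Submission
  imports Defs "HOL-Complex_Analysis.Great_Picard"
begin

text \<open>
  Let \<open>k\<^sub>s(z) = (s/\<pi>)\<^bsup>N/2\<^esup> exp(-s\<bar>z\<bar>\<^sup>2)\<close> be the heat kernel at time \<open>1/(4s)\<close>. Since \<open>c\<^sub>N \<bar>z\<bar>\<^bsup>-N\<^esup>\<close> is the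
  integral of \<open>k\<^sub>s(z)\<close> against \<open>ds/s\<close> over \<open>s > 0\<close>, for \<open>\<parallel>u\<parallel> = 1\<close> one gets
  \<open>E\<^sub>L(u,u) - \<rho>\<^sub>N = \<integral> (\<integral>\<^bsub>\<bar>z\<bar>\<le>1\<^esub> k\<^sub>s - \<langle>u, k\<^sub>s * u\<rangle>) ds/s\<close>. The semigroup law and the Cauchy-Schwarz inequality make
  \<open>\<langle>u, k\<^sub>s * u\<rangle>\<close> midpoint log-convex in time, which together with its first-order expansion at time \<open>0\<close>
  gives \<open>\<langle>u, k\<^sub>s * u\<rangle> \<ge> exp(-\<parallel>\<nabla>u\<parallel>\<^sup>2/(4s))\<close>. The remaining one-dimensional integral is
  \<open>log \<parallel>\<nabla>u\<parallel>\<^sup>2 - \<rho>\<^sub>N\<close>, so \<open>E\<^sub>L(u,u) \<le> log \<parallel>\<nabla>u\<parallel>\<^sup>2\<close> for test functions, without any Fourier transform.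

  If \<open>\<lambda>\<^sub>1\<^sup>1 \<le> 1\<close>, then \<open>\<lambda>\<^sub>1\<^sup>L \<le> 0\<close>. Functions of bounded energy are precompact in \<open>L\<^sup>2\<close> because \<open>\<bar>z\<bar>\<^bsup>-N\<^esup>\<close> is not
  integrable at \<open>0\<close>, so there is a minimizer of \<open>E\<^sub>L\<close>, which may be replaced by its absolute value
  \<open>v \<ge> 0\<close>. Then \<open>E\<^sub>L(-v,\<phi>) = -\<lambda>\<^sub>1\<^sup>L \<integral> v \<phi> \<ge> 0\<close> for \<open>\<phi> \<ge> 0\<close>, and \<open>-v\<close> violates the maximum principle.
\<close>

text \<open>The constant rho_N has a probabilistic origin. If Z has density k_s, then s |Z|^2 has
  the Gamma distribution of shape N/2, so the mass of k_s in the unit ball is a distribution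
  function evaluated at s; exp(-l/(4s)) is the distribution function of l/(4X) with X exponential. A
  layer-cake formula for ln turns the ds/s integral of a difference of two distribution functions
  into a difference of means of ln, hence into Digamma (N/2) and Digamma 1.

  \<open>first_dirichlet_eigenvalue\<close> is an infimum of reals over all weak eigenvalues, so a
  bound below every eigenvalue says something only once an eigenvalue has been exhibited. Its
  construction and the minimizer of E_L rest on the same compactness lemma, because the Dirichlet
  integral controls the near part of the energy.

  The definitions integrate with respect to completed Lebesgue measure, whereas the Fubini arguments
  run on products of Borel measures; hence the repeated passage to Borel representatives.\<close>

abbreviation lborel\<^sub>2 :: "('a::euclidean_space \<times> 'a) measure" where
  "lborel\<^sub>2 \<equiv> lborel \<Otimes>\<^sub>M lborel"

abbreviation sq_int :: "('a::euclidean_space \<Rightarrow> real) \<Rightarrow> real" where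
  "sq_int f \<equiv> \<integral>x. (f x)\<^sup>2 \<partial>lborel"

abbreviation sq_norm :: "('a::euclidean_space \<Rightarrow> 'b::real_normed_vector) \<Rightarrow> real" where
  "sq_norm f \<equiv> \<integral>x. (norm (f x))\<^sup>2 \<partial>lborel"

subsection \<open>Integrals over the half-line\<close>

lemma has_bochner_integral_Gamma:
  fixes a b :: real
  assumes a: "a > 0" and b: "b > 0"
  shows "has_bochner_integral lborel
    (\<lambda>v. indicator {0<..} v * (v powr (a - 1) * exp (- b * v))) (Gamma a / b powr a)"
proof -
  let ?f = "\<lambda>v::real. indicator {0<..} v * (v powr (a - 1) * exp (- b * v))"
  let ?g = "\<lambda>v::real. indicator {0<..} v * (v powr (a - 1) * exp (- v))"
  have ind0: "indicator {0<..} (v::real) * (v powr (a - 1) * exp (- v)) =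
    indicator {0..} v * (v powr (a - 1) / exp v)" for v
    by (auto simp: indicator_def exp_minus field_simps)
  have Gn: "(\<integral>\<^sup>+v. ?g v \<partial>lborel) = ennreal (Gamma a)"
    unfolding ind0
    using Gamma_integral_real[OF a]
    by (subst nn_integral_has_integral_lebesgue) auto
  have "(\<integral>\<^sup>+v. ?g v \<partial>lborel) = \<bar>b\<bar> * (\<integral>\<^sup>+v. ?g (0 + b * v) \<partial>lborel)"
    using b by (intro nn_integral_real_affine) auto
  also have "(\<integral>\<^sup>+v. ?g (0 + b * v) \<partial>lborel) = (\<integral>\<^sup>+v. ennreal (b powr (a-1)) * ?f v \<partial>lborel)"
    using b by (intro nn_integral_cong)
      (auto simp: indicator_def powr_mult zero_less_mult_iff ennreal_mult[symmetric] mult_ac)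
  also have "\<dots> = ennreal (b powr (a-1)) * (\<integral>\<^sup>+v. ?f v \<partial>lborel)"
    by (intro nn_integral_cmult) auto
  finally have 1: "ennreal (Gamma a) = ennreal (b powr a) * (\<integral>\<^sup>+v. ?f v \<partial>lborel)"
    using b Gn by (simp add: mult.assoc[symmetric] ennreal_mult[symmetric] powr_diff)
  have "(\<integral>\<^sup>+v. ?f v \<partial>lborel) = ennreal (inverse (b powr a)) * (ennreal (b powr a) * (\<integral>\<^sup>+v. ?f v \<partial>lborel))"
    using b by (simp add: mult.assoc[symmetric] ennreal_mult[symmetric])
  also have "\<dots> = ennreal (Gamma a / b powr a)"
    unfolding 1[symmetric] using a b by (simp add: ennreal_mult[symmetric] field_simps Gamma_real_pos less_imp_le)
  finally show ?thesis
    using a b by (intro has_bochner_integral_nn_integral) (auto simp: Gamma_real_pos less_imp_le)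
qed

text \<open>Both bounds are 1 + y <= exp y, at y = -h ln v and at y = h ln v. They trap ln v between
  difference quotients of powers, so that Euler's integral can be differentiated by
  squeezing.\<close>

lemma powr_minus_one_quotient_bounds:
  fixes v h :: real
  assumes "v > 0" "h > 0"
  shows "(1 - v powr (- h)) / h \<le> ln v" "ln v \<le> (v powr h - 1) / h"
proof -
  have "1 + h * ln v \<le> v powr h" "1 + (-h) * ln v \<le> v powr (-h)"
    using assms exp_ge_add_one_self[of "h * ln v"] exp_ge_add_one_self[of "- h * ln v"] by (simp_all add: powr_def)
  then show "(1 - v powr (- h)) / h \<le> ln v" "ln v \<le> (v powr h - 1) / h"
    using assms by (simp_all add: field_simps)
qed

text \<open>This is Gamma' = Gamma * Digamma read under Euler's integral. The difference quotient of
  Gamma with increment h is the integral of \<open>U h\<close>; since \<open>U (-h)\<close> and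
  \<open>U h\<close> enclose the logarithmic integrand, its integral is the common limit.\<close>

lemma has_bochner_integral_Gamma_ln:
  fixes a :: real
  assumes a: "a > 0"
  shows "has_bochner_integral lborel
    (\<lambda>v. indicator {0<..} v * (v powr (a - 1) * exp (- v)) * ln v) (Gamma a * Digamma a)"
proof -
  let ?g = "\<lambda>v::real. indicator {0<..} v * (v powr (a - 1) * exp (- v))"
  define U where "U h v = ?g v * ((v powr h - 1) / h)" for h v :: real
  have hb: "has_bochner_integral lborel (U h) ((Gamma (a + h) - Gamma a) / h)"
    if "a + h > 0" "h \<noteq> 0" for h
  proof -
    have "has_bochner_integral lborel (\<lambda>v. (indicator {0<..} v * (v powr (a + h - 1) * exp (- 1 * v)) -
        indicator {0<..} v * (v powr (a - 1) * exp (- 1 * v))) / h) ((Gamma (a + h) / 1 powr (a+h) - Gamma a / 1 powr a) / h)"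
      using that a by (intro has_bochner_integral_divide_zero has_bochner_integral_diff has_bochner_integral_Gamma) auto
    moreover have "(\<lambda>v. (indicator {0<..} v * (v powr (a + h - 1) * exp (- 1 * v)) -
        indicator {0<..} v * (v powr (a - 1) * exp (- 1 * v))) / h) = U h"
      using that by (auto simp: U_def fun_eq_iff indicator_def field_simps powr_add powr_diff)
    ultimately show ?thesis by simp
  qed
  have upper: "?g v * ln v \<le> U h v" if "h > 0" for h v
    using powr_minus_one_quotient_bounds(2)[of v h] that
    by (auto simp: U_def indicator_def simp del: times_divide_eq_right intro!: mult_left_mono)
  have lower: "U (-h) v \<le> ?g v * ln v" if "h > 0" for h v
    using powr_minus_one_quotient_bounds(1)[of v h] that
    by (auto simp: U_def indicator_def minus_divide_left[symmetric] diff_divide_distrib simp del: times_divide_eq_right intro!: mult_left_mono)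
  \<comment> \<open>The increments a/2 and -a/2 keep both shifted arguments of Gamma positive, and
    the two quotients together dominate the integrand.\<close>
  have int: "integrable lborel (\<lambda>v. ?g v * ln v)"
  proof (rule Bochner_Integration.integrable_bound)
    show "integrable lborel (\<lambda>v. \<bar>U (a/2) v\<bar> + \<bar>U (-(a/2)) v\<bar>)"
      using hb[of "a/2"] hb[of "-(a/2)"] a
      by (intro Bochner_Integration.integrable_add integrable_abs) (auto simp: has_bochner_integral_iff)
    show "AE v in lborel. norm (?g v * ln v) \<le> norm (\<bar>U (a/2) v\<bar> + \<bar>U (-(a/2)) v\<bar>)"
    proof (rule AE_I2)
      fix v :: real
      show "norm (?g v * ln v) \<le> norm (\<bar>U (a/2) v\<bar> + \<bar>U (-(a/2)) v\<bar>)"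
        using upper[of "a/2" v] lower[of "a/2" v] a by (simp only: real_norm_def) linarith
    qed
  qed simp
  let ?I = "\<integral>v. ?g v * ln v \<partial>lborel"
  have "((\<lambda>h. (Gamma (a + h) - Gamma a) / h) \<longlongrightarrow> Gamma a * Digamma a) (at 0)"
    using has_field_derivative_Gamma[of a UNIV] nonpos_Ints_nonpos[of a] a
    by (auto simp: DERIV_def)
  then have lim: "(\<lambda>n. (Gamma (a + s n) - Gamma a) / s n) \<longlonglongrightarrow> Gamma a * Digamma a"
    if "s \<longlonglongrightarrow> 0" "\<And>n. s n \<noteq> 0" for s :: "nat \<Rightarrow> real"
    by (rule filterlim_compose) (use that in \<open>auto simp: filterlim_at\<close>)
  \<comment> \<open>The offset 2 gives 0 < s n < a already at n = 0, so that a - s n stays in the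
    range of Euler's integral.\<close>
  define s where "s n = a / real (n + 2)" for n
  have s0: "s \<longlonglongrightarrow> 0"
    unfolding s_def using LIMSEQ_ignore_initial_segment[OF lim_const_over_n[of a], of 2] by simp
  have sp: "s n > 0" "s n < a" for n using a by (auto simp: s_def field_simps add_pos_nonneg)
  have "?I \<le> (Gamma (a + s n) - Gamma a) / s n" for n
    using hb[of "s n"] sp[of n] a integral_mono[OF int _ upper[of "s n"]]
    by (auto simp: has_bochner_integral_iff)
  then have 1: "?I \<le> Gamma a * Digamma a"
    using sp(1) s0 by (intro LIMSEQ_le_const[OF lim[of s]]) (auto simp: less_imp_neq[symmetric])
  have "?I \<ge> (Gamma (a + - s n) - Gamma a) / - s n" for n
    using hb[of "- s n"] sp[of n] a integral_mono[OF _ int lower[of "s n"]]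
    by (auto simp: has_bochner_integral_iff)
  then have 2: "?I \<ge> Gamma a * Digamma a"
    using sp(1) tendsto_minus[OF s0] by (intro LIMSEQ_le_const2[OF lim[of "\<lambda>n. - s n"]]) (auto simp: less_imp_neq[symmetric])
  from 1 2 int show ?thesis by (simp add: has_bochner_integral_iff)
qed

text \<open>Up to endpoints, D is the signed indicator of the interval between v and 1, divided by
  s. The second claim is the absolute bound that Fubini asks for in
  \<open>log_layer_cake\<close>.\<close>

lemma has_bochner_integral_log_step:
  fixes v :: real
  assumes v: "v > 0"
  defines "D \<equiv> \<lambda>s. indicator {0<..} s * (((if v \<le> s then 1 else 0) - (if 1 \<le> s then 1 else 0)) / s)"
  shows "has_bochner_integral lborel D (- ln v)"
    and "has_bochner_integral lborel (\<lambda>s. \<bar>D s\<bar>) \<bar>ln v\<bar>"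
proof -
  have FTC: "has_bochner_integral lborel (\<lambda>s. indicator {a..b} s * (1 / s)) (ln b - ln a)"
    if "0 < a" "a \<le> b" for a b :: real
  proof -
    have "has_bochner_integral lborel (\<lambda>s. indicator {a..b} s *\<^sub>R (1 / s)) (ln b - ln a)"
      using that by (intro has_bochner_integral_FTC_Icc)
        (auto intro!: derivative_eq_intros continuous_intros
           simp: has_real_derivative_iff_has_vector_derivative[symmetric])
    then show ?thesis by simp
  qed
  have AE1: "AE s in lborel. s \<noteq> c" for c :: real
    by (rule AE_lborel_singleton)
  have m[measurable]: "D \<in> borel_measurable lborel" unfolding D_def by measurable
  have "has_bochner_integral lborel D (- ln v) \<and> has_bochner_integral lborel (\<lambda>s. \<bar>D s\<bar>) \<bar>ln v\<bar>"
  proof (cases "v \<le> 1")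
    case True
    have 1: "has_bochner_integral lborel (\<lambda>s. indicator {v..1} s * (1 / s)) (- ln v)"
      using FTC[of v 1] v True by simp
    have 2: "AE s in lborel. D s = indicator {v..1} s * (1 / s)"
      using AE1[of 1] by eventually_elim (use v True in \<open>auto simp: D_def indicator_def\<close>)
    have 3: "AE s in lborel. \<bar>D s\<bar> = indicator {v..1} s * (1 / s)"
      using 2 by eventually_elim (use v in \<open>auto simp: indicator_def\<close>)
    have "\<bar>ln v\<bar> = - ln v" using v True by simp
    with 1 show ?thesis
      by (auto simp: has_bochner_integral_cong_AE[OF _ _ 2] has_bochner_integral_cong_AE[OF _ _ 3])
  next
    case False
    have 1: "has_bochner_integral lborel (\<lambda>s. indicator {1..v} s * (1 / s)) (ln v)"
      using FTC[of 1 v] False by simp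
    have 2: "AE s in lborel. D s = - (indicator {1..v} s * (1 / s))"
      using AE1[of v] by eventually_elim (use v False in \<open>auto simp: D_def indicator_def\<close>)
    have 3: "AE s in lborel. \<bar>D s\<bar> = indicator {1..v} s * (1 / s)"
      using 2 by eventually_elim (use v in \<open>auto simp: indicator_def\<close>)
    have "\<bar>ln v\<bar> = ln v" using False by simp
    with 1 has_bochner_integral_minus[OF 1] show ?thesis
      by (auto simp: has_bochner_integral_cong_AE[OF _ _ 2] has_bochner_integral_cong_AE[OF _ _ 3])
  qed
  then show "has_bochner_integral lborel D (- ln v)"
    and "has_bochner_integral lborel (\<lambda>s. \<bar>D s\<bar>) \<bar>ln v\<bar>" by auto
qed

text \<open>Integrate the step function of \<open>has_bochner_integral_log_step\<close> over v = X
  and exchange the integrals. Subtracting the indicator of s >= 1 tames ds/s at infinity, and it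
  cancels when two such formulas are subtracted from each other.\<close>

lemma log_layer_cake:
  fixes X :: "'a \<Rightarrow> real"
  assumes M: "emeasure M (space M) = 1"
    and X[measurable]: "X \<in> borel_measurable M" and pos: "AE x in M. X x > 0"
    and int: "integrable M (\<lambda>x. ln (X x))"
  shows "has_bochner_integral lborel
    (\<lambda>s. indicator {0<..} s * ((measure M {x\<in>space M. X x \<le> s} - (if 1 \<le> s then 1 else 0)) / s))
    (- (\<integral>x. ln (X x) \<partial>M))"
proof -
  interpret finite_measure M by (rule finite_measureI) (simp add: M)
  interpret P: pair_sigma_finite M "lborel :: real measure" ..
  define D where "D v s = indicator {0<..} s * (((if v \<le> s then 1 else 0) - (if 1 \<le> s then 1 else 0)) / s)" for v s :: real
  have m[measurable]: "(\<lambda>(x, s). D (X x) s) \<in> borel_measurable (M \<Otimes>\<^sub>M lborel)"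
    unfolding D_def by measurable
  note step = has_bochner_integral_log_step[folded D_def]
  have mF: "(\<lambda>x. \<integral>s. \<bar>D (X x) s\<bar> \<partial>lborel) \<in> borel_measurable M"
    by measurable
  have mF2: "(\<lambda>x. \<integral>s. D (X x) s \<partial>lborel) \<in> borel_measurable M"
    by measurable
  have I: "integrable (M \<Otimes>\<^sub>M lborel) (\<lambda>(x, s). D (X x) s)"
  proof (rule P.Fubini_integrable)
    have "integrable M (\<lambda>x. \<bar>ln (X x)\<bar>)" using int by simp
    moreover have "AE x in M. \<bar>ln (X x)\<bar> = (\<integral>s. norm (case (x, s) of (x, s) \<Rightarrow> D (X x) s) \<partial>lborel)"
      using pos by eventually_elim (use step(2) in \<open>auto simp: has_bochner_integral_iff\<close>)
    moreover have "(\<lambda>x. \<integral>s. norm (case (x, s) of (x, s) \<Rightarrow> D (X x) s) \<partial>lborel) \<in> borel_measurable M"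
      using mF by simp
    ultimately show "integrable M (\<lambda>x. \<integral>s. norm (case (x, s) of (x, s) \<Rightarrow> D (X x) s) \<partial>lborel)"
      using integrable_cong_AE_imp by blast
    show "AE x in M. integrable lborel (\<lambda>s. case (x, s) of (x, s) \<Rightarrow> D (X x) s)"
      using pos by eventually_elim (use step(1) in \<open>auto simp: has_bochner_integral_iff\<close>)
  qed (rule m)
  have inner: "(\<integral>x. D (X x) s \<partial>M) =
      indicator {0<..} s * ((measure M {x\<in>space M. X x \<le> s} - (if 1 \<le> s then 1 else 0)) / s)" for s
  proof -
    have "(\<integral>x. D (X x) s \<partial>M) = (\<integral>x. indicator {0<..} s * ((indicator {x\<in>space M. X x \<le> s} x - (if 1 \<le> s then 1 else 0)) / s) \<partial>M)"
      by (intro Bochner_Integration.integral_cong) (auto simp: D_def indicator_def)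
    also have "\<dots> = indicator {0<..} s * ((measure M {x\<in>space M. X x \<le> s} - (if 1 \<le> s then 1 else 0)) / s)"
      using M by (subst integral_mult_right_zero, subst integral_divide_zero, subst Bochner_Integration.integral_diff)
        (auto simp: measure_def integrable_real_indicator less_top[symmetric])
    finally show ?thesis .
  qed
  have eq: "(\<integral>s. (\<integral>x. D (X x) s \<partial>M) \<partial>lborel) = (\<integral>x. (\<integral>s. D (X x) s \<partial>lborel) \<partial>M)"
    by (rule P.Fubini_integral[OF I])
  also have "\<dots> = (\<integral>x. - ln (X x) \<partial>M)"
    using pos by (intro integral_cong_AE) (auto simp: mF2 elim!: eventually_mono dest!: step(1) simp: has_bochner_integral_iff)
  finally show ?thesis
    using P.integrable_snd[OF I] unfolding inner by (simp add: has_bochner_integral_iff)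
qed

subsection \<open>Radial integrals and the heat kernel\<close>

text \<open>Polar coordinates in the variable |z|^2: both measures give the half-line below a the
  volume of the ball of radius sqrt a. With the squared radius as variable, radial Gaussian
  integrals become Gamma integrals directly.\<close>

lemma distr_norm_square_lborel:
  "distr (lborel :: 'a::euclidean_space measure) borel (\<lambda>z. (norm z)\<^sup>2) =
    density lborel (\<lambda>s. ennreal (indicator {0<..} s *
      (pi powr (DIM('a) / 2) / Gamma (DIM('a) / 2) * s powr (DIM('a) / 2 - 1))))"
    (is "?M = density lborel ?d")
proof (rule measure_eqI_generator_eq_countable)
  define n where "n = DIM('a) / 2"
  have n: "n > 0" by (simp add: n_def)
  let ?E = "range (\<lambda>a::real. {..a})"
  have em: "emeasure ?M {..a} = ennreal (if a \<ge> 0 then pi powr n / Gamma (n + 1) * a powr n else 0)" for a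
  proof (cases "a \<ge> 0")
    case True
    have "(norm z)\<^sup>2 \<le> a \<longleftrightarrow> norm z \<le> sqrt a" for z :: 'a
      by (metis abs_norm_cancel real_sqrt_abs real_sqrt_le_iff)
    then have "(\<lambda>z::'a. (norm z)\<^sup>2) -` {..a} \<inter> space lborel = cball 0 (sqrt a)"
      by auto
    moreover have "sqrt a ^ DIM('a) = a powr n"
      using True by (cases "a = 0") (auto simp: n_def powr_half_sqrt[symmetric] powr_powr powr_realpow[symmetric])
    ultimately show ?thesis
      using True by (simp add: emeasure_distr emeasure_cball unit_ball_vol_def n_def)
  next
    case False
    then have "(\<lambda>z::'a. (norm z)\<^sup>2) -` {..a} \<inter> space lborel = {}"
      by (auto simp: not_le dest: order_trans[OF zero_le_power2])
    with False show ?thesis by (simp add: emeasure_distr)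
  qed
  have ed: "emeasure (density lborel ?d) {..a} = ennreal (if a \<ge> 0 then pi powr n / Gamma (n + 1) * a powr n else 0)" for a
  proof (cases "a \<ge> 0")
    case True
    have "((\<lambda>s. s powr (n - 1)) has_integral (a powr n / n)) {0..a}"
      using has_integral_powr_from_0[of "n - 1" a] True n by simp
    then have "((\<lambda>s. pi powr n / Gamma n * s powr (n - 1)) has_integral (pi powr n / Gamma n * (a powr n / n))) {0..a}"
      by (rule has_integral_mult_right)
    then have "(\<integral>\<^sup>+s. ennreal (indicator {0..a} s * (pi powr n / Gamma n * s powr (n - 1))) \<partial>lborel)
       = ennreal (pi powr n / Gamma n * (a powr n / n))"
      using n by (intro nn_integral_has_integral_lebesgue) (auto intro!: mult_nonneg_nonneg divide_nonneg_nonneg simp: Gamma_real_pos less_imp_le)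
    moreover have "(\<integral>\<^sup>+s. ennreal (indicator {0..a} s * (pi powr n / Gamma n * s powr (n - 1))) \<partial>lborel) =
       (\<integral>\<^sup>+s. ?d s * indicator {..a} s \<partial>lborel)"
      by (intro nn_integral_cong) (auto simp: indicator_def n_def)
    moreover have "Gamma (n + 1) = n * Gamma n"
      using n by (intro Gamma_plus1) (auto dest: nonpos_Ints_nonpos)
    ultimately show ?thesis
      using True n by (simp add: emeasure_density mult_ac)
  next
    case False
    then have "(\<integral>\<^sup>+s. ?d s * indicator {..a} s \<partial>lborel) = (\<integral>\<^sup>+s. 0 \<partial>(lborel :: real measure))"
      by (intro nn_integral_cong) (auto simp: indicator_def)
    with False show ?thesis by (simp add: emeasure_density)
  qed
  show "Int_stable ?E"
    by (auto simp: Int_stable_def)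
  show "emeasure ?M X = emeasure (density lborel ?d) X" if "X \<in> ?E" for X
    using that em ed by auto
  show "sets ?M = sigma_sets UNIV ?E" "sets (density lborel ?d) = sigma_sets UNIV ?E"
    by (simp_all add: borel_eq_atMost)
  show "(\<lambda>n. {..real n}) ` UNIV \<subseteq> ?E" "(\<Union>n. {..real n}) = UNIV"
    by (auto simp: real_arch_simple)
  show "emeasure ?M a \<noteq> \<infinity>" if "a \<in> (\<lambda>n. {..real n}) ` UNIV" for a
    using that em by auto
qed auto

lemma nn_integral_radial:
  fixes F :: "real \<Rightarrow> ennreal"
  assumes [measurable]: "F \<in> borel_measurable borel"
  shows "(\<integral>\<^sup>+z. F ((norm z)\<^sup>2) \<partial>(lborel :: 'a::euclidean_space measure)) =
    (\<integral>\<^sup>+s. ennreal (indicator {0<..} s *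
      (pi powr (DIM('a) / 2) / Gamma (DIM('a) / 2) * s powr (DIM('a) / 2 - 1))) * F s \<partial>lborel)"
proof -
  have "(\<integral>\<^sup>+z. F ((norm z)\<^sup>2) \<partial>(lborel :: 'a measure)) =
    (\<integral>\<^sup>+s. F s \<partial>distr (lborel :: 'a measure) borel (\<lambda>z. (norm z)\<^sup>2))"
    by (simp add: nn_integral_distr)
  then show ?thesis
    unfolding distr_norm_square_lborel by (simp add: nn_integral_density)
qed

definition gauss :: "real \<Rightarrow> 'a::euclidean_space \<Rightarrow> real" where
  "gauss s z = (s / pi) powr (DIM('a) / 2) * exp (- s * (norm z)\<^sup>2)"

lemma gauss_nonneg [simp]: "gauss s z \<ge> 0"
  by (simp add: gauss_def)

lemma gauss_uminus [simp]: "gauss s (- z) = gauss s z"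
  by (simp add: gauss_def)

lemma borel_measurable_gauss [measurable]: "(\<lambda>(s, z). gauss s z) \<in> borel_measurable (borel \<Otimes>\<^sub>M borel)"
  unfolding gauss_def by measurable

lemma borel_measurable_gauss' [measurable]:
  "f \<in> borel_measurable M \<Longrightarrow> g \<in> borel_measurable M \<Longrightarrow> (\<lambda>x. gauss (f x) (g x)) \<in> borel_measurable M"
  using measurable_compose[OF measurable_Pair borel_measurable_gauss] by simp

lemma has_bochner_integral_gauss:
  assumes s: "s > 0"
  shows "has_bochner_integral lborel (gauss s :: 'a::euclidean_space \<Rightarrow> real) 1"
proof (rule has_bochner_integral_nn_integral)
  define n where "n = DIM('a) / 2"
  have n: "n > 0" by (simp add: n_def)
  then have gn: "Gamma n \<noteq> 0" using Gamma_real_pos[of n] by linarith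
  have "(\<integral>\<^sup>+z. ennreal (gauss s z) \<partial>(lborel::'a measure)) =
     (\<integral>\<^sup>+r. ennreal (indicator {0<..} r * (pi powr n / Gamma n * r powr (n - 1))) *
       ennreal ((s / pi) powr n * exp (- s * r)) \<partial>lborel)"
    unfolding gauss_def n_def by (rule nn_integral_radial) simp
  also have "\<dots> = (\<integral>\<^sup>+r. ennreal (s powr n / Gamma n) *
      ennreal (indicator {0<..} r * (r powr (n - 1) * exp (- s * r))) \<partial>lborel)"
    using s n by (intro nn_integral_cong)
      (auto simp: ennreal_mult[symmetric] indicator_def powr_divide field_simps Gamma_real_pos less_imp_le)
  also have "\<dots> = ennreal (s powr n / Gamma n) *
      (\<integral>\<^sup>+r. ennreal (indicator {0<..} r * (r powr (n - 1) * exp (- s * r))) \<partial>lborel)"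
    by (intro nn_integral_cmult) auto
  also have "(\<integral>\<^sup>+r. ennreal (indicator {0<..} r * (r powr (n - 1) * exp (- s * r))) \<partial>lborel) = ennreal (Gamma n / s powr n)"
    using has_bochner_integral_Gamma[OF n s]
    by (subst nn_integral_eq_integral) (auto simp: has_bochner_integral_iff)
  also have "ennreal (s powr n / Gamma n) * ennreal (Gamma n / s powr n) = 1"
    using s n gn by (subst ennreal_mult[symmetric]) auto
  finally show "(\<integral>\<^sup>+z. ennreal (gauss s z) \<partial>(lborel::'a measure)) = ennreal 1" by simp
qed (auto simp: gauss_def)

lemma borel_measurable_gauss_space [measurable]: "gauss s \<in> borel_measurable borel"
  using borel_measurable_gauss'[of "\<lambda>_. s" borel "\<lambda>z. z"] by simp

lemma norm_power_DIM: "norm (z :: 'a::euclidean_space) ^ DIM('a) = ((norm z)\<^sup>2) powr (DIM('a) / 2)"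
proof (cases "z = 0")
  case False
  then have "((norm z)\<^sup>2) powr (DIM('a) / 2) = (norm z powr 2) powr (DIM('a) / 2)" by simp
  also have "\<dots> = norm z powr real DIM('a)" unfolding powr_powr by simp
  finally show ?thesis using False by (simp add: powr_realpow)
qed (simp add: zero_power)

lemma has_bochner_integral_gauss_time:
  fixes z :: "'a::euclidean_space"
  assumes z: "z \<noteq> 0"
  shows "has_bochner_integral lborel (\<lambda>s. indicator {0<..} s * (gauss s z / s))
    (c_const DIM('a) / norm z ^ DIM('a))"
proof -
  define n where "n = DIM('a) / 2"
  have n: "n > 0" by (simp add: n_def)
  have "has_bochner_integral lborel (\<lambda>s. pi powr (- n) *
     (indicator {0<..} s * (s powr (n - 1) * exp (- (norm z)\<^sup>2 * s))))
    (pi powr (- n) * (Gamma n / ((norm z)\<^sup>2) powr n))"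
  proof (rule has_bochner_integral_mult_right)
    show "has_bochner_integral lborel (\<lambda>s. indicator {0<..} s * (s powr (n - 1) * exp (- (norm z)\<^sup>2 * s)))
      (Gamma n / ((norm z)\<^sup>2) powr n)"
      by (rule has_bochner_integral_Gamma[OF n]) (simp add: z)
  qed
  moreover have "((norm z)\<^sup>2) powr n = norm z ^ DIM('a)"
    by (simp add: n_def norm_power_DIM)
  moreover have "pi powr (- n) * (indicator {0<..} s * (s powr (n - 1) * exp (- (norm z)\<^sup>2 * s)))
     = indicator {0<..} s * (gauss s z / s)" for s
    by (cases "s > 0")
      (simp_all add: indicator_def gauss_def n_def[symmetric] powr_divide powr_minus_divide powr_diff mult_ac)
  ultimately show ?thesis by (simp add: c_const_def n_def)
qed

section \<open>Gamma distributions and the value of the time integral\<close>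

definition gamma_measure :: "real \<Rightarrow> real measure" where
  "gamma_measure a = density lborel (\<lambda>v. ennreal (indicator {0<..} v * (v powr (a - 1) * exp (- v)) / Gamma a))"

lemma space_gamma_measure [simp]: "space (gamma_measure a) = UNIV"
  and sets_gamma_measure [measurable_cong, simp]: "sets (gamma_measure a) = sets borel"
  by (simp_all add: gamma_measure_def)

lemma gamma_measure_facts:
  assumes a: "a > 0"
  shows "emeasure (gamma_measure a) (space (gamma_measure a)) = 1"
    and "AE v in gamma_measure a. v > 0"
    and "has_bochner_integral (gamma_measure a) ln (Digamma a)"
proof -
  have G: "Gamma a > 0" using a by (rule Gamma_real_pos)
  have "has_bochner_integral lborel (\<lambda>v. indicator {0<..} v * (v powr (a - 1) * exp (- v)) / Gamma a) 1"
    using has_bochner_integral_divide_zero[OF has_bochner_integral_Gamma[OF a, of 1], of "Gamma a"] G by simp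
  then have "(\<integral>\<^sup>+v. ennreal (indicator {0<..} v * (v powr (a - 1) * exp (- v)) / Gamma a) \<partial>lborel) = 1"
    using G by (subst nn_integral_eq_integral) (auto simp: has_bochner_integral_iff)
  then show "emeasure (gamma_measure a) (space (gamma_measure a)) = 1"
    by (simp add: gamma_measure_def emeasure_density)
  show "AE v in gamma_measure a. v > 0"
    unfolding gamma_measure_def by (subst AE_density) (auto simp: indicator_def)
  have *: "has_bochner_integral lborel (\<lambda>v. (indicator {0<..} v * (v powr (a - 1) * exp (- v)) * ln v) / Gamma a) (Digamma a)"
    using has_bochner_integral_divide_zero[OF has_bochner_integral_Gamma_ln[OF a], of "Gamma a"] G by simp
  show "has_bochner_integral (gamma_measure a) ln (Digamma a)"
    unfolding gamma_measure_def using * G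
    by (intro has_bochner_integral_density) (auto simp: field_simps)
qed

lemma measure_gamma_1_ge:
  assumes "c > 0"
  shows "measure (gamma_measure 1) {c..} = exp (- c)"
proof -
  have "(\<integral>\<^sup>+v. ennreal (indicator {c..} v * exp (- 1 * v)) \<partial>lborel) = ennreal (exp (- 1 * c) / 1)"
    by (intro nn_integral_has_integral_lebesgue has_integral_exp_minus_to_infinity) auto
  also have "(\<integral>\<^sup>+v. ennreal (indicator {c..} v * exp (- 1 * v)) \<partial>lborel) = emeasure (gamma_measure 1) {c..}"
    using assms by (auto simp: gamma_measure_def emeasure_density indicator_def intro!: nn_integral_cong)
  finally show ?thesis by (simp add: measure_def)
qed

text \<open>If Z has density \<open>gauss s\<close>, then s |Z|^2 has the Gamma distribution of
  shape N/2, and |Z| <= 1 means s |Z|^2 <= s. This identifies the mass in the unit ball as a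
  distribution function, ready for \<open>log_layer_cake\<close>.\<close>

lemma measure_gamma_atMost:
  assumes s: "s > 0"
  shows "(\<integral>z. indicator (cball 0 1) z * gauss s z \<partial>(lborel :: 'a::euclidean_space measure)) =
    measure (gamma_measure (DIM('a) / 2)) {..s}"
proof -
  define n where "n = DIM('a) / 2"
  have n: "n > 0" by (simp add: n_def)
  have "(\<integral>\<^sup>+z. ennreal (indicator (cball 0 1) z * gauss s z) \<partial>(lborel :: 'a measure)) =
    (\<integral>\<^sup>+z. (\<lambda>r. ennreal (indicator {..1} r * ((s / pi) powr n * exp (- s * r)))) ((norm z)\<^sup>2) \<partial>(lborel :: 'a measure))"
    by (intro nn_integral_cong) (auto simp: gauss_def n_def indicator_def abs_square_le_1)
  also have "\<dots> = (\<integral>\<^sup>+r. ennreal (indicator {0<..} r * (pi powr n / Gamma n * r powr (n - 1))) *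
       ennreal (indicator {..1} r * ((s / pi) powr n * exp (- s * r))) \<partial>lborel)"
    unfolding n_def by (rule nn_integral_radial) simp
  also have "\<dots> = (\<integral>\<^sup>+r. ennreal s * (ennreal (indicator {0<..} (0 + s * r) * ((0 + s * r) powr (n - 1) * exp (- (0 + s * r))) / Gamma n)
       * indicator {..s} (0 + s * r)) \<partial>lborel)"
    using s n by (intro nn_integral_cong)
      (auto simp: ennreal_mult[symmetric] indicator_def powr_divide powr_mult powr_diff field_simps Gamma_real_pos less_imp_le zero_less_mult_iff)
  also have "\<dots> = ennreal \<bar>s\<bar> * (\<integral>\<^sup>+r. (ennreal (indicator {0<..} (0 + s * r) * ((0 + s * r) powr (n - 1) * exp (- (0 + s * r))) / Gamma n)
       * indicator {..s} (0 + s * r)) \<partial>lborel)"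
    using s by (subst nn_integral_cmult) auto
  also have "\<dots> = emeasure (gamma_measure n) {..s}"
    using s by (subst nn_integral_real_affine[symmetric]) (auto simp: gamma_measure_def emeasure_density)
  finally have *: "(\<integral>\<^sup>+z. ennreal (indicator (cball 0 1) z * gauss s z) \<partial>(lborel :: 'a measure)) = emeasure (gamma_measure n) {..s}" .
  have "(\<lambda>z. indicator (cball 0 1) z * gauss s z) \<in> borel_measurable (lborel :: 'a measure)"
    by (intro borel_measurable_times borel_measurable_indicator) simp_all
  then show ?thesis
    by (subst integral_eq_nn_integral) (auto simp: * measure_def n_def)
qed

text \<open>Both terms are distribution functions at s: of a Gamma variable of shape N/2, and of
  l/(4X) with X exponential. The difference of their layer-cake formulas is ln (l/4) - Digamma 1 -
  Digamma (N/2), and Digamma 1 is minus the Euler-Mascheroni constant, which assembles exactly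
  rho_N.\<close>

lemma has_bochner_integral_log_rho:
  assumes l: "l > 0"
  shows "has_bochner_integral lborel (\<lambda>s. indicator {0<..} s *
     (((\<integral>z. indicator (cball 0 1) z * gauss s z \<partial>(lborel :: 'a::euclidean_space measure)) - exp (- l / (4 * s))) / s))
     (ln l - rho_const DIM('a))"
proof -
  define n where "n = DIM('a) / 2"
  have n: "n > 0" by (simp add: n_def)
  note g = gamma_measure_facts[OF n] and e = gamma_measure_facts[of 1, simplified]
  have A: "has_bochner_integral lborel
    (\<lambda>s. indicator {0<..} s * ((measure (gamma_measure n) {..s} - (if 1 \<le> s then 1 else 0)) / s)) (- Digamma n)"
    using log_layer_cake[OF g(1) _ g(2)] g(3) by (simp add: has_bochner_integral_iff atMost_def)
  have *: "has_bochner_integral (gamma_measure 1) (\<lambda>x. ln (l / 4) - ln x) (ln (l / 4) * 1 - Digamma 1)"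
  proof (intro has_bochner_integral_diff)
    have "has_bochner_integral (gamma_measure 1) (\<lambda>x. ln (l / 4) * indicator UNIV x) (ln (l / 4) * measure (gamma_measure 1) UNIV)"
      by (rule has_bochner_integral_mult_right) (rule has_bochner_integral_real_indicator, use e(1) in auto)
    with e(1) show "has_bochner_integral (gamma_measure 1) (\<lambda>x. ln (l / 4)) (ln (l / 4) * 1)"
      by (simp add: measure_def)
  qed (use gamma_measure_facts[of 1] in auto)
  have AEln: "AE x in gamma_measure 1. ln (l / (4 * x)) = ln (l / 4) - ln x"
    using e(2) by eventually_elim (use l in \<open>simp add: ln_div ln_mult\<close>)
  have L: "has_bochner_integral (gamma_measure 1) (\<lambda>x. ln (l / (4 * x))) (ln (l / 4) * 1 - Digamma 1)"
    using * by (subst has_bochner_integral_cong_AE[OF _ _ AEln]) auto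
  have "AE x in gamma_measure 1. l / (4 * x) > 0"
    using e(2) by eventually_elim (use l in simp)
  then have "has_bochner_integral lborel
    (\<lambda>s. indicator {0<..} s * ((measure (gamma_measure 1) {x\<in>space (gamma_measure 1). l / (4 * x) \<le> s} - (if 1 \<le> s then 1 else 0)) / s))
     (- (\<integral>x. ln (l / (4 * x)) \<partial>gamma_measure 1))"
    using L e(1) by (intro log_layer_cake) (auto simp: has_bochner_integral_iff)
  moreover have "measure (gamma_measure 1) {x\<in>space (gamma_measure 1). l / (4 * x) \<le> s} = exp (- l / (4 * s))" if s: "s > 0" for s
  proof -
    have "AE x in gamma_measure 1. (l / (4 * x) \<le> s) = (l / (4 * s) \<le> x)"
      using e(2) by eventually_elim (use l s in \<open>auto simp: field_simps\<close>)
    then have "measure (gamma_measure 1) {x\<in>space (gamma_measure 1). l / (4 * x) \<le> s} = measure (gamma_measure 1) {l / (4 * s)..}"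
      unfolding measure_def by (intro arg_cong[where f=enn2real] emeasure_eq_AE) auto
    then show ?thesis using l s by (simp add: measure_gamma_1_ge)
  qed
  then have "(\<lambda>s. indicator {0<..} s * ((measure (gamma_measure 1) {x\<in>space (gamma_measure 1). l / (4 * x) \<le> s} - (if 1 \<le> s then 1 else 0)) / s))
    = (\<lambda>s. indicator {0<..} s * ((exp (- l / (4 * s)) - (if 1 \<le> s then 1 else 0)) / s))"
    by (auto simp: fun_eq_iff indicator_def)
  ultimately have B: "has_bochner_integral lborel
     (\<lambda>s. indicator {0<..} s * ((exp (- l / (4 * s)) - (if 1 \<le> s then 1 else 0)) / s)) (- (ln (l / 4) * 1 - Digamma 1))"
    using L by (simp add: has_bochner_integral_iff)
  have "ln (4::real) = 2 * ln 2"
    using ln_powr[of 2 2] by simp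
  then have "- Digamma n - - (ln (l / 4) * 1 - Digamma 1) = ln l - rho_const DIM('a)"
    using l by (simp add: rho_const_def n_def ln_div)
  moreover have "indicator {0<..} s * ((measure (gamma_measure n) {..s} - (if 1 \<le> s then 1 else 0)) / s) -
      indicator {0<..} s * ((exp (- l / (4 * s)) - (if 1 \<le> s then 1 else 0)) / s) =
      indicator {0<..} s * (((\<integral>z. indicator (cball 0 1) z * gauss s z \<partial>(lborel :: 'a measure)) - exp (- l / (4 * s))) / s)" for s
    using measure_gamma_atMost[of s, where 'a='a] by (auto simp: indicator_def n_def diff_divide_distrib)
  ultimately show ?thesis
    using has_bochner_integral_diff[OF A B] by simp
qed

subsection \<open>Convolution kernels\<close>

lemma lborel_distr_translate: "distr lborel borel (\<lambda>x. a + x) = (lborel :: 'a::euclidean_space measure)"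
  using lborel_affine[of 1 a] by (simp add: density_1)

lemma lborel_distr_reflect: "distr lborel borel (\<lambda>x. a - x) = (lborel :: 'a::euclidean_space measure)"
  using lborel_affine[of "-1" a] by (simp add: density_1)

lemma nn_integral_lborel_translate:
  fixes f :: "'a::euclidean_space \<Rightarrow> ennreal"
  assumes [measurable]: "f \<in> borel_measurable borel"
  shows "(\<integral>\<^sup>+x. f (x + a) \<partial>lborel) = (\<integral>\<^sup>+x. f x \<partial>lborel)"
  using nn_integral_distr[of "\<lambda>x. a + x" lborel borel f]
  unfolding lborel_distr_translate by (simp add: add.commute[of _ a])

lemma has_bochner_integral_lborel_translate:
  fixes f :: "'a::euclidean_space \<Rightarrow> 'b::{banach, second_countable_topology}"
  assumes "has_bochner_integral lborel f I"
  shows "has_bochner_integral lborel (\<lambda>x. f (x + a)) I"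
  using assms integrable_distr_eq[of "\<lambda>x. a + x" lborel borel f] integral_distr[of "\<lambda>x. a + x" lborel borel f]
    borel_measurable_integrable[of lborel f]
  unfolding lborel_distr_translate by (simp add: has_bochner_integral_iff add.commute[of _ a])

lemma has_bochner_integral_lborel_reflect:
  fixes f :: "'a::euclidean_space \<Rightarrow> 'b::{banach, second_countable_topology}"
  assumes "has_bochner_integral lborel f I"
  shows "has_bochner_integral lborel (\<lambda>x. f (a - x)) I"
  using assms integrable_distr_eq[of "\<lambda>x. a - x" lborel borel f] integral_distr[of "\<lambda>x. a - x" lborel borel f]
    borel_measurable_integrable[of lborel f]
  unfolding lborel_distr_reflect by (simp add: has_bochner_integral_iff)

text \<open>One set of identities serves three families: the Gaussians, the Gaussians cut off at
  distance 1, and the averaging kernels of the compactness proof.\<close>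

locale even_kernel =
  fixes \<kappa> :: "'a::euclidean_space \<Rightarrow> real"
  assumes kernel_measurable [measurable]: "\<kappa> \<in> borel_measurable borel"
    and kernel_nonneg: "\<kappa> z \<ge> 0"
    and kernel_even: "\<kappa> (- z) = \<kappa> z"
    and kernel_integrable: "integrable lborel \<kappa>"
begin

lemma kernel_commute: "\<kappa> (x - y) = \<kappa> (y - x)"
  using kernel_even[of "x - y"] by simp

lemma kernel_section: "has_bochner_integral lborel (\<lambda>y. \<kappa> (x - y)) (\<integral>z. \<kappa> z \<partial>lborel)"
  by (rule has_bochner_integral_lborel_reflect)
    (simp add: has_bochner_integral_iff kernel_integrable)

lemma nn_kernel_section: "(\<integral>\<^sup>+y. ennreal (\<kappa> (x - y)) \<partial>lborel) = ennreal (\<integral>z. \<kappa> z \<partial>lborel)"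
  using kernel_section[of x] by (subst nn_integral_eq_integral) (auto simp: has_bochner_integral_iff kernel_nonneg)

context
  fixes w :: "'a \<Rightarrow> real"
  assumes w[measurable]: "w \<in> borel_measurable borel" and w2: "integrable lborel (\<lambda>x. (w x)\<^sup>2)"
begin

lemma kernel_square_fst:
  "has_bochner_integral lborel\<^sub>2 (\<lambda>(x, y). \<kappa> (x - y) * (w x)\<^sup>2)
    ((\<integral>z. \<kappa> z \<partial>lborel) * sq_int w)"
proof (rule has_bochner_integral_nn_integral)
  have "(\<integral>\<^sup>+p. ennreal (case p of (x, y) \<Rightarrow> \<kappa> (x - y) * (w x)\<^sup>2) \<partial>lborel\<^sub>2) =
    (\<integral>\<^sup>+x. \<integral>\<^sup>+y. ennreal (\<kappa> (x - y) * (w x)\<^sup>2) \<partial>lborel \<partial>lborel)"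
    by (subst lborel.nn_integral_fst[symmetric]) auto
  also have "\<dots> = (\<integral>\<^sup>+x. ennreal (\<integral>z. \<kappa> z \<partial>lborel) * ennreal ((w x)\<^sup>2) \<partial>lborel)"
    by (intro nn_integral_cong) (simp add: ennreal_mult kernel_nonneg nn_integral_multc nn_kernel_section)
  also have "\<dots> = ennreal (\<integral>z. \<kappa> z \<partial>lborel) * ennreal (sq_int w)"
    using w2 by (simp add: nn_integral_cmult nn_integral_eq_integral)
  finally show "(\<integral>\<^sup>+p. ennreal (case p of (x, y) \<Rightarrow> \<kappa> (x - y) * (w x)\<^sup>2) \<partial>lborel\<^sub>2) =
    ennreal ((\<integral>z. \<kappa> z \<partial>lborel) * sq_int w)"
    by (simp add: ennreal_mult' kernel_nonneg)
qed (auto simp: kernel_nonneg)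

lemma kernel_square_snd:
  "has_bochner_integral lborel\<^sub>2 (\<lambda>(x, y). \<kappa> (x - y) * (w y)\<^sup>2)
    ((\<integral>z. \<kappa> z \<partial>lborel) * sq_int w)"
proof (rule has_bochner_integral_nn_integral)
  have "(\<integral>\<^sup>+p. ennreal (case p of (x, y) \<Rightarrow> \<kappa> (x - y) * (w y)\<^sup>2) \<partial>lborel\<^sub>2) =
    (\<integral>\<^sup>+y. \<integral>\<^sup>+x. ennreal (\<kappa> (y - x) * (w y)\<^sup>2) \<partial>lborel \<partial>lborel)"
    by (subst lborel_pair.nn_integral_snd[symmetric]) (auto simp: kernel_commute)
  also have "\<dots> = (\<integral>\<^sup>+x. ennreal (\<integral>z. \<kappa> z \<partial>lborel) * ennreal ((w x)\<^sup>2) \<partial>lborel)"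
    by (intro nn_integral_cong) (simp add: ennreal_mult kernel_nonneg nn_integral_multc nn_kernel_section)
  also have "\<dots> = ennreal (\<integral>z. \<kappa> z \<partial>lborel) * ennreal (sq_int w)"
    using w2 by (simp add: nn_integral_cmult nn_integral_eq_integral)
  finally show "(\<integral>\<^sup>+p. ennreal (case p of (x, y) \<Rightarrow> \<kappa> (x - y) * (w y)\<^sup>2) \<partial>lborel\<^sub>2) =
    ennreal ((\<integral>z. \<kappa> z \<partial>lborel) * sq_int w)"
    by (simp add: ennreal_mult' kernel_nonneg)
qed (auto simp: kernel_nonneg)

lemma kernel_form_integrable:
  "integrable lborel\<^sub>2 (\<lambda>(x, y). \<kappa> (x - y) * (w x * w y))"
proof (rule Bochner_Integration.integrable_bound)
  show "integrable lborel\<^sub>2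
      (\<lambda>p. (case p of (x, y) \<Rightarrow> \<kappa> (x - y) * (w x)\<^sup>2) + (case p of (x, y) \<Rightarrow> \<kappa> (x - y) * (w y)\<^sup>2))"
    using kernel_square_fst kernel_square_snd by (auto simp: has_bochner_integral_iff)
  have "\<bar>\<kappa> (x - y) * (w x * w y)\<bar> \<le> \<bar>\<kappa> (x - y) * (w x)\<^sup>2 + \<kappa> (x - y) * (w y)\<^sup>2\<bar>" for x y
  proof -
    have "\<bar>w x * w y\<bar> \<le> (w x)\<^sup>2 + (w y)\<^sup>2"
    proof -
      have "2 * (\<bar>w x\<bar> * \<bar>w y\<bar>) \<le> (w x)\<^sup>2 + (w y)\<^sup>2"
        using sum_squares_bound[of "\<bar>w x\<bar>" "\<bar>w y\<bar>"] by (simp add: mult.assoc)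
      moreover have "0 \<le> \<bar>w x\<bar> * \<bar>w y\<bar>" by simp
      ultimately show ?thesis unfolding abs_mult by linarith
    qed
    then have "\<kappa> (x - y) * \<bar>w x * w y\<bar> \<le> \<kappa> (x - y) * ((w x)\<^sup>2 + (w y)\<^sup>2)"
      by (intro mult_left_mono kernel_nonneg)
    then show ?thesis by (simp add: abs_mult kernel_nonneg distrib_left)
  qed
  then show "AE p in lborel\<^sub>2. norm (case p of (x, y) \<Rightarrow> \<kappa> (x - y) * (w x * w y)) \<le>
     norm ((case p of (x, y) \<Rightarrow> \<kappa> (x - y) * (w x)\<^sup>2) + (case p of (x, y) \<Rightarrow> \<kappa> (x - y) * (w y)\<^sup>2))"
    by (auto simp: split_beta)
qed measurable

text \<open>Expand the square; integrability of the kernel is what allows the three terms to be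
  integrated separately. The kernel |z|^(-N) itself fails this at the origin, so it is only reached
  through integrable kernels: Gaussians at fixed s, or averaging kernels below it.\<close>

lemma kernel_form_diff:
  "has_bochner_integral lborel\<^sub>2 (\<lambda>(x, y). \<kappa> (x - y) * (w x - w y)\<^sup>2)
    (2 * (\<integral>z. \<kappa> z \<partial>lborel) * sq_int w -
     2 * (\<integral>p. (case p of (x, y) \<Rightarrow> \<kappa> (x - y) * (w x * w y)) \<partial>lborel\<^sub>2))"
proof -
  have "has_bochner_integral lborel\<^sub>2 (\<lambda>p. (case p of (x, y) \<Rightarrow> \<kappa> (x - y) * (w x)\<^sup>2) +
     (case p of (x, y) \<Rightarrow> \<kappa> (x - y) * (w y)\<^sup>2) - (case p of (x, y) \<Rightarrow> \<kappa> (x - y) * (w x * w y)) - (case p of (x, y) \<Rightarrow> \<kappa> (x - y) * (w x * w y)))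
   ((\<integral>z. \<kappa> z \<partial>lborel) * sq_int w + (\<integral>z. \<kappa> z \<partial>lborel) * sq_int w
     - (\<integral>p. (case p of (x, y) \<Rightarrow> \<kappa> (x - y) * (w x * w y)) \<partial>lborel\<^sub>2)
     - (\<integral>p. (case p of (x, y) \<Rightarrow> \<kappa> (x - y) * (w x * w y)) \<partial>lborel\<^sub>2))"
    by (intro has_bochner_integral_add has_bochner_integral_diff kernel_square_fst kernel_square_snd
       has_bochner_integral_integrable kernel_form_integrable)
  moreover have "(\<lambda>p. (case p of (x, y) \<Rightarrow> \<kappa> (x - y) * (w x)\<^sup>2) + (case p of (x, y) \<Rightarrow> \<kappa> (x - y) * (w y)\<^sup>2) -
      (case p of (x, y) \<Rightarrow> \<kappa> (x - y) * (w x * w y)) - (case p of (x, y) \<Rightarrow> \<kappa> (x - y) * (w x * w y))) =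
     (\<lambda>(x, y). \<kappa> (x - y) * (w x - w y)\<^sup>2)"
    by (auto simp: fun_eq_iff power2_diff distrib_left right_diff_distrib)
  ultimately show ?thesis
    by (simp add: mult.assoc)
qed

end

end

lemma gauss_even_kernel: "s > 0 \<Longrightarrow> even_kernel (gauss s)"
  using has_bochner_integral_gauss[of s] by unfold_locales (auto simp: has_bochner_integral_iff)

text \<open>Completing the square in w about the midpoint of x and y. Integrated over w this is the
  semigroup law: two heat steps of time 1/(8s) make one of time 1/(4s).\<close>

lemma gauss_mult_gauss:
  fixes x y w :: "'a::euclidean_space"
  assumes "s > 0"
  shows "gauss (2 * s) (x - w) * gauss (2 * s) (w - y) = gauss s (x - y) * gauss (4 * s) (w - (1/2) *\<^sub>R (x + y))"
proof -
  have "(norm (x - w))\<^sup>2 + (norm (w - y))\<^sup>2 = 2 * (norm (w - (1/2) *\<^sub>R (x + y)))\<^sup>2 + (norm (x - y))\<^sup>2 / 2"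
    by (simp add: power2_norm_eq_inner inner_diff inner_add inner_commute algebra_simps field_simps)
  then have "- (2 * s) * (norm (x - w))\<^sup>2 + - (2 * s) * (norm (w - y))\<^sup>2 =
      - s * (norm (x - y))\<^sup>2 + - (4 * s) * (norm (w - (1/2) *\<^sub>R (x + y)))\<^sup>2"
    by algebra
  moreover have "(2 * s / pi) powr (DIM('a) / 2) * (2 * s / pi) powr (DIM('a) / 2) =
     (s / pi) powr (DIM('a) / 2) * (4 * s / pi) powr (DIM('a) / 2)"
    using assms by (subst (1 2) powr_mult[symmetric]) (auto simp: field_simps)
  moreover have "A * exp a * (A * exp b) = B * exp c * (C * exp d)"
    if "a + b = c + d" "A * A = B * C" for A B C a b c d :: real
  proof -
    have "A * exp a * (A * exp b) = (A * A) * exp (a + b)" by (simp add: exp_add)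
    also have "\<dots> = B * exp c * (C * exp d)" by (simp add: that exp_add)
    finally show ?thesis .
  qed
  ultimately show ?thesis
    unfolding gauss_def by blast
qed

lemma has_bochner_integral_gauss_mult_gauss:
  fixes x y :: "'a::euclidean_space"
  assumes "s > 0"
  shows "has_bochner_integral lborel (\<lambda>w. gauss (2 * s) (x - w) * gauss (2 * s) (w - y)) (gauss s (x - y))"
proof -
  have "has_bochner_integral lborel (\<lambda>w. gauss (4 * s) (w + - ((1/2) *\<^sub>R (x + y)))) 1"
    by (rule has_bochner_integral_lborel_translate[OF has_bochner_integral_gauss]) (use assms in auto)
  then have "has_bochner_integral lborel (\<lambda>w. gauss s (x - y) * gauss (4 * s) (w - (1/2) *\<^sub>R (x + y))) (gauss s (x - y) * 1)"
    by (intro has_bochner_integral_mult_right) simp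
  then show ?thesis
    using assms by (simp add: gauss_mult_gauss)
qed

section \<open>Exponential lower bound for the heat form\<close>

definition heat_form :: "real \<Rightarrow> ('a::euclidean_space \<Rightarrow> real) \<Rightarrow> real" where
  "heat_form s u = (\<integral>p. (case p of (x, y) \<Rightarrow> gauss s (x - y) * (u x * u y)) \<partial>lborel\<^sub>2)"

text \<open>Let P be the heat flow over time 1/(8s). Then \<open>heat_form s u\<close> is the square
  norm of P u and \<open>heat_form (2 * s) u\<close> is the inner product of u with P u, so the
  claim is the Cauchy-Schwarz inequality against the unit vector u.\<close>

lemma heat_form_double:
  fixes u :: "'a::euclidean_space \<Rightarrow> real"
  assumes u[measurable]: "u \<in> borel_measurable borel" and u2: "integrable lborel (\<lambda>x. (u x)\<^sup>2)"
    and s: "s > 0" and norm: "sq_int u = 1"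
  shows "(heat_form (2 * s) u)\<^sup>2 \<le> heat_form s u"
proof -
  interpret k: even_kernel "gauss s :: 'a \<Rightarrow> real" using s by (rule gauss_even_kernel)
  interpret k2: even_kernel "gauss (2 * s) :: 'a \<Rightarrow> real" using s by (intro gauss_even_kernel) simp
  interpret LL: sigma_finite_measure "lborel\<^sub>2 :: ('a \<times> 'a) measure"
    unfolding lborel_prod by (rule lborel.sigma_finite_measure_axioms)
  interpret P: pair_sigma_finite "lborel\<^sub>2 :: ('a \<times> 'a) measure" "lborel :: 'a measure" ..
  \<comment> \<open>The triple integrand: over w it gives the integrand of
    \<open>heat_form s u\<close> by the semigroup law, over the pair p it factors into
    \<open>(v w)\<^sup>2\<close>.\<close>
  define T where "T p w = gauss (2 * s) (fst p - w) * gauss (2 * s) (w - snd p) * (u (fst p) * u (snd p))" for p and w :: 'a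
  define v where "v w = (\<integral>x. gauss (2 * s) (w - x) * u x \<partial>lborel)" for w
  have mT[measurable]: "(\<lambda>(p, w). T p w) \<in> borel_measurable (lborel\<^sub>2 \<Otimes>\<^sub>M lborel)"
    unfolding T_def by measurable
  have mv[measurable]: "v \<in> borel_measurable lborel"
    unfolding v_def by measurable
  have Tw: "has_bochner_integral lborel (T p) (gauss s (fst p - snd p) * (u (fst p) * u (snd p)))" for p
    unfolding T_def by (intro has_bochner_integral_mult_left has_bochner_integral_gauss_mult_gauss s)
  have Tn: "(\<integral>w. norm (T p w) \<partial>lborel) = gauss s (fst p - snd p) * (\<bar>u (fst p)\<bar> * \<bar>u (snd p)\<bar>)" for p
  proof -
    have "has_bochner_integral lborel (\<lambda>w. norm (T p w)) (gauss s (fst p - snd p) * (\<bar>u (fst p)\<bar> * \<bar>u (snd p)\<bar>))"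
      unfolding T_def real_norm_def abs_mult abs_of_nonneg[OF gauss_nonneg]
      by (intro has_bochner_integral_mult_left has_bochner_integral_gauss_mult_gauss s)
    then show ?thesis by (simp add: has_bochner_integral_iff)
  qed
  have IT: "integrable (lborel\<^sub>2 \<Otimes>\<^sub>M lborel) (\<lambda>(p, w). T p w)"
  proof (rule P.Fubini_integrable)
    show "integrable lborel\<^sub>2 (\<lambda>p. \<integral>w. norm (case (p, w) of (p, w) \<Rightarrow> T p w) \<partial>lborel)"
      using k.kernel_form_integrable[of "\<lambda>x. \<bar>u x\<bar>"] u2 by (simp add: Tn[unfolded real_norm_def] split_beta')
    show "AE p in lborel\<^sub>2. integrable lborel (\<lambda>w. case (p, w) of (p, w) \<Rightarrow> T p w)"
      using Tw by (auto simp: has_bochner_integral_iff)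
  qed (rule mT)
  have 1: "(\<integral>w. (\<integral>p. T p w \<partial>lborel\<^sub>2) \<partial>lborel) = heat_form s u"
    using P.Fubini_integral[OF IT] Tw by (simp add: has_bochner_integral_iff heat_form_def split_beta')
  have "AE w in lborel. integrable lborel\<^sub>2 (\<lambda>p. T p w)"
    using P.AE_integrable_snd[OF IT] .
  then have 2: "AE w in lborel. (\<integral>p. T p w \<partial>lborel\<^sub>2) = (v w)\<^sup>2"
  proof eventually_elim
    case (elim w)
    have "(\<integral>p. T p w \<partial>lborel\<^sub>2) = (\<integral>x. (\<integral>y. T (x, y) w \<partial>lborel) \<partial>lborel)"
      using lborel_pair.integral_fst'[OF elim] by simp
    also have "\<dots> = (\<integral>x. (gauss (2 * s) (w - x) * u x) * v w \<partial>lborel)"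
    proof (intro Bochner_Integration.integral_cong refl)
      fix x
      have "(\<integral>y. T (x, y) w \<partial>lborel) = (\<integral>y. (gauss (2 * s) (w - x) * u x) * (gauss (2 * s) (w - y) * u y) \<partial>lborel)"
        by (intro Bochner_Integration.integral_cong refl) (simp add: T_def k2.kernel_commute[of x w])
      then show "(\<integral>y. T (x, y) w \<partial>lborel) = (gauss (2 * s) (w - x) * u x) * v w"
        by (simp add: v_def)
    qed
    also have "\<dots> = (v w)\<^sup>2"
      by (simp add: v_def power2_eq_square)
    finally show ?case .
  qed
  have Iv: "has_bochner_integral lborel (\<lambda>w. (v w)\<^sup>2) (heat_form s u)"
    using P.integrable_snd[OF IT] 1 by (subst has_bochner_integral_cong_AE[OF _ _ AE_symmetric[OF 2]])
      (auto simp: has_bochner_integral_iff)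
  have Iuv: "has_bochner_integral lborel (\<lambda>w. u w * v w) (heat_form (2 * s) u)"
  proof -
    have eq: "(\<lambda>x. \<integral>y. gauss (2 * s) (x - y) * (u x * u y) \<partial>lborel) = (\<lambda>w. u w * v w)"
      by (auto simp: v_def fun_eq_iff mult.left_commute)
    show ?thesis
      using lborel_pair.integrable_fst[OF k2.kernel_form_integrable[OF u u2]]
         lborel_pair.integral_fst[OF k2.kernel_form_integrable[OF u u2]]
      unfolding eq heat_form_def has_bochner_integral_iff by auto
  qed
  \<comment> \<open>c is the coefficient of the projection of v onto u; the square norm of v - c u,
    which is \<open>heat_form s u\<close> minus c^2, cannot be negative.\<close>
  define c where "c = heat_form (2 * s) u"
  have "has_bochner_integral lborel (\<lambda>w. (v w)\<^sup>2 - (2 * c) * (u w * v w) + c\<^sup>2 * (u w)\<^sup>2)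
    (heat_form s u - (2 * c) * heat_form (2 * s) u + c\<^sup>2 * 1)"
    using u2 norm by (intro has_bochner_integral_add has_bochner_integral_diff has_bochner_integral_mult_right Iv Iuv)
      (auto simp: has_bochner_integral_iff)
  then have "heat_form s u - (2 * c) * heat_form (2 * s) u + c\<^sup>2 * 1 = (\<integral>w. (v w)\<^sup>2 - (2 * c) * (u w * v w) + c\<^sup>2 * (u w)\<^sup>2 \<partial>lborel)"
    by (simp add: has_bochner_integral_iff)
  also have "\<dots> = (\<integral>w. (v w - c * u w)\<^sup>2 \<partial>lborel)"
    by (intro Bochner_Integration.integral_cong refl) (simp add: power2_eq_square algebra_simps)
  also have "\<dots> \<ge> 0" by simp
  finally show ?thesis by (simp add: c_def[symmetric] power2_eq_square)
qed

text \<open>Doubling s k times bounds \<open>heat_form s u\<close> below by the power 2^k of the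
  heat form at a time 2^k times shorter. There the linear estimate l applies, and the powers (1 +
  a/2^k)^(2^k) tend to exp a.\<close>

lemma heat_form_lower_bound:
  fixes u :: "'a::euclidean_space \<Rightarrow> real"
  assumes u: "u \<in> borel_measurable borel" "integrable lborel (\<lambda>x. (u x)\<^sup>2)"
    and norm: "sq_int u = 1"
    and l: "\<And>s. s > 0 \<Longrightarrow> 1 - heat_form s u \<le> l / (4 * s)"
    and s: "s > 0"
  shows "exp (- l / (4 * s)) \<le> heat_form s u"
proof -
  have dbl: "(heat_form (2 ^ k * s) u) ^ (2 ^ k) \<le> heat_form s u" for k
  proof (induction k)
    case (Suc k)
    have "(heat_form (2 * (2 ^ k * s)) u)\<^sup>2 \<le> heat_form (2 ^ k * s) u"
      using heat_form_double[OF u(1,2) _ norm, of "2 ^ k * s"] s by simp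
    then have "((heat_form (2 * (2 ^ k * s)) u)\<^sup>2) ^ (2 ^ k) \<le> heat_form (2 ^ k * s) u ^ (2 ^ k)"
      by (intro power_mono) auto
    with Suc show ?case by (simp add: power_mult[symmetric] mult.assoc)
  qed simp
  define a where "a = - l / (4 * s)"
  have "(\<lambda>n. (1 + a / real n) ^ n) \<longlonglongrightarrow> exp a"
    by (rule tendsto_exp_limit_sequentially)
  then have lim: "(\<lambda>k. (1 + a / real (2 ^ k)) ^ (2 ^ k)) \<longlonglongrightarrow> exp a"
    by (rule filterlim_compose) (auto intro!: filterlim_subseq simp: strict_mono_def)
  \<comment> \<open>The linear lower bound may be negative for small k; raising it to a power
    preserves the inequality only once it is nonnegative.\<close>
  have "(\<lambda>k. 1 + a * (1 / 2) ^ k) \<longlonglongrightarrow> 1 + a * 0"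
    by (intro tendsto_intros LIMSEQ_realpow_zero) auto
  then have "eventually (\<lambda>k. 1 + a * (1 / 2) ^ k > 0) sequentially"
    by (rule order_tendstoD) simp
  then have "eventually (\<lambda>k. (1 + a / real (2 ^ k)) ^ (2 ^ k) \<le> heat_form s u) sequentially"
  proof eventually_elim
    case (elim k)
    have "1 + a / real (2 ^ k) \<le> heat_form (2 ^ k * s) u"
      using l[of "2 ^ k * s"] s by (simp add: a_def field_simps)
    then have "(1 + a / real (2 ^ k)) ^ (2 ^ k) \<le> (heat_form (2 ^ k * s) u) ^ (2 ^ k)"
      using elim by (intro power_mono) (auto simp: power_one_over field_simps)
    with dbl[of k] show ?case by linarith
  qed
  then show ?thesis
    using lim unfolding a_def by (intro tendsto_upperbound[OF lim[unfolded a_def]]) auto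
qed

subsection \<open>Energy of continuously differentiable functions\<close>

text \<open>The right-hand side is the square of 2 sinh (x/2), and 2 sinh y >= 2 y for y >= 0. It
  lets exponential moments of a Gaussian control its second moments.\<close>

lemma square_le_exp_sum: "x\<^sup>2 \<le> exp x + exp (- x) - (2::real)"
proof -
  have mono: "2 * y \<le> exp y - exp (- y)" if "y \<ge> 0" for y :: real
  proof -
    let ?f = "\<lambda>y::real. exp y - exp (- y) - 2 * y"
    have "?f 0 \<le> ?f y"
    proof (rule DERIV_nonneg_imp_nondecreasing[OF that])
      fix t :: real
      have "(?f has_real_derivative exp t + exp (- t) - 2) (at t)"
        by (auto intro!: derivative_eq_intros)
      moreover have "0 \<le> exp t + exp (- t) - 2"
        using exp_ge_add_one_self[of t] exp_ge_add_one_self[of "- t"] by linarith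
      ultimately show "\<exists>D. (?f has_real_derivative D) (at t) \<and> 0 \<le> D" by blast
    qed
    then show ?thesis by simp
  qed
  define y where "y = \<bar>x\<bar> / 2"
  have "exp x + exp (- x) - 2 = (exp y - exp (- y))\<^sup>2"
    by (cases "x \<ge> 0")
      (simp_all add: y_def power2_eq_square left_diff_distrib right_diff_distrib exp_add[symmetric])
  moreover have "(2 * y)\<^sup>2 \<le> (exp y - exp (- y))\<^sup>2"
    using mono[of y] by (intro power_mono) (auto simp: y_def)
  ultimately show ?thesis by (simp add: y_def)
qed

text \<open>The second moment is extracted from the moment generating function: completing the
  square gives the exponential moments exp (t^2 c), \<open>square_le_exp_sum\<close> bounds the
  square of t (v . z) by them, and then t tends to 0.\<close>

lemma nn_integral_gauss_square_inner_le:
  fixes v :: "'a::euclidean_space"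
  assumes s: "s > 0"
  shows "(\<integral>\<^sup>+z. ennreal (gauss s z * (v \<bullet> z)\<^sup>2) \<partial>lborel) \<le> ennreal ((norm v)\<^sup>2 / (2 * s))"
proof -
  define c where "c = (norm v)\<^sup>2 / (4 * s)"
  have E: "has_bochner_integral lborel (\<lambda>z::'a. gauss s z * exp (t * (v \<bullet> z))) (exp (t\<^sup>2 * c))" for t
  proof -
    let ?w = "(t / (2 * s)) *\<^sub>R v"
    have "gauss s z * exp (t * (v \<bullet> z)) = exp (t\<^sup>2 * c) * gauss s (z + - ?w)" for z :: 'a
    proof -
      have "(norm (z + - ?w))\<^sup>2 = (norm z)\<^sup>2 - (t / s) * (v \<bullet> z) + (t / (2 * s))\<^sup>2 * (norm v)\<^sup>2"
        unfolding power2_norm_eq_inner using s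
        by (simp add: inner_diff inner_add inner_commute power2_eq_square field_simps)
      then have "- s * (norm z)\<^sup>2 + t * (v \<bullet> z) = t\<^sup>2 * c + - s * (norm (z + - ?w))\<^sup>2"
        unfolding c_def using s by (simp only:) (simp add: field_simps power2_eq_square)
      moreover have "A * exp a * exp b = exp c * (A * exp d)" if "a + b = c + d" for A a b c d :: real
      proof -
        have "A * exp a * exp b = A * exp (a + b)" by (simp add: exp_add)
        also have "\<dots> = exp c * (A * exp d)" by (simp add: that exp_add)
        finally show ?thesis .
      qed
      ultimately show ?thesis unfolding gauss_def by blast
    qed
    moreover have "has_bochner_integral lborel (\<lambda>z. exp (t\<^sup>2 * c) * gauss s (z + - ?w)) (exp (t\<^sup>2 * c) * 1)"
      by (rule has_bochner_integral_mult_right)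
        (rule has_bochner_integral_lborel_translate[OF has_bochner_integral_gauss[OF s]])
    ultimately show ?thesis by simp
  qed
  have bound: "(\<integral>\<^sup>+z. ennreal (gauss s z * (v \<bullet> z)\<^sup>2) \<partial>lborel) \<le> ennreal (2 * (exp (t\<^sup>2 * c) - 1) / t\<^sup>2)"
    if t: "t > 0" for t
  proof -
    have "has_bochner_integral lborel (\<lambda>z. (gauss s z * exp (t * (v \<bullet> z)) + gauss s z * exp (- t * (v \<bullet> z)) - (gauss s z + gauss s z)) / t\<^sup>2)
      ((exp (t\<^sup>2 * c) + exp ((- t)\<^sup>2 * c) - (1 + 1)) / t\<^sup>2)"
      by (intro has_bochner_integral_divide_zero has_bochner_integral_add has_bochner_integral_diff E has_bochner_integral_gauss s)
    then have H: "has_bochner_integral lborel (\<lambda>z. gauss s z * (exp (t * (v \<bullet> z)) + exp (- t * (v \<bullet> z)) - 2) / t\<^sup>2)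
      (2 * (exp (t\<^sup>2 * c) - 1) / t\<^sup>2)"
      by (simp add: algebra_simps)
    have le: "gauss s z * (v \<bullet> z)\<^sup>2 \<le> gauss s z * (exp (t * (v \<bullet> z)) + exp (- t * (v \<bullet> z)) - 2) / t\<^sup>2" for z
    proof -
      have "gauss s z * (t * (v \<bullet> z))\<^sup>2 \<le> gauss s z * (exp (t * (v \<bullet> z)) + exp (- (t * (v \<bullet> z))) - 2)"
        by (intro mult_left_mono square_le_exp_sum) simp
      then show ?thesis using t by (simp add: field_simps power_mult_distrib)
    qed
    have "(\<integral>\<^sup>+z. ennreal (gauss s z * (v \<bullet> z)\<^sup>2) \<partial>lborel) \<le>
       (\<integral>\<^sup>+z. ennreal (gauss s z * (exp (t * (v \<bullet> z)) + exp (- t * (v \<bullet> z)) - 2) / t\<^sup>2) \<partial>lborel)"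
      by (intro nn_integral_mono ennreal_leI le)
    also have "\<dots> = ennreal (2 * (exp (t\<^sup>2 * c) - 1) / t\<^sup>2)"
    proof (subst nn_integral_eq_integral)
      have "0 \<le> gauss s z * (exp (t * (v \<bullet> z)) + exp (- t * (v \<bullet> z)) - 2) / t\<^sup>2" for z
        by (rule order_trans[OF _ le]) simp
      then show "AE z in lborel. 0 \<le> gauss s z * (exp (t * (v \<bullet> z)) + exp (- t * (v \<bullet> z)) - 2) / t\<^sup>2"
        by simp
    qed (use H in \<open>auto simp: has_bochner_integral_iff\<close>)
    finally show ?thesis .
  qed
  \<comment> \<open>The bound depends on t only through h = t^2, so its limit is twice the
    derivative of exp (h c) at h = 0, which is |v|^2 / (2s).\<close>
  have "((\<lambda>h. (exp (h * c) - exp (0 * c)) / (h - 0)) \<longlongrightarrow> c * exp (0 * c)) (at 0)"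
    by (subst has_field_derivative_iff[symmetric]) (auto intro!: derivative_eq_intros)
  then have "((\<lambda>h. 2 * ((exp (h * c) - 1) / h)) \<longlongrightarrow> 2 * c) (at 0)"
    by (intro tendsto_mult tendsto_const) simp
  moreover have "filterlim (\<lambda>n. (1 / real (Suc n))\<^sup>2) (at 0) sequentially"
    unfolding filterlim_at using tendsto_power[OF LIMSEQ_Suc[OF lim_1_over_n[where 'a=real]], where n=2] by simp
  ultimately have "(\<lambda>n. 2 * ((exp ((1 / real (Suc n))\<^sup>2 * c) - 1) / (1 / real (Suc n))\<^sup>2)) \<longlonglongrightarrow> 2 * c"
    by (rule filterlim_compose)
  then have lim: "(\<lambda>n. ennreal (2 * ((exp ((1 / real (Suc n))\<^sup>2 * c) - 1) / (1 / real (Suc n))\<^sup>2))) \<longlonglongrightarrow> ennreal (2 * c)"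
    by (rule tendsto_ennrealI)
  have "(\<integral>\<^sup>+z. ennreal (gauss s z * (v \<bullet> z)\<^sup>2) \<partial>lborel) \<le> ennreal (2 * c)"
    using bound by (intro tendsto_lowerbound[OF lim]) (auto intro!: always_eventually)
  then show ?thesis by (simp add: c_def)
qed

locale C1_function =
  fixes u :: "'a::euclidean_space \<Rightarrow> real" and G :: "'a \<Rightarrow> 'a"
  assumes deriv: "(u has_derivative (\<lambda>h. G x \<bullet> h)) (at x)"
    and continuous_grad: "continuous_on UNIV G"
begin

lemma continuous: "continuous_on UNIV u"
  by (intro continuous_at_imp_continuous_on ballI has_derivative_continuous[OF deriv])

lemma borel_measurable_function [measurable]: "u \<in> borel_measurable borel"
  by (rule borel_measurable_continuous_onI[OF continuous])

lemma borel_measurable_grad [measurable]: "G \<in> borel_measurable borel"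
  by (rule borel_measurable_continuous_onI[OF continuous_grad])

text \<open>By the fundamental theorem of calculus the increment is the mean of the directional
  derivative over the segment from x to x + z, and the square of a mean is at most the mean of the
  squares: the variance is nonnegative. The extended-real form feeds into Tonelli.\<close>

lemma increment_square_le:
  "ennreal ((u (x + z) - u x)\<^sup>2) \<le> (\<integral>\<^sup>+s. indicator {0..1} s * ennreal ((G (x + s *\<^sub>R z) \<bullet> z)\<^sup>2) \<partial>lborel)"
proof -
  define h where "h s = G (x + s *\<^sub>R z) \<bullet> z" for s
  have conth: "continuous_on {0..1} h"
    unfolding h_def by (intro continuous_intros continuous_on_compose2[OF continuous_grad]) auto
  have "has_bochner_integral lborel (\<lambda>s. indicator {0..1} s *\<^sub>R h s) (u (x + 1 *\<^sub>R z) - u (x + 0 *\<^sub>R z))"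
  proof (rule has_bochner_integral_FTC_Icc)
    fix s :: real
    have "((\<lambda>s. u (x + s *\<^sub>R z)) has_derivative (\<lambda>d. G (x + s *\<^sub>R z) \<bullet> (d *\<^sub>R z))) (at s within {0..1})"
      by (rule has_derivative_compose[of "\<lambda>s. x + s *\<^sub>R z" "\<lambda>d. d *\<^sub>R z" s _ u, OF _ deriv])
        (auto intro!: derivative_eq_intros)
    then show "((\<lambda>s. u (x + s *\<^sub>R z)) has_vector_derivative h s) (at s within {0..1})"
      by (simp add: has_vector_derivative_def h_def)
  qed (use conth in auto)
  then have I: "has_bochner_integral lborel (\<lambda>s. indicator {0..1} s * h s) (u (x + z) - u x)"
    by simp
  have I2: "integrable lborel (\<lambda>s. indicator {0..1} s * (h s)\<^sup>2)"
    using borel_integrable_compact[of "{0..1::real}" "\<lambda>s. (h s)\<^sup>2"] conth by (auto intro!: continuous_intros)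
  have I1: "has_bochner_integral lborel (\<lambda>s::real. indicator {0..1} s :: real) 1"
    using has_bochner_integral_real_indicator[of "{0..1::real}" lborel] by simp
  define d where "d = u (x + z) - u x"
  have "has_bochner_integral lborel (\<lambda>s. indicator {0..1} s * (h s)\<^sup>2 - 2 * d * (indicator {0..1} s * h s) + d\<^sup>2 * indicator {0..1} s)
    ((\<integral>s. indicator {0..1} s * (h s)\<^sup>2 \<partial>lborel) - 2 * d * d + d\<^sup>2 * 1)"
    using I I2 I1 unfolding d_def[symmetric]
    by (intro has_bochner_integral_add has_bochner_integral_diff has_bochner_integral_mult_right)
      (auto simp: has_bochner_integral_iff)
  then have "(\<integral>s. indicator {0..1} s * (h s)\<^sup>2 \<partial>lborel) - 2 * d * d + d\<^sup>2 * 1 =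
     (\<integral>s. indicator {0..1} s * (h s)\<^sup>2 - 2 * d * (indicator {0..1} s * h s) + d\<^sup>2 * indicator {0..1} s \<partial>lborel)"
    by (simp add: has_bochner_integral_iff)
  also have "\<dots> = (\<integral>s. indicator {0..1} s * (h s - d)\<^sup>2 \<partial>lborel)"
    by (intro Bochner_Integration.integral_cong refl) (auto simp: indicator_def power2_diff)
  also have "\<dots> \<ge> 0" by simp
  finally have "d\<^sup>2 \<le> (\<integral>s. indicator {0..1} s * (h s)\<^sup>2 \<partial>lborel)"
    by (simp add: power2_eq_square)
  then have "ennreal (d\<^sup>2) \<le> (\<integral>\<^sup>+s. ennreal (indicator {0..1} s * (h s)\<^sup>2) \<partial>lborel)"
    using I2 by (subst nn_integral_eq_integral) (auto intro: ennreal_leI)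
  also have "\<dots> = (\<integral>\<^sup>+s. indicator {0..1} s * ennreal ((h s)\<^sup>2) \<partial>lborel)"
    by (intro nn_integral_cong) (auto simp: indicator_def)
  finally show ?thesis unfolding d_def h_def .
qed

text \<open>Integrate \<open>increment_square_le\<close> over x and exchange the integrals: by
  translation invariance every point of the segment contributes the same amount.\<close>

lemma translation_square_le:
  "(\<integral>\<^sup>+x. ennreal ((u (x + z) - u x)\<^sup>2) \<partial>lborel) \<le> (\<integral>\<^sup>+x. ennreal ((G x \<bullet> z)\<^sup>2) \<partial>lborel)"
proof -
  have "(\<integral>\<^sup>+x. ennreal ((u (x + z) - u x)\<^sup>2) \<partial>lborel) \<le>
    (\<integral>\<^sup>+x. \<integral>\<^sup>+s. indicator {0..1} s * ennreal ((G (x + s *\<^sub>R z) \<bullet> z)\<^sup>2) \<partial>lborel \<partial>lborel)"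
    by (intro nn_integral_mono increment_square_le)
  also have "\<dots> = (\<integral>\<^sup>+s. \<integral>\<^sup>+x. indicator {0..1::real} s * ennreal ((G (x + s *\<^sub>R z) \<bullet> z)\<^sup>2) \<partial>lborel \<partial>lborel)"
    by (rule lborel_pair.Fubini') measurable
  also have "\<dots> = (\<integral>\<^sup>+s. indicator {0..1::real} s * (\<integral>\<^sup>+x. ennreal ((G x \<bullet> z)\<^sup>2) \<partial>lborel) \<partial>lborel)"
  proof (intro nn_integral_cong)
    fix s :: real
    have "(\<integral>\<^sup>+x. ennreal ((G (x + s *\<^sub>R z) \<bullet> z)\<^sup>2) \<partial>lborel) = (\<integral>\<^sup>+x. ennreal ((G x \<bullet> z)\<^sup>2) \<partial>lborel)"
      by (rule nn_integral_lborel_translate[where f="\<lambda>x. ennreal ((G x \<bullet> z)\<^sup>2)"]) measurable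
    then show "(\<integral>\<^sup>+x. indicator {0..1::real} s * ennreal ((G (x + s *\<^sub>R z) \<bullet> z)\<^sup>2) \<partial>lborel) =
       indicator {0..1} s * (\<integral>\<^sup>+x. ennreal ((G x \<bullet> z)\<^sup>2) \<partial>lborel)"
      by (subst nn_integral_cmult) auto
  qed
  also have "\<dots> = (\<integral>\<^sup>+x. ennreal ((G x \<bullet> z)\<^sup>2) \<partial>lborel)"
    by (subst nn_integral_multc) (auto simp: nn_integral_indicator)
  finally show ?thesis .
qed

text \<open>Substituting x = y + z reduces the double integral to translation differences, so only
  the directional second moments of the kernel enter. It is applied to the Gaussian and to the
  singular kernel near the origin.\<close>

lemma kernel_difference_le:
  assumes \<kappa>[measurable]: "\<kappa> \<in> borel_measurable borel" and nn: "\<And>z. \<kappa> z \<ge> 0"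
    and b: "\<And>v. (\<integral>\<^sup>+z. ennreal (\<kappa> z * (v \<bullet> z)\<^sup>2) \<partial>lborel) \<le> ennreal (B * (norm v)\<^sup>2)" and B: "B \<ge> 0"
  shows "(\<integral>\<^sup>+p. ennreal (case p of (x, y) \<Rightarrow> \<kappa> (x - y) * (u x - u y)\<^sup>2) \<partial>lborel\<^sub>2) \<le>
    ennreal B * (\<integral>\<^sup>+x. ennreal ((norm (G x))\<^sup>2) \<partial>lborel)"
proof -
  have "(\<integral>\<^sup>+p. ennreal (case p of (x, y) \<Rightarrow> \<kappa> (x - y) * (u x - u y)\<^sup>2) \<partial>lborel\<^sub>2) =
    (\<integral>\<^sup>+y. \<integral>\<^sup>+x. ennreal (\<kappa> (x - y) * (u x - u y)\<^sup>2) \<partial>lborel \<partial>lborel)"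
    by (subst lborel_pair.nn_integral_snd[symmetric]) auto
  also have "\<dots> = (\<integral>\<^sup>+y. \<integral>\<^sup>+z. ennreal (\<kappa> z * (u (y + z) - u y)\<^sup>2) \<partial>lborel \<partial>lborel)"
  proof (rule nn_integral_cong)
    fix y :: 'a
    show "(\<integral>\<^sup>+x. ennreal (\<kappa> (x - y) * (u x - u y)\<^sup>2) \<partial>lborel) = (\<integral>\<^sup>+z. ennreal (\<kappa> z * (u (y + z) - u y)\<^sup>2) \<partial>lborel)"
      using nn_integral_lborel_translate[of "\<lambda>x. ennreal (\<kappa> (x - y) * (u x - u y)\<^sup>2)" y]
      by (simp add: add.commute)
  qed
  also have "\<dots> = (\<integral>\<^sup>+z. \<integral>\<^sup>+y. ennreal (\<kappa> z * (u (y + z) - u y)\<^sup>2) \<partial>lborel \<partial>lborel)"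
    by (rule lborel_pair.Fubini') measurable
  also have "\<dots> = (\<integral>\<^sup>+z. ennreal (\<kappa> z) * (\<integral>\<^sup>+y. ennreal ((u (y + z) - u y)\<^sup>2) \<partial>lborel) \<partial>lborel)"
    by (intro nn_integral_cong) (simp add: ennreal_mult nn nn_integral_cmult)
  also have "\<dots> \<le> (\<integral>\<^sup>+z. ennreal (\<kappa> z) * (\<integral>\<^sup>+y. ennreal ((G y \<bullet> z)\<^sup>2) \<partial>lborel) \<partial>lborel)"
    by (intro nn_integral_mono mult_left_mono translation_square_le) auto
  also have "\<dots> = (\<integral>\<^sup>+z. \<integral>\<^sup>+y. ennreal (\<kappa> z * (G y \<bullet> z)\<^sup>2) \<partial>lborel \<partial>lborel)"
    by (intro nn_integral_cong) (simp add: ennreal_mult nn nn_integral_cmult)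
  also have "\<dots> = (\<integral>\<^sup>+y. \<integral>\<^sup>+z. ennreal (\<kappa> z * (G y \<bullet> z)\<^sup>2) \<partial>lborel \<partial>lborel)"
    by (rule lborel_pair.Fubini') measurable
  also have "\<dots> \<le> (\<integral>\<^sup>+y. ennreal (B * (norm (G y))\<^sup>2) \<partial>lborel)"
    by (intro nn_integral_mono b)
  also have "\<dots> = ennreal B * (\<integral>\<^sup>+x. ennreal ((norm (G x))\<^sup>2) \<partial>lborel)"
    using B by (simp add: ennreal_mult nn_integral_cmult)
  finally show ?thesis .
qed

end

section \<open>The singular kernel, split at distance 1\<close>

definition log_kernel :: "'a::euclidean_space \<Rightarrow> real" where
  "log_kernel z = 1 / norm z ^ DIM('a)"

lemma borel_measurable_log_kernel [measurable]: "log_kernel \<in> borel_measurable borel"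
  unfolding log_kernel_def by measurable

lemma log_kernel_nonneg [simp]: "log_kernel z \<ge> 0"
  by (simp add: log_kernel_def)

lemma log_kernel_uminus [simp]: "log_kernel (- z) = log_kernel z"
  by (simp add: log_kernel_def)

text \<open>The factor |z|^2 removes the singularity: in the variable r = |z|^2 the integrand times
  the radial density is constant on (0, 1].\<close>

lemma nn_integral_log_kernel_square:
  "(\<integral>\<^sup>+z. ennreal (indicator (cball 0 1) z * log_kernel z * (norm z)\<^sup>2) \<partial>(lborel :: 'a::euclidean_space measure)) =
    ennreal (pi powr (DIM('a) / 2) / Gamma (DIM('a) / 2))"
proof -
  define n where "n = DIM('a) / 2"
  have n: "n > 0" by (simp add: n_def)
  have G: "Gamma n > 0" using n by (rule Gamma_real_pos)
  have "(\<integral>\<^sup>+z. ennreal (indicator (cball 0 1) z * log_kernel z * (norm z)\<^sup>2) \<partial>(lborel :: 'a measure)) =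
    (\<integral>\<^sup>+z. (\<lambda>r. ennreal (indicator {..1} r * (1 / r powr n) * r)) ((norm z)\<^sup>2) \<partial>(lborel :: 'a measure))"
    by (intro nn_integral_cong) (auto simp: log_kernel_def norm_power_DIM n_def indicator_def abs_square_le_1)
  also have "\<dots> = (\<integral>\<^sup>+r. ennreal (indicator {0<..} r * (pi powr n / Gamma n * r powr (n - 1))) *
       ennreal (indicator {..1} r * (1 / r powr n) * r) \<partial>lborel)"
    unfolding n_def by (rule nn_integral_radial) simp
  also have "\<dots> = (\<integral>\<^sup>+r. ennreal (pi powr n / Gamma n) * indicator {0<..1::real} r \<partial>lborel)"
    using G by (intro nn_integral_cong) (auto simp: indicator_def powr_diff ennreal_mult[symmetric])
  also have "\<dots> = ennreal (pi powr n / Gamma n)"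
    by (subst nn_integral_cmult) (auto simp: nn_integral_indicator)
  finally show ?thesis by (simp add: n_def)
qed

text \<open>Pairs at distance exactly 1 belong both to \<open>near_pairs\<close> and to
  \<open>far_pairs\<close>; this makes the double counting harmless.\<close>

lemma sphere_pairs_null:
  "AE p in lborel\<^sub>2. dist (fst p) (snd p :: 'a::euclidean_space) \<noteq> 1"
proof (rule lborel_pair.AE_pair_measure)
  show "{p \<in> space lborel\<^sub>2. dist (fst p) (snd p :: 'a) \<noteq> 1} \<in> sets lborel\<^sub>2"
    by measurable
  show "AE x in lborel. AE y in lborel. dist (fst (x, y)) (snd (x, y) :: 'a) \<noteq> 1"
  proof (rule AE_I2)
    fix x :: 'a
    have "sphere x 1 \<in> null_sets lborel"
      using negligible_sphere[of x 1] by (auto simp: null_sets_completion_iff negligible_iff_null_sets)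
    then have "AE y in lborel. y \<notin> sphere x 1" by (rule AE_not_in)
    then show "AE y in lborel. dist (fst (x, y)) (snd (x, y)) \<noteq> 1" by simp
  qed
qed

lemma integrable_product_pair:
  fixes f g :: "'a::euclidean_space \<Rightarrow> real"
  assumes f: "integrable lborel f" and g: "integrable lborel g"
  shows "integrable lborel\<^sub>2 (\<lambda>(x, y). f x * g y)"
proof (rule lborel_pair.Fubini_integrable)
  have [measurable]: "f \<in> borel_measurable borel" "g \<in> borel_measurable borel"
    using f g by (auto dest: borel_measurable_integrable)
  show "(\<lambda>(x, y). f x * g y) \<in> borel_measurable lborel\<^sub>2" by measurable
qed (use f g in \<open>auto simp: abs_mult\<close>)

definition near_kernel :: "'a::euclidean_space \<Rightarrow> real" where
  "near_kernel z = indicator (cball 0 1) z * log_kernel z"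

text \<open>Like \<open>near_kernel\<close> it contains the unit sphere, mirroring the overlap of
  \<open>near_pairs\<close> and \<open>far_pairs\<close>.\<close>

definition far_kernel :: "'a::euclidean_space \<Rightarrow> real" where
  "far_kernel z = indicator (- ball 0 1) z * log_kernel z"

lemma borel_measurable_near_kernel [measurable]: "near_kernel \<in> borel_measurable borel"
  unfolding near_kernel_def by (intro borel_measurable_times borel_measurable_indicator) simp_all

lemma borel_measurable_far_kernel [measurable]: "far_kernel \<in> borel_measurable borel"
  unfolding far_kernel_def by (intro borel_measurable_times borel_measurable_indicator) simp_all

lemma near_kernel_nonneg [simp]: "near_kernel z \<ge> 0"
  and far_kernel_nonneg [simp]: "far_kernel z \<ge> 0"
  by (simp_all add: near_kernel_def far_kernel_def)

lemma far_kernel_le_1: "far_kernel z \<le> 1"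
  by (auto simp: far_kernel_def log_kernel_def indicator_def divide_le_eq one_le_power intro: order_trans)

definition near_energy :: "('a::euclidean_space \<Rightarrow> real) \<Rightarrow> real" where
  "near_energy u = (\<integral>p. (case p of (x, y) \<Rightarrow> near_kernel (x - y) * (u x - u y)\<^sup>2) \<partial>lborel\<^sub>2)"

definition far_form :: "('a::euclidean_space \<Rightarrow> real) \<Rightarrow> ('a \<Rightarrow> real) \<Rightarrow> real" where
  "far_form u w = (\<integral>p. (case p of (x, y) \<Rightarrow> far_kernel (x - y) * (u x * w y)) \<partial>lborel\<^sub>2)"

lemma far_form_integrable:
  assumes f: "integrable lborel f" and g: "integrable lborel g"
  shows "integrable lborel\<^sub>2 (\<lambda>(x, y). far_kernel (x - y) * (f x * g y))"
proof (rule Bochner_Integration.integrable_bound)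
  show "integrable lborel\<^sub>2 (\<lambda>(x, y). f x * g y)"
    using f g by (rule integrable_product_pair)
  have [measurable]: "f \<in> borel_measurable borel" "g \<in> borel_measurable borel"
    using f g by (auto dest: borel_measurable_integrable)
  show "(\<lambda>(x, y). far_kernel (x - y) * (f x * g y)) \<in> borel_measurable lborel\<^sub>2" by measurable
  show "AE p in lborel\<^sub>2. norm (case p of (x, y) \<Rightarrow> far_kernel (x - y) * (f x * g y)) \<le> norm (case p of (x, y) \<Rightarrow> f x * g y)"
    by (auto simp: abs_mult split_beta' intro!: mult_left_le_one_le far_kernel_le_1)
qed

context C1_function
begin

context
  assumes u1: "integrable lborel u" and u2: "integrable lborel (\<lambda>x. (u x)\<^sup>2)"
    and G2: "integrable lborel (\<lambda>x. (norm (G x))\<^sup>2)"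
begin

text \<open>Second moments of the near kernel are finite, so \<open>kernel_difference_le\<close>
  applies. Besides integrability for the energy estimate, this gives the control by the Dirichlet
  integral that makes minimizing sequences of the Dirichlet problem compact.\<close>

lemma near_energy_bound:
  "integrable lborel\<^sub>2 (\<lambda>(x, y). near_kernel (x - y) * (u x - u y)\<^sup>2)" (is ?A)
  "near_energy u \<le> pi powr (DIM('a) / 2) / Gamma (DIM('a) / 2) * sq_norm G" (is ?B)
proof -
  \<comment> \<open>C is half the area of the unit sphere, the integral of |z|^(2-N) over the unit
    ball.\<close>
  define C where "C = pi powr (DIM('a) / 2) / Gamma (DIM('a) / 2)"
  have C: "C \<ge> 0" by (simp add: C_def Gamma_real_pos less_imp_le)
  have v: "(\<integral>\<^sup>+z. ennreal (near_kernel z * (v \<bullet> z)\<^sup>2) \<partial>lborel) \<le> ennreal (C * (norm v)\<^sup>2)" for v :: 'a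
  proof -
    have "near_kernel z * (v \<bullet> z)\<^sup>2 \<le> near_kernel z * (norm z)\<^sup>2 * (norm v)\<^sup>2" for z :: 'a
    proof -
      have "(v \<bullet> z)\<^sup>2 \<le> (norm v * norm z)\<^sup>2"
        using Cauchy_Schwarz_ineq2[of v z] by (metis abs_ge_zero power2_abs power_mono)
      then show ?thesis
        unfolding mult.assoc by (intro mult_left_mono) (simp_all add: power_mult_distrib mult.commute)
    qed
    then have "(\<integral>\<^sup>+z. ennreal (near_kernel z * (v \<bullet> z)\<^sup>2) \<partial>(lborel :: 'a measure)) \<le>
        (\<integral>\<^sup>+z. ennreal (near_kernel z * (norm z)\<^sup>2) * ennreal ((norm v)\<^sup>2) \<partial>(lborel :: 'a measure))"
      by (intro nn_integral_mono) (simp add: ennreal_mult[symmetric] ennreal_leI)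
    also have "\<dots> = ennreal (C * (norm v)\<^sup>2)"
    proof (subst nn_integral_multc)
      have "(\<integral>\<^sup>+z. ennreal (near_kernel z * (norm z)\<^sup>2) \<partial>(lborel :: 'a measure)) = ennreal C"
        unfolding near_kernel_def C_def by (rule nn_integral_log_kernel_square)
      then show "(\<integral>\<^sup>+z. ennreal (near_kernel z * (norm z)\<^sup>2) \<partial>(lborel :: 'a measure)) * ennreal ((norm v)\<^sup>2) = ennreal (C * (norm v)\<^sup>2)"
        using C by (simp add: ennreal_mult)
    qed measurable
    finally show ?thesis .
  qed
  have le: "(\<integral>\<^sup>+p. ennreal (case p of (x, y) \<Rightarrow> near_kernel (x - y) * (u x - u y)\<^sup>2) \<partial>lborel\<^sub>2) \<le>
    ennreal C * (\<integral>\<^sup>+x. ennreal ((norm (G x))\<^sup>2) \<partial>lborel)"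
    by (rule kernel_difference_le[OF _ _ v C]) auto
  also have "\<dots> = ennreal (C * sq_norm G)"
    using G2 C by (simp add: nn_integral_eq_integral ennreal_mult)
  finally have le: "(\<integral>\<^sup>+p. ennreal (case p of (x, y) \<Rightarrow> near_kernel (x - y) * (u x - u y)\<^sup>2) \<partial>lborel\<^sub>2) \<le>
     ennreal (C * sq_norm G)" .
  show ?A
    by (rule integrableI_nonneg) (use le in \<open>auto simp: split_beta' intro: le_less_trans\<close>)
  then have "ennreal (near_energy u) \<le> ennreal (C * sq_norm G)"
    using le unfolding near_energy_def by (subst (asm) nn_integral_eq_integral) (auto simp: split_beta')
  then show ?B
    using C by (subst (asm) ennreal_le_iff) (auto simp: C_def)
qed

context
  fixes l :: real
  assumes norm: "sq_int u = 1"
    and l: "l > 0" "sq_norm G \<le> l"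
begin

text \<open>The Gaussian has directional second moment 1/(2s), so
  \<open>kernel_difference_le\<close> bounds 2 - 2 \<open>heat_form s u\<close> by l/(2s); this is
  the linear estimate that \<open>heat_form_lower_bound\<close> amplifies.\<close>

lemma heat_form_ge:
  assumes s: "s > 0"
  shows "exp (- l / (4 * s)) \<le> heat_form s u"
proof (rule heat_form_lower_bound[OF _ u2 norm _ s])
  fix s :: real assume s: "s > 0"
  interpret k: even_kernel "gauss s :: 'a \<Rightarrow> real" using s by (rule gauss_even_kernel)
  have K: "(\<integral>z. gauss s z \<partial>(lborel :: 'a measure)) = 1"
    using has_bochner_integral_gauss[OF s, where 'a='a] by (simp add: has_bochner_integral_iff)
  have H: "has_bochner_integral lborel\<^sub>2 (\<lambda>(x, y). gauss s (x - y) * (u x - u y)\<^sup>2) (2 - 2 * heat_form s u)"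
    using k.kernel_form_diff[OF _ u2] by (simp add: K norm heat_form_def)
  have "ennreal (2 - 2 * heat_form s u) = (\<integral>\<^sup>+p. ennreal (case p of (x, y) \<Rightarrow> gauss s (x - y) * (u x - u y)\<^sup>2) \<partial>lborel\<^sub>2)"
    using H by (subst nn_integral_eq_integral) (auto simp: has_bochner_integral_iff split_beta')
  also have "\<dots> \<le> ennreal (1 / (2 * s)) * (\<integral>\<^sup>+x. ennreal ((norm (G x))\<^sup>2) \<partial>lborel)"
    using s nn_integral_gauss_square_inner_le[OF s, where 'a='a] by (intro kernel_difference_le) auto
  also have "\<dots> = ennreal (1 / (2 * s) * sq_norm G)"
    by (subst nn_integral_eq_integral[OF G2]) (use s in \<open>simp_all add: ennreal_mult[symmetric]\<close>)
  also have "\<dots> \<le> ennreal (1 / (2 * s) * l)"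
    using l s by (intro ennreal_leI mult_left_mono) auto
  finally have "2 - 2 * heat_form s u \<le> 1 / (2 * s) * l"
    using s l by (subst (asm) ennreal_le_iff) auto
  then show "1 - heat_form s u \<le> l / (4 * s)"
    using s by (simp add: field_simps)
qed measurable

text \<open>Allowing any positive l above the Dirichlet integral avoids having to show first that
  the Dirichlet integral is positive.\<close>

theorem nonlocal_energy_le_log:
  "c_const DIM('a) / 2 * near_energy u - c_const DIM('a) * far_form u u + rho_const DIM('a) \<le> ln l"
proof -
  define c where "c = c_const DIM('a)"
  interpret LL: sigma_finite_measure "lborel\<^sub>2 :: ('a \<times> 'a) measure"
    unfolding lborel_prod by (rule lborel.sigma_finite_measure_axioms)
  interpret P: pair_sigma_finite "lborel\<^sub>2 :: ('a \<times> 'a) measure" "lborel :: real measure" ..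
  \<comment> \<open>The combined integrand without its kernel: half the squared difference on near
    pairs, minus the product on far pairs. It vanishes on the diagonal, precisely where the time
    integral of the Gaussian does not represent the kernel.\<close>
  define d where "d p = indicator (cball 0 1) (fst p - snd p) * (u (fst p) - u (snd p))\<^sup>2 / 2 -
    indicator (- ball 0 1) (fst p - snd p) * (u (fst p) * u (snd p))" for p
  define W where "W p s = indicator {0<..} s * (gauss s (fst p - snd p) / s) * d p" for p and s :: real
  have [measurable]: "(\<lambda>z::'a. indicator (cball 0 1) z :: real) \<in> borel_measurable borel"
     "(\<lambda>z::'a. indicator (- ball 0 1) z :: real) \<in> borel_measurable borel"
    by (intro borel_measurable_indicator; simp)+
  have md[measurable]: "d \<in> borel_measurable lborel\<^sub>2"
    unfolding d_def by measurable
  have mW: "(\<lambda>(p, s). W p s) \<in> borel_measurable (lborel\<^sub>2 \<Otimes>\<^sub>M lborel)"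
    unfolding W_def by measurable
  have Ws: "has_bochner_integral lborel (W p) (c * (log_kernel (fst p - snd p) * d p))"
    and Wa: "has_bochner_integral lborel (\<lambda>s. norm (W p s)) (c * (log_kernel (fst p - snd p) * \<bar>d p\<bar>))" for p
  proof -
    have "has_bochner_integral lborel (W p) (c * (log_kernel (fst p - snd p) * d p)) \<and>
      has_bochner_integral lborel (\<lambda>s. norm (W p s)) (c * (log_kernel (fst p - snd p) * \<bar>d p\<bar>))"
    proof (cases "fst p = snd p")
      case True
      then have "d p = 0" by (simp add: d_def)
      then have "W p = (\<lambda>_. 0)" by (simp add: W_def fun_eq_iff)
      with \<open>d p = 0\<close> show ?thesis by (simp add: has_bochner_integral_zero)
    next
      case False
      then have z: "fst p - snd p \<noteq> 0" by simp
      have "has_bochner_integral lborel (W p) (c / norm (fst p - snd p) ^ DIM('a) * d p)"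
        unfolding W_def c_def by (intro has_bochner_integral_mult_left has_bochner_integral_gauss_time z)
      moreover have "has_bochner_integral lborel (\<lambda>s. indicator {0<..} s * (gauss s (fst p - snd p) / s) * \<bar>d p\<bar>) (c / norm (fst p - snd p) ^ DIM('a) * \<bar>d p\<bar>)"
        unfolding c_def by (intro has_bochner_integral_mult_left has_bochner_integral_gauss_time z)
      moreover have "norm (W p s) = indicator {0<..} s * (gauss s (fst p - snd p) / s) * \<bar>d p\<bar>" for s
        by (auto simp: W_def abs_mult indicator_def)
      ultimately show ?thesis by (simp add: log_kernel_def)
    qed
    then show "has_bochner_integral lborel (W p) (c * (log_kernel (fst p - snd p) * d p))"
     "has_bochner_integral lborel (\<lambda>s. norm (W p s)) (c * (log_kernel (fst p - snd p) * \<bar>d p\<bar>))" by auto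
  qed
  have near: "integrable lborel\<^sub>2 (\<lambda>p. near_kernel (fst p - snd p) * (u (fst p) - u (snd p))\<^sup>2)"
    using near_energy_bound(1) by (simp add: split_beta')
  have far: "integrable lborel\<^sub>2 (\<lambda>p. far_kernel (fst p - snd p) * (u (fst p) * u (snd p)))"
    using far_form_integrable[OF u1 u1] by (simp add: split_beta')
  have ld: "log_kernel (fst p - snd p) * d p = near_kernel (fst p - snd p) * (u (fst p) - u (snd p))\<^sup>2 / 2 -
      far_kernel (fst p - snd p) * (u (fst p) * u (snd p))" for p
    by (simp add: d_def near_kernel_def far_kernel_def right_diff_distrib mult_ac)
  have Ild: "has_bochner_integral lborel\<^sub>2 (\<lambda>p. c * (log_kernel (fst p - snd p) * d p)) (c * (near_energy u / 2 - far_form u u))"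
    unfolding ld using near far
    by (intro has_bochner_integral_mult_right has_bochner_integral_diff has_bochner_integral_divide_zero)
      (auto simp: has_bochner_integral_iff near_energy_def far_form_def split_beta')
  have IW: "integrable (lborel\<^sub>2 \<Otimes>\<^sub>M lborel) (\<lambda>(p, s). W p s)"
  proof (rule P.Fubini_integrable[OF mW])
    have "integrable lborel\<^sub>2 (\<lambda>p. \<bar>c * (log_kernel (fst p - snd p) * d p)\<bar>)"
      using Ild by (auto simp: has_bochner_integral_iff)
    moreover have "c \<ge> 0" by (simp add: c_def c_const_def Gamma_real_pos less_imp_le)
    ultimately show "integrable lborel\<^sub>2 (\<lambda>p. \<integral>s. norm (case (p, s) of (p, s) \<Rightarrow> W p s) \<partial>lborel)"
      using Wa by (simp add: has_bochner_integral_iff abs_mult)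
    show "AE p in lborel\<^sub>2. integrable lborel (\<lambda>s. case (p, s) of (p, s) \<Rightarrow> W p s)"
      using Ws by (simp add: has_bochner_integral_iff)
  qed
  define q where "q s = (\<integral>z. indicator (cball 0 1) z * gauss s z \<partial>(lborel :: 'a measure))" for s
  have inner: "(\<integral>p. W p s \<partial>lborel\<^sub>2) = indicator {0<..} s * ((q s - heat_form s u) / s)" for s
  proof (cases "s > 0")
    case s: True
    interpret k: even_kernel "gauss s :: 'a \<Rightarrow> real" using s by (rule gauss_even_kernel)
    \<comment> \<open>The Gaussian cut off at distance 1 has mass q s. Half its squared-difference
      form is q s - ?B, and the far products contribute ?B minus the full heat form, so the near
      product term ?B drops out of the sum.\<close>
    interpret k': even_kernel "\<lambda>z::'a. indicator (cball 0 1) z * gauss s z"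
      by unfold_locales (auto simp: indicator_def intro!: Bochner_Integration.integrable_bound[OF k.kernel_integrable])
    have gi: "integrable lborel\<^sub>2 (\<lambda>p. gauss s (fst p - snd p) * (u (fst p) * u (snd p)))"
      using k.kernel_form_integrable[OF _ u2] by (simp add: split_beta')
    have gi': "integrable lborel\<^sub>2 (\<lambda>p. indicator (cball 0 1) (fst p - snd p) * gauss s (fst p - snd p) * (u (fst p) * u (snd p)))"
      using k'.kernel_form_integrable[OF _ u2] by (simp add: split_beta')
    let ?B = "\<integral>p. indicator (cball 0 1) (fst p - snd p) * gauss s (fst p - snd p) * (u (fst p) * u (snd p)) \<partial>lborel\<^sub>2"
    have A: "has_bochner_integral lborel\<^sub>2
      (\<lambda>p. indicator (cball 0 1) (fst p - snd p) * gauss s (fst p - snd p) * (u (fst p) - u (snd p))\<^sup>2) (2 * q s - 2 * ?B)"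
      using k'.kernel_form_diff[OF _ u2] by (simp add: split_beta' norm q_def)
    have "has_bochner_integral lborel\<^sub>2
      (\<lambda>p. (indicator (cball 0 1) (fst p - snd p) * gauss s (fst p - snd p) * (u (fst p) - u (snd p))\<^sup>2) / 2 -
        (gauss s (fst p - snd p) * (u (fst p) * u (snd p)) -
         indicator (cball 0 1) (fst p - snd p) * gauss s (fst p - snd p) * (u (fst p) * u (snd p))))
      ((2 * q s - 2 * ?B) / 2 - (heat_form s u - ?B))"
      using gi gi' by (intro has_bochner_integral_diff has_bochner_integral_divide_zero A)
        (auto simp: has_bochner_integral_iff heat_form_def split_beta')
    then have 1: "has_bochner_integral lborel\<^sub>2
      (\<lambda>p. (indicator (cball 0 1) (fst p - snd p) * gauss s (fst p - snd p) * (u (fst p) - u (snd p))\<^sup>2) / 2 -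
        (gauss s (fst p - snd p) * (u (fst p) * u (snd p)) -
         indicator (cball 0 1) (fst p - snd p) * gauss s (fst p - snd p) * (u (fst p) * u (snd p))))
      (q s - heat_form s u)"
      by (simp add: diff_divide_distrib)
    \<comment> \<open>The far indicator is replaced by one minus the near indicator; the two differ
      only at distance 1.\<close>
    have 2: "AE p in lborel\<^sub>2. W p s = ((indicator (cball 0 1) (fst p - snd p) * gauss s (fst p - snd p) * (u (fst p) - u (snd p))\<^sup>2) / 2 -
        (gauss s (fst p - snd p) * (u (fst p) * u (snd p)) -
         indicator (cball 0 1) (fst p - snd p) * gauss s (fst p - snd p) * (u (fst p) * u (snd p)))) / s"
      using sphere_pairs_null[where 'a='a]
    proof eventually_elim
      case (elim p)
      then have "norm (fst p - snd p) \<noteq> 1" by (simp add: dist_norm)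
      then have "norm (fst p - snd p) < 1 \<or> norm (fst p - snd p) > 1" by linarith
      then show ?case
        by (elim disjE) (use s in \<open>simp_all add: W_def d_def diff_divide_distrib\<close>)
    qed
    have mWs: "(\<lambda>p. W p s) \<in> borel_measurable lborel\<^sub>2"
      unfolding W_def by measurable
    show ?thesis
      using has_bochner_integral_divide_zero[OF 1, of s] s
      by (subst integral_cong_AE[OF mWs _ 2]) (auto simp: has_bochner_integral_iff)
  qed (simp add: W_def)
  have "c * (near_energy u / 2 - far_form u u) = (\<integral>p. (\<integral>s. W p s \<partial>lborel) \<partial>lborel\<^sub>2)"
    using Ild Ws by (auto simp: has_bochner_integral_iff)
  also have "\<dots> = (\<integral>s. (\<integral>p. W p s \<partial>lborel\<^sub>2) \<partial>lborel)"
    by (rule P.Fubini_integral[OF IW, symmetric])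
  also have "\<dots> \<le> (\<integral>s. indicator {0<..} s * ((q s - exp (- l / (4 * s))) / s) \<partial>lborel)"
  proof (rule integral_mono)
    show "integrable lborel (\<lambda>s. \<integral>p. W p s \<partial>lborel\<^sub>2)"
      using P.integrable_snd[OF IW] by simp
    show "integrable lborel (\<lambda>s. indicator {0<..} s * ((q s - exp (- l / (4 * s))) / s))"
      using has_bochner_integral_log_rho[OF l(1), where 'a='a] by (simp add: has_bochner_integral_iff q_def)
    show "(\<integral>p. W p s \<partial>lborel\<^sub>2) \<le> indicator {0<..} s * ((q s - exp (- l / (4 * s))) / s)" for s
      unfolding inner using heat_form_ge[of s] by (auto simp: indicator_def intro!: divide_right_mono)
  qed
  also have "\<dots> = ln l - rho_const DIM('a)"
    using has_bochner_integral_log_rho[OF l(1), where 'a='a] by (simp add: has_bochner_integral_iff q_def)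
  finally show ?thesis by (simp add: c_def algebra_simps)
qed

end

end

end

subsection \<open>Test functions\<close>

lemma has_derivative_grad:
  fixes f :: "real ^ 'n \<Rightarrow> real"
  assumes "f differentiable (at x)"
  shows "(f has_derivative (\<lambda>h. grad f x \<bullet> h)) (at x)"
proof -
  let ?D = "frechet_derivative f (at x)"
  have D: "(f has_derivative ?D) (at x)"
    using assms by (rule frechet_derivative_works[THEN iffD1])
  then have lin: "linear ?D" by (rule has_derivative_linear)
  have "?D h = grad f x \<bullet> h" for h
  proof -
    have "?D h = ?D (\<Sum>i\<in>UNIV. (h $ i) *\<^sub>R axis i 1)"
      using basis_expansion[of h] by (simp add: scalar_mult_eq_scaleR)
    also have "\<dots> = (\<Sum>i\<in>UNIV. h $ i * ?D (axis i 1))"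
      by (simp add: linear_sum[OF lin] linear_scale[OF lin])
    also have "\<dots> = grad f x \<bullet> h"
      by (simp add: inner_vec_def grad_def mult.commute)
    finally show ?thesis .
  qed
  then have "?D = (\<lambda>h. grad f x \<bullet> h)" by (rule ext)
  with D show ?thesis by simp
qed

lemma grad_eqI:
  fixes f :: "real ^ 'n \<Rightarrow> real"
  assumes "(f has_derivative (\<lambda>h. v \<bullet> h)) (at x)"
  shows "grad f x = v"
proof -
  have "frechet_derivative f (at x) = (\<lambda>h. v \<bullet> h)"
    using frechet_derivative_at[OF assms] by simp
  then show ?thesis by (simp add: grad_def vec_eq_iff inner_axis)
qed

lemma grad_lincomb:
  fixes f g :: "real ^ 'n \<Rightarrow> real"
  assumes "f differentiable (at x)" "g differentiable (at x)"
  shows "grad (\<lambda>x. a * f x + b * g x) x = a *\<^sub>R grad f x + b *\<^sub>R grad g x"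
  by (rule grad_eqI)
    (auto intro!: derivative_eq_intros has_derivative_grad assms simp: inner_add_left)

lemma C_k_lincomb:
  assumes "C_k k f" "C_k k g"
  shows "C_k k (\<lambda>x. a * f x + b * g x)"
  using assms
proof (induction k arbitrary: f g)
  case 0
  then show ?case by (auto intro!: continuous_intros)
next
  case (Suc k)
  then have d: "f differentiable (at x)" "g differentiable (at x)" for x by auto
  have "(\<lambda>x. grad (\<lambda>x. a * f x + b * g x) x $ i) = (\<lambda>x. a * (grad f x $ i) + b * (grad g x $ i))" for i
    by (simp add: fun_eq_iff grad_lincomb d)
  then show ?case
    using Suc d by (auto intro!: differentiable_add differentiable_mult)
qed

lemma Cc_infinity_lincomb:
  assumes "f \<in> Cc_infinity \<Omega>" "g \<in> Cc_infinity \<Omega>"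
  shows "(\<lambda>x. a * f x + b * g x) \<in> Cc_infinity \<Omega>"
proof -
  let ?S = "closure {x. f x \<noteq> 0} \<union> closure {x. g x \<noteq> 0}"
  have S: "compact ?S" "?S \<subseteq> \<Omega>"
    using assms by (auto simp: Cc_infinity_def)
  have sub: "closure {x. a * f x + b * g x \<noteq> 0} \<subseteq> ?S"
  proof (rule closure_minimal)
    have "{x. a * f x + b * g x \<noteq> 0} \<subseteq> {x. f x \<noteq> 0} \<union> {x. g x \<noteq> 0}" by auto
    also have "\<dots> \<subseteq> ?S" by (intro Un_mono closure_subset)
    finally show "{x. a * f x + b * g x \<noteq> 0} \<subseteq> ?S" .
  qed (use S in \<open>auto intro: compact_imp_closed\<close>)
  have "compact (closure {x. a * f x + b * g x \<noteq> 0})"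
    using compact_Int_closed[OF S(1) closed_closure, of "{x. a * f x + b * g x \<noteq> 0}"] sub
    by (simp add: Int_absorb1)
  with S sub assms show ?thesis
    unfolding Cc_infinity_def by (auto intro: C_k_lincomb)
qed

lemma Cc_infinity_C1_function:
  assumes "\<phi> \<in> Cc_infinity \<Omega>"
  shows "C1_function \<phi> (grad \<phi>)"
proof
  have C: "C_k (Suc 0) \<phi>" using assms unfolding Cc_infinity_def by blast
  then show "(\<phi> has_derivative (\<lambda>h. grad \<phi> x \<bullet> h)) (at x)" for x
    by (intro has_derivative_grad) auto
  have "continuous_on UNIV (\<lambda>x. \<chi> i. grad \<phi> x $ i)"
    using C by (intro continuous_on_vec_lambda) auto
  then show "continuous_on UNIV (grad \<phi>)" by simp
qed

lemma Cc_infinity_support: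
  assumes "\<phi> \<in> Cc_infinity \<Omega>"
  obtains S where "compact S" "S \<subseteq> \<Omega>" "\<And>x. x \<notin> S \<Longrightarrow> \<phi> x = 0" "\<And>x. x \<notin> S \<Longrightarrow> grad \<phi> x = 0"
proof
  let ?S = "closure {x. \<phi> x \<noteq> 0}"
  show "compact ?S" "?S \<subseteq> \<Omega>" using assms by (auto simp: Cc_infinity_def)
  show 0: "\<phi> x = 0" if "x \<notin> ?S" for x
  proof (rule ccontr)
    assume "\<phi> x \<noteq> 0"
    then have "x \<in> {x. \<phi> x \<noteq> 0}" by simp
    from that subsetD[OF closure_subset this] show False by (rule notE)
  qed
  show "grad \<phi> x = 0" if "x \<notin> ?S" for x
  proof (rule grad_eqI)
    have "((\<lambda>_. 0) has_derivative (\<lambda>h. 0 \<bullet> h)) (at x)" by simp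
    then show "(\<phi> has_derivative (\<lambda>h. 0 \<bullet> h)) (at x)"
    proof (rule has_derivative_transform_within_open)
      show "open (- ?S)" "x \<in> - ?S" using that by (simp_all only: open_Compl closed_closure Compl_iff simp_thms)
      show "0 = \<phi> y" if "y \<in> - ?S" for y using 0[of y] that by (simp only: Compl_iff simp_thms)
    qed
  qed
qed

lemma integrable_continuous_compact_support:
  fixes f :: "'a::euclidean_space \<Rightarrow> 'b::{banach, second_countable_topology}"
  assumes "continuous_on UNIV f" "compact S" "\<And>x. x \<notin> S \<Longrightarrow> f x = 0"
  shows "integrable lborel f"
proof -
  have "integrable lborel (\<lambda>x. indicator S x *\<^sub>R f x)"
    using assms by (intro borel_integrable_compact) (auto intro: continuous_on_subset)
  moreover have "(\<lambda>x. indicator S x *\<^sub>R f x) = f"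
    using assms(3) by (auto simp: fun_eq_iff indicator_def)
  ultimately show ?thesis by simp
qed

lemma Cc_infinity_integrable:
  assumes "\<phi> \<in> Cc_infinity \<Omega>"
  shows "integrable lborel \<phi>" "integrable lborel (\<lambda>x. (\<phi> x)\<^sup>2)"
    "integrable lborel (\<lambda>x. (norm (grad \<phi> x))\<^sup>2)"
proof -
  interpret C1_function \<phi> "grad \<phi>" using assms by (rule Cc_infinity_C1_function)
  obtain S where S: "compact S" "S \<subseteq> \<Omega>" "\<And>x. x \<notin> S \<Longrightarrow> \<phi> x = 0" "\<And>x. x \<notin> S \<Longrightarrow> grad \<phi> x = 0"
    by (rule Cc_infinity_support[OF assms], rule that)
  show "integrable lborel \<phi>"
    by (rule integrable_continuous_compact_support[OF continuous S(1,3)])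
  show "integrable lborel (\<lambda>x. (\<phi> x)\<^sup>2)"
    by (rule integrable_continuous_compact_support[OF _ S(1)])
      (simp_all add: S continuous continuous_on_power)
  show "integrable lborel (\<lambda>x. (norm (grad \<phi> x))\<^sup>2)"
    by (rule integrable_continuous_compact_support[OF _ S(1)])
      (simp_all add: S continuous_grad continuous_on_power continuous_on_norm)
qed

subsection \<open>A bump function\<close>

text \<open>The index m makes the family closed under differentiation up to linear combinations, so
  a single derivative formula yields smoothness of all orders.\<close>

definition flat_exp :: "nat \<Rightarrow> real \<Rightarrow> real" where
  "flat_exp m t = (if t > 0 then exp (- 1 / t) / t ^ m else 0)"

lemma power_div_fact_le_exp:
  fixes x :: real
  assumes "x \<ge> 0"
  shows "x ^ n / fact n \<le> exp x"
proof -
  have "(\<Sum>k\<in>{n}. x ^ k /\<^sub>R fact k) \<le> (\<Sum>k. x ^ k /\<^sub>R fact k)"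
    using exp_converges[of x] assms by (intro sum_le_suminf) (auto simp: sums_iff)
  then show ?thesis by (simp add: exp_def field_simps)
qed

text \<open>The term of order m + 2 in the series of exp (1/t) beats the factor t^m with t^2 to
  spare. Quadratic decay makes the difference quotient at 0 vanish.\<close>

lemma flat_exp_le:
  assumes "t \<ge> 0"
  shows "flat_exp m t \<le> fact (m + 2) * t\<^sup>2"
proof (cases "t = 0")
  case False
  with assms have t: "t > 0" by simp
  have E: "exp (- 1 / t) \<le> F * t ^ k" if "(1 / t) ^ k / F \<le> exp (1 / t)" "F > 0" for k and F :: real
    using t that by (simp add: exp_minus field_simps)
  have "exp (- 1 / t) \<le> fact (m + 2) * t ^ (m + 2)"
    by (rule E, rule power_div_fact_le_exp) (use t in auto)
  then have "exp (- 1 / t) / t ^ m \<le> fact (m + 2) * t ^ (m + 2) / t ^ m"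
    using t by (intro divide_right_mono) auto
  then show ?thesis
    using t by (simp add: flat_exp_def power_add power2_eq_square mult_ac)
qed (simp add: flat_exp_def)

lemma has_real_derivative_flat_exp:
  "(flat_exp m has_real_derivative - real m * flat_exp (Suc m) t + flat_exp (Suc (Suc m)) t) (at t)"
proof -
  consider "t > 0" | "t < 0" | "t = 0" by linarith
  then show ?thesis
  proof cases
    case 1
    \<comment> \<open>Natural-number subtraction in the exponent is harmless: at m = 0 both sides
      are 0.\<close>
    have e: "real m * t ^ (m - Suc 0) = real m * t ^ m / t"
      using 1 by (cases m) auto
    have "((\<lambda>t. exp (- 1 / t) / t ^ m) has_real_derivative - real m * flat_exp (Suc m) t + flat_exp (Suc (Suc m)) t) (at t)"
      using 1 by (auto intro!: derivative_eq_intros simp: flat_exp_def e field_simps power2_eq_square)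
    then show ?thesis
      by (rule has_field_derivative_transform_within_open[of _ _ _ "{0<..}"]) (use 1 in \<open>auto simp: flat_exp_def\<close>)
  next
    case 2
    have "((\<lambda>t. 0) has_real_derivative - real m * flat_exp (Suc m) t + flat_exp (Suc (Suc m)) t) (at t)"
      using 2 by (simp add: flat_exp_def)
    then show ?thesis
      by (rule has_field_derivative_transform_within_open[of _ _ _ "{..<0}"]) (use 2 in \<open>auto simp: flat_exp_def\<close>)
  next
    case 3
    have "((\<lambda>h. flat_exp m h / h) \<longlongrightarrow> 0) (at 0)"
    proof (rule Lim_null_comparison)
      have "norm (flat_exp m h / h) \<le> fact (m + 2) * \<bar>h\<bar>" for h
      proof (cases "h > 0")
        case True
        then have "flat_exp m h / h \<le> fact (m + 2) * h\<^sup>2 / h"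
          by (intro divide_right_mono flat_exp_le) auto
        with True show ?thesis by (simp add: flat_exp_def power2_eq_square)
      next
        case False
        then have "norm (flat_exp m h / h) = 0" by (simp add: flat_exp_def)
        also have "0 \<le> fact (m + 2) * \<bar>h\<bar>" by (intro mult_nonneg_nonneg) auto
        finally show ?thesis .
      qed
      then show "\<forall>\<^sub>F h in at 0. norm (flat_exp m h / h) \<le> fact (m + 2) * \<bar>h\<bar>"
        by simp
      have "((\<lambda>h::real. fact (m + 2) * \<bar>h\<bar>) \<longlongrightarrow> fact (m + 2) * \<bar>0\<bar>) (at 0)"
        by (intro tendsto_intros)
      then show "((\<lambda>h::real. fact (m + 2) * \<bar>h\<bar>) \<longlongrightarrow> 0) (at 0)" by simp
    qed
    with 3 show ?thesis by (simp add: has_field_derivative_iff flat_exp_def)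
  qed
qed

text \<open>The algebra generated by constants, coordinates and the functions
  \<open>flat_exp\<close> of r^2 - |x-p|^2. Partial derivatives stay inside it, so
  \<open>C_k\<close> follows for every k by induction without writing down higher
  derivatives.\<close>

inductive bump_algebra :: "real ^ 'n \<Rightarrow> real \<Rightarrow> (real ^ 'n \<Rightarrow> real) \<Rightarrow> bool" for p r where
  const: "bump_algebra p r (\<lambda>x. c)"
| coord: "bump_algebra p r (\<lambda>x. x $ i)"
| bump: "bump_algebra p r (\<lambda>x. flat_exp m (r\<^sup>2 - (norm (x - p))\<^sup>2))"
| add: "bump_algebra p r f \<Longrightarrow> bump_algebra p r g \<Longrightarrow> bump_algebra p r (\<lambda>x. f x + g x)"
| mult: "bump_algebra p r f \<Longrightarrow> bump_algebra p r g \<Longrightarrow> bump_algebra p r (\<lambda>x. f x * g x)"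

lemma bump_algebra_grad:
  fixes p :: "real ^ 'n"
  assumes "bump_algebra p r f"
  shows "(\<forall>x. f differentiable (at x)) \<and> (\<forall>i. bump_algebra p r (\<lambda>x. grad f x $ i))"
  using assms
proof induction
  case (const c)
  have "grad (\<lambda>x::real^'n. c) x = 0" for x
    by (rule grad_eqI) simp
  then show ?case by (simp add: bump_algebra.const)
next
  case (coord j)
  have D: "((\<lambda>x::real^'n. x $ j) has_derivative (\<lambda>h. axis j 1 \<bullet> h)) (at x)" for x
    by (simp add: inner_axis' bounded_linear_imp_has_derivative bounded_linear_vec_nth)
  then have "grad (\<lambda>x::real^'n. x $ j) x = axis j 1" for x
    by (rule grad_eqI)
  with D show ?case by (auto simp: bump_algebra.const differentiable_def)
next
  case (bump m)
  let ?q = "\<lambda>x. r\<^sup>2 - (norm (x - p))\<^sup>2"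
  have q: "(?q has_derivative (\<lambda>h. - (2 * ((x - p) \<bullet> h)))) (at x)" for x
    unfolding power2_norm_eq_inner by (auto intro!: derivative_eq_intros simp: inner_commute)
  have D: "((\<lambda>x. flat_exp m (?q x)) has_derivative
     (\<lambda>h. ((- real m * flat_exp (Suc m) (?q x) + flat_exp (Suc (Suc m)) (?q x)) * (- 2)) *\<^sub>R (x - p) \<bullet> h)) (at x)" for x
    by (rule has_derivative_eq_rhs[OF has_derivative_compose[OF q
      has_real_derivative_flat_exp[unfolded has_field_derivative_def]]]) (auto simp: fun_eq_iff algebra_simps)
  then have "grad (\<lambda>x. flat_exp m (?q x)) x =
     ((- real m * flat_exp (Suc m) (?q x) + flat_exp (Suc (Suc m)) (?q x)) * (- 2)) *\<^sub>R (x - p)" for x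
    by (rule grad_eqI)
  then have "(\<lambda>x. grad (\<lambda>x. flat_exp m (?q x)) x $ i) =
    (\<lambda>x. ((- real m * flat_exp (Suc m) (?q x) + flat_exp (Suc (Suc m)) (?q x)) * (- 2)) * (x $ i + - (p $ i)))" for i
    by auto
  moreover have "bump_algebra p r (\<lambda>x. ((- real m * flat_exp (Suc m) (?q x) + flat_exp (Suc (Suc m)) (?q x)) * (- 2)) * (x $ i + - (p $ i)))" for i
    by (intro bump_algebra.intros)
  ultimately show ?case using D by (auto simp: differentiable_def)
next
  case (add f g)
  then have "grad (\<lambda>x. f x + g x) x $ i = grad f x $ i + grad g x $ i" for x i
    using grad_lincomb[of f x g 1 1] by simp
  with add show ?case by (auto intro: bump_algebra.intros)
next
  case (mult f g)
  have "grad (\<lambda>x. f x * g x) x = f x *\<^sub>R grad g x + g x *\<^sub>R grad f x" for x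
    using mult by (intro grad_eqI)
      (auto intro!: derivative_eq_intros has_derivative_grad simp: inner_add_left fun_eq_iff)
  with mult show ?case by (auto intro!: bump_algebra.intros)
qed

lemma bump_algebra_C_k: "bump_algebra p r f \<Longrightarrow> C_k k f"
proof (induction k arbitrary: f)
  case 0
  then show ?case
    using bump_algebra_grad[OF 0] by (auto intro!: continuous_at_imp_continuous_on differentiable_imp_continuous_within)
next
  case (Suc k)
  then show ?case using bump_algebra_grad[OF Suc.prems] by auto
qed

text \<open>Supplies a nonzero test function, so that the infima over normalized functions are taken
  over nonempty sets.\<close>

lemma bump_function_exists:
  fixes \<Omega> :: "(real ^ 'n) set"
  assumes "open \<Omega>" "\<Omega> \<noteq> {}"
  obtains \<phi> where "\<phi> \<in> Cc_infinity \<Omega>" "sq_int \<phi> > 0"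
proof -
  obtain p where p: "p \<in> \<Omega>" using assms(2) by auto
  then obtain r where r: "r > 0" "cball p r \<subseteq> \<Omega>" using assms(1) open_contains_cball by blast
  define \<phi> where "\<phi> x = flat_exp 0 (r\<^sup>2 - (norm (x - p))\<^sup>2)" for x
  have ball: "\<phi> x \<noteq> 0 \<longleftrightarrow> x \<in> ball p r" for x
  proof -
    have "r\<^sup>2 - (norm (x - p))\<^sup>2 > 0 \<longleftrightarrow> norm (x - p) < r"
      using r by (auto intro: power_strict_mono dest: power_less_imp_less_base)
    then show ?thesis by (auto simp: \<phi>_def flat_exp_def dist_norm norm_minus_commute)
  qed
  have cl: "closure {x. \<phi> x \<noteq> 0} = cball p r"
  proof -
    have "{x. \<phi> x \<noteq> 0} = ball p r" using ball by blast
    then show ?thesis using r by simp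
  qed
  have \<phi>: "\<phi> \<in> Cc_infinity \<Omega>"
  proof -
    have "\<phi> = (\<lambda>x. flat_exp 0 (r\<^sup>2 - (norm (x - p))\<^sup>2))"
      by (simp add: \<phi>_def fun_eq_iff)
    then have "bump_algebra p r \<phi>" by (simp only: bump_algebra.bump)
    then show ?thesis
      unfolding Cc_infinity_def mem_Collect_eq cl using r(2) by (auto intro: bump_algebra_C_k)
  qed
  have "sq_int \<phi> \<noteq> 0"
  proof
    assume "sq_int \<phi> = 0"
    then have "AE x in lborel. (\<phi> x)\<^sup>2 = 0"
      using Cc_infinity_integrable(2)[OF \<phi>] by (subst (asm) integral_nonneg_eq_0_iff_AE) auto
    then have "AE x in lborel. x \<notin> ball p r"
      by eventually_elim (use ball in auto)
    then have "emeasure lborel (ball p r) = 0"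
      by (subst (asm) AE_iff_measurable[of "ball p r"]) auto
    moreover have "emeasure lborel (ball p r) > 0"
      using r by (simp add: emeasure_ball)
    ultimately show False by simp
  qed
  moreover have "sq_int \<phi> \<ge> 0" by simp
  ultimately have pos: "sq_int \<phi> > 0" by linarith
  show ?thesis by (rule that[OF \<phi> pos])
qed

subsection \<open>Quadratic forms\<close>

definition near_form :: "('a::euclidean_space \<Rightarrow> real) \<Rightarrow> ('a \<Rightarrow> real) \<Rightarrow> real" where
  "near_form u w = (\<integral>p. (case p of (x, y) \<Rightarrow> near_kernel (x - y) * ((u x - u y) * (w x - w y))) \<partial>lborel\<^sub>2)"

text \<open>\<open>near_energy\<close> is 0 on a non-integrable integrand, so finiteness has to be
  carried as a predicate of its own.\<close>

definition finite_energy :: "('a::euclidean_space \<Rightarrow> real) \<Rightarrow> bool" where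
  "finite_energy u \<longleftrightarrow> integrable lborel\<^sub>2 (\<lambda>(x, y). near_kernel (x - y) * (u x - u y)\<^sup>2)"

lemma AE_pair_lborel:
  fixes P Q :: "'a::euclidean_space \<Rightarrow> bool"
  assumes "AE x in lborel. P x" "AE x in lborel. Q x"
  shows "AE p in lborel\<^sub>2. P (fst p) \<and> Q (snd p)"
proof -
  obtain N1 where N1: "N1 \<in> null_sets lborel" "{x. \<not> P x} \<subseteq> N1"
    using assms(1) by (auto simp: eventually_ae_filter)
  obtain N2 where N2: "N2 \<in> null_sets lborel" "{x. \<not> Q x} \<subseteq> N2"
    using assms(2) by (auto simp: eventually_ae_filter)
  have [measurable]: "N1 \<in> sets lborel" "N2 \<in> sets lborel" using N1 N2 by auto
  have "AE p in lborel\<^sub>2. fst p \<notin> N1 \<and> snd p \<notin> N2"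
  proof (rule lborel_pair.AE_pair_measure)
    show "{p \<in> space lborel\<^sub>2. fst p \<notin> N1 \<and> snd p \<notin> N2} \<in> sets lborel\<^sub>2"
      by measurable
    have "AE x in lborel. x \<notin> N1" "AE x in lborel. x \<notin> N2"
      using N1 N2 by (auto intro: AE_not_in)
    then show "AE x in lborel. AE y in lborel. fst (x, y) \<notin> N1 \<and> snd (x, y) \<notin> N2" by auto
  qed
  then show ?thesis
    by eventually_elim (use N1(2) N2(2) in auto)
qed

context
  fixes u w :: "'a::euclidean_space \<Rightarrow> real"
  assumes [measurable]: "u \<in> borel_measurable borel" "w \<in> borel_measurable borel"
    and E: "finite_energy u" "finite_energy w"
begin

lemma near_form_integrable:
  "integrable lborel\<^sub>2 (\<lambda>(x, y). near_kernel (x - y) * ((u x - u y) * (w x - w y)))"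
proof (rule Bochner_Integration.integrable_bound)
  show "integrable lborel\<^sub>2 (\<lambda>p. (case p of (x, y) \<Rightarrow> near_kernel (x - y) * (u x - u y)\<^sup>2) +
      (case p of (x, y) \<Rightarrow> near_kernel (x - y) * (w x - w y)\<^sup>2))"
    using E unfolding finite_energy_def by (rule Bochner_Integration.integrable_add)
  have "\<bar>k * (a * b)\<bar> \<le> \<bar>k * a\<^sup>2 + k * b\<^sup>2\<bar>" if "k \<ge> 0" for k a b :: real
  proof -
    have "2 * (\<bar>a\<bar> * \<bar>b\<bar>) \<le> a\<^sup>2 + b\<^sup>2"
      using sum_squares_bound[of "\<bar>a\<bar>" "\<bar>b\<bar>"] by (simp add: mult.assoc)
    moreover have "0 \<le> \<bar>a\<bar> * \<bar>b\<bar>" by simp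
    ultimately have "\<bar>a\<bar> * \<bar>b\<bar> \<le> a\<^sup>2 + b\<^sup>2" by linarith
    from mult_left_mono[OF this that] that show ?thesis
      by (simp add: abs_mult distrib_left)
  qed
  then show "AE p in lborel\<^sub>2. norm (case p of (x, y) \<Rightarrow> near_kernel (x - y) * ((u x - u y) * (w x - w y))) \<le>
    norm ((case p of (x, y) \<Rightarrow> near_kernel (x - y) * (u x - u y)\<^sup>2) + (case p of (x, y) \<Rightarrow> near_kernel (x - y) * (w x - w y)\<^sup>2))"
    by (simp add: split_beta')
qed measurable

lemma near_energy_lincomb:
  "finite_energy (\<lambda>x. u x + t * w x)"
  "near_energy (\<lambda>x. u x + t * w x) = near_energy u + 2 * t * near_form u w + t\<^sup>2 * near_energy w"
proof -
  have "has_bochner_integral lborel\<^sub>2 (\<lambda>p. (case p of (x, y) \<Rightarrow> near_kernel (x - y) * (u x - u y)\<^sup>2) +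
      (2 * t) * (case p of (x, y) \<Rightarrow> near_kernel (x - y) * ((u x - u y) * (w x - w y))) +
      t\<^sup>2 * (case p of (x, y) \<Rightarrow> near_kernel (x - y) * (w x - w y)\<^sup>2))
     (near_energy u + (2 * t) * near_form u w + t\<^sup>2 * near_energy w)"
    using E near_form_integrable
    by (intro has_bochner_integral_add has_bochner_integral_mult_right)
      (auto simp: has_bochner_integral_iff finite_energy_def near_energy_def near_form_def)
  moreover have "(\<lambda>p. (case p of (x, y) \<Rightarrow> near_kernel (x - y) * (u x - u y)\<^sup>2) +
      (2 * t) * (case p of (x, y) \<Rightarrow> near_kernel (x - y) * ((u x - u y) * (w x - w y))) +
      t\<^sup>2 * (case p of (x, y) \<Rightarrow> near_kernel (x - y) * (w x - w y)\<^sup>2)) =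
     (\<lambda>(x, y). near_kernel (x - y) * ((u x + t * w x) - (u y + t * w y))\<^sup>2)"
    by (auto simp: fun_eq_iff power2_eq_square algebra_simps)
  ultimately show "finite_energy (\<lambda>x. u x + t * w x)"
    "near_energy (\<lambda>x. u x + t * w x) = near_energy u + 2 * t * near_form u w + t\<^sup>2 * near_energy w"
    by (auto simp: has_bochner_integral_iff finite_energy_def near_energy_def)
qed

text \<open>The parallelogram law with the energy of the sum dropped.\<close>

lemma near_energy_diff_le:
  "near_energy (\<lambda>x. u x - w x) \<le> 2 * near_energy u + 2 * near_energy w"
proof -
  have p: "near_energy (\<lambda>x. u x + 1 * w x) \<ge> 0"
    unfolding near_energy_def by (rule integral_nonneg_AE) (auto simp: split_beta')
  then show ?thesis
    using near_energy_lincomb(2)[of "-1"] near_energy_lincomb(2)[of 1] by simp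
qed

end

lemma near_energy_nonneg: "near_energy u \<ge> 0"
  unfolding near_energy_def by (rule integral_nonneg_AE) (auto simp: split_beta')

lemma far_form_commute:
  assumes [measurable]: "u \<in> borel_measurable borel" "w \<in> borel_measurable borel"
  shows "far_form u w = far_form w u"
proof -
  have "far_form w u = (\<integral>p. (case p of (x, y) \<Rightarrow> far_kernel (y - x) * (w y * u x)) \<partial>lborel\<^sub>2)"
    unfolding far_form_def
    by (subst lborel_pair.integral_product_swap[symmetric]) (auto simp: split_beta')
  also have "(\<lambda>p. case p of (x, y) \<Rightarrow> far_kernel (y - x) * (w y * u x)) = (\<lambda>(x, y). far_kernel (x - y) * (u x * w y))"
    by (auto simp: fun_eq_iff far_kernel_def log_kernel_def norm_minus_commute indicator_def dist_norm)
  finally show ?thesis by (simp add: far_form_def)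
qed

text \<open>The far kernel is at most 1, so the far form is bounded by the product of the L1 norms;
  this makes it continuous under L1 convergence.\<close>

lemma abs_far_form_le:
  assumes f: "integrable lborel f" and g: "integrable lborel g"
  shows "\<bar>far_form f g\<bar> \<le> (\<integral>x. \<bar>f x\<bar> \<partial>lborel) * (\<integral>x. \<bar>g x\<bar> \<partial>lborel)"
proof -
  have I: "integrable lborel\<^sub>2 (\<lambda>(x, y). \<bar>f x\<bar> * \<bar>g y\<bar>)"
    using f g by (intro integrable_product_pair integrable_abs)
  have "\<bar>far_form f g\<bar> \<le> (\<integral>p. \<bar>case p of (x, y) \<Rightarrow> far_kernel (x - y) * (f x * g y)\<bar> \<partial>lborel\<^sub>2)"
    unfolding far_form_def by (rule integral_abs_bound)
  also have "\<dots> \<le> (\<integral>p. (case p of (x, y) \<Rightarrow> \<bar>f x\<bar> * \<bar>g y\<bar>) \<partial>lborel\<^sub>2)"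
    using far_form_integrable[OF f g] I
    by (intro integral_mono integrable_abs) (auto simp: abs_mult split_beta' intro!: mult_left_le_one_le far_kernel_le_1)
  also have "\<dots> = (\<integral>x. \<bar>f x\<bar> \<partial>lborel) * (\<integral>x. \<bar>g x\<bar> \<partial>lborel)"
    by (subst lborel_pair.integral_fst'[OF I, symmetric]) simp
  finally show ?thesis .
qed

lemma far_form_lincomb:
  assumes f: "integrable lborel f" and g: "integrable lborel g"
  shows "far_form (\<lambda>x. f x + t * g x) (\<lambda>x. f x + t * g x) = far_form f f + 2 * t * far_form f g + t\<^sup>2 * far_form g g"
proof -
  have c: "far_form g f = far_form f g"
    using f g by (intro far_form_commute) (auto dest: borel_measurable_integrable)
  have "has_bochner_integral lborel\<^sub>2 (\<lambda>p. (case p of (x, y) \<Rightarrow> far_kernel (x - y) * (f x * f y)) +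
     t * (case p of (x, y) \<Rightarrow> far_kernel (x - y) * (f x * g y)) + t * (case p of (x, y) \<Rightarrow> far_kernel (x - y) * (g x * f y)) +
     t\<^sup>2 * (case p of (x, y) \<Rightarrow> far_kernel (x - y) * (g x * g y)))
    (far_form f f + t * far_form f g + t * far_form g f + t\<^sup>2 * far_form g g)"
    using far_form_integrable[OF f f] far_form_integrable[OF f g] far_form_integrable[OF g f] far_form_integrable[OF g g]
    by (intro has_bochner_integral_add has_bochner_integral_mult_right) (auto simp: has_bochner_integral_iff far_form_def)
  moreover have "(\<lambda>p. (case p of (x, y) \<Rightarrow> far_kernel (x - y) * (f x * f y)) +
     t * (case p of (x, y) \<Rightarrow> far_kernel (x - y) * (f x * g y)) + t * (case p of (x, y) \<Rightarrow> far_kernel (x - y) * (g x * f y)) +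
     t\<^sup>2 * (case p of (x, y) \<Rightarrow> far_kernel (x - y) * (g x * g y))) =
     (\<lambda>(x, y). far_kernel (x - y) * ((f x + t * g x) * (f y + t * g y)))"
    by (auto simp: fun_eq_iff power2_eq_square algebra_simps)
  ultimately show ?thesis
    unfolding c by (simp add: has_bochner_integral_iff far_form_def)
qed

text \<open>The bridge between the definitions, stated over completed Lebesgue measure, and Borel
  functions over \<open>lborel\<close>, to which Fubini applies.\<close>

lemma lebesgue_eq_borel_AE:
  fixes f f' :: "'a::euclidean_space \<Rightarrow> 'b::euclidean_space"
  assumes f'[measurable]: "f' \<in> borel_measurable borel" and AE: "AE x in lborel. f x = f' x"
  shows "f \<in> borel_measurable lebesgue"
    and "integrable lebesgue f \<longleftrightarrow> integrable lborel f'"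
    and "integral\<^sup>L lebesgue f = integral\<^sup>L lborel f'"
proof -
  have m': "f' \<in> borel_measurable lebesgue" by (simp add: measurable_completion)
  have AE': "AE x in lebesgue. f x = f' x" using AE by (rule AE_completion)
  then show m: "f \<in> borel_measurable lebesgue"
    by (intro borel_measurable_AE[OF m']) (auto elim: eventually_mono)
  show "integrable lebesgue f \<longleftrightarrow> integrable lborel f'"
    using integrable_cong_AE[OF m m' AE'] by (simp add: integrable_completion)
  show "integral\<^sup>L lebesgue f = integral\<^sup>L lborel f'"
    using integral_cong_AE[OF m m' AE'] by (simp add: integral_completion)
qed

text \<open>E_L depends only on the almost-everywhere classes of its arguments, since almost
  everywhere in both coordinates means almost everywhere on pairs. No integrability is assumed: an
  integral that does not exist is 0 on both sides.\<close>

lemma E_L_eq_AE: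
  fixes u w :: "real ^ 'n \<Rightarrow> real"
  assumes [measurable]: "u' \<in> borel_measurable borel" "w' \<in> borel_measurable borel"
    and u: "AE x in lborel. u x = u' x" and w: "AE x in lborel. w x = w' x"
  shows "E_L u w = c_const CARD('n) / 2 * near_form u' w' - c_const CARD('n) * far_form u' w'
    + rho_const CARD('n) * (\<integral>x. u' x * w' x \<partial>lborel)"
proof -
  have uw: "AE x in lborel. u x = u' x \<and> w x = w' x" using u w by eventually_elim simp
  have AE2: "AE p in lborel. (u (fst p) = u' (fst p) \<and> w (fst p) = w' (fst p)) \<and> (u (snd p) = u' (snd p) \<and> w (snd p) = w' (snd p))"
    by (rule AE_pair_lborel[OF uw uw, unfolded lborel_prod])
  have m: "(\<lambda>(x, y). near_kernel (x - y) * ((u' x - u' y) * (w' x - w' y))) \<in> borel_measurable lborel\<^sub>2"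
     "(\<lambda>(x, y). far_kernel (x - y) * (u' x * w' y)) \<in> borel_measurable lborel\<^sub>2"
    by measurable
  have near: "AE p in lborel. indicator near_pairs p *\<^sub>R (case p of (x, y) \<Rightarrow> (u x - u y) * (w x - w y) / dist x y ^ CARD('n))
     = (case p of (x, y) \<Rightarrow> near_kernel (x - y) * ((u' x - u' y) * (w' x - w' y)))"
    using AE2 by eventually_elim
      (auto simp: near_pairs_def near_kernel_def log_kernel_def indicator_def dist_norm norm_minus_commute)
  have far: "AE p in lborel. indicator far_pairs p *\<^sub>R (case p of (x, y) \<Rightarrow> u x * w y / dist x y ^ CARD('n))
     = (case p of (x, y) \<Rightarrow> far_kernel (x - y) * (u' x * w' y))"
    using AE2 by eventually_elim
      (auto simp: far_pairs_def far_kernel_def log_kernel_def indicator_def dist_norm norm_minus_commute)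
  have prod: "AE x in lborel. u x * w x = u' x * w' x" using uw by eventually_elim simp
  show ?thesis
    unfolding E_L_def set_lebesgue_integral_def near_form_def far_form_def
    using lebesgue_eq_borel_AE(3)[OF _ near] lebesgue_eq_borel_AE(3)[OF _ far] lebesgue_eq_borel_AE(3)[OF _ prod] m
    by (simp add: lborel_prod)
qed

lemmas E_L_eq = E_L_eq_AE[OF _ _ AE_I2 AE_I2, OF _ _ refl refl]

lemma near_form_self: "near_form u u = near_energy u"
  by (simp add: near_form_def near_energy_def power2_eq_square)

lemma near_pairs_integrable_iff:
  fixes u :: "real ^ 'n \<Rightarrow> real"
  assumes [measurable]: "u' \<in> borel_measurable borel" and u: "AE x in lborel. u x = u' x"
  shows "set_integrable lebesgue near_pairs (\<lambda>(x, y). (u x - u y)\<^sup>2 / dist x y ^ CARD('n)) \<longleftrightarrow> finite_energy u'"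
proof -
  have AE2: "AE p in lborel. u (fst p) = u' (fst p) \<and> u (snd p) = u' (snd p)"
    by (rule AE_pair_lborel[OF u u, unfolded lborel_prod])
  have near: "AE p in lborel. indicator near_pairs p *\<^sub>R (case p of (x, y) \<Rightarrow> (u x - u y)\<^sup>2 / dist x y ^ CARD('n))
     = (case p of (x, y) \<Rightarrow> near_kernel (x - y) * (u' x - u' y)\<^sup>2)"
    using AE2 by eventually_elim
      (auto simp: near_pairs_def near_kernel_def log_kernel_def indicator_def dist_norm norm_minus_commute)
  have m: "(\<lambda>(x, y). near_kernel (x - y) * (u' x - u' y)\<^sup>2) \<in> borel_measurable lborel\<^sub>2"
    by measurable
  show ?thesis
    unfolding set_integrable_def finite_energy_def
    using lebesgue_eq_borel_AE(2)[OF _ near] m by (simp add: lborel_prod)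
qed

lemma H_space_borel_iff:
  fixes u :: "real ^ 'n \<Rightarrow> real"
  assumes u[measurable]: "u \<in> borel_measurable borel"
  shows "u \<in> H_space \<Omega> \<longleftrightarrow> (\<forall>x. x \<notin> \<Omega> \<longrightarrow> u x = 0) \<and> finite_energy u"
proof -
  have "u \<in> borel_measurable lebesgue" by (simp add: measurable_completion)
  then show ?thesis
    unfolding H_space_def using near_pairs_integrable_iff[OF u, of u] by auto
qed

lemma H_space_borel_representative:
  fixes u :: "real ^ 'n \<Rightarrow> real"
  assumes u: "u \<in> H_space \<Omega>" and \<Omega>: "open \<Omega>"
  obtains u' where "u' \<in> borel_measurable borel" "\<And>x. x \<notin> \<Omega> \<Longrightarrow> u' x = 0" "finite_energy u'"
    "AE x in lborel. u x = u' x"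
proof -
  have [measurable]: "\<Omega> \<in> sets borel" using \<Omega> by simp
  obtain v where v[measurable]: "v \<in> borel_measurable lborel" and AE: "AE x in lborel. u x = v x"
    using completion_ex_borel_measurable_real[of u lborel] u by (auto simp: H_space_def)
  \<comment> \<open>The indicator makes the representative vanish everywhere outside \<Omega>, not
    just almost everywhere.\<close>
  define u' where "u' x = indicator \<Omega> x * v x" for x
  have m: "u' \<in> borel_measurable borel" unfolding u'_def using v by simp
  have 0: "u' x = 0" if "x \<notin> \<Omega>" for x using that by (simp add: u'_def)
  have AE': "AE x in lborel. u x = u' x"
    using AE by eventually_elim (use u in \<open>auto simp: u'_def H_space_def indicator_def\<close>)
  have "finite_energy u'"
    using near_pairs_integrable_iff[OF m AE'] u by (auto simp: H_space_def)
  then show ?thesis using that m 0 AE' by blast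
qed

subsection \<open>Square integrable functions and compactness\<close>

lemma square_integrable_mult:
  fixes f g :: "'a \<Rightarrow> real"
  assumes [measurable]: "f \<in> borel_measurable M" "g \<in> borel_measurable M"
    and f: "integrable M (\<lambda>x. (f x)\<^sup>2)" and g: "integrable M (\<lambda>x. (g x)\<^sup>2)"
  shows "integrable M (\<lambda>x. f x * g x)"
proof (rule Bochner_Integration.integrable_bound)
  show "integrable M (\<lambda>x. (f x)\<^sup>2 + (g x)\<^sup>2)" using f g by simp
  have "\<bar>a * b\<bar> \<le> a\<^sup>2 + b\<^sup>2" for a b :: real
  proof -
    have "2 * (\<bar>a\<bar> * \<bar>b\<bar>) \<le> a\<^sup>2 + b\<^sup>2"
      using sum_squares_bound[of "\<bar>a\<bar>" "\<bar>b\<bar>"] by (simp add: mult.assoc)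
    moreover have "0 \<le> \<bar>a\<bar> * \<bar>b\<bar>" by simp
    ultimately show ?thesis unfolding abs_mult by linarith
  qed
  then show "AE x in M. norm (f x * g x) \<le> norm ((f x)\<^sup>2 + (g x)\<^sup>2)"
    by simp
qed measurable

lemma Cauchy_Schwarz_integral:
  fixes f g :: "'a \<Rightarrow> real"
  assumes [measurable]: "f \<in> borel_measurable M" "g \<in> borel_measurable M"
    and f: "integrable M (\<lambda>x. (f x)\<^sup>2)" and g: "integrable M (\<lambda>x. (g x)\<^sup>2)"
  shows "(\<integral>x. f x * g x \<partial>M)\<^sup>2 \<le> (\<integral>x. (f x)\<^sup>2 \<partial>M) * (\<integral>x. (g x)\<^sup>2 \<partial>M)"
proof -
  have fg: "integrable M (\<lambda>x. f x * g x)"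
    by (rule square_integrable_mult) (use f g in auto)
  define A B C where "A = (\<integral>x. (f x)\<^sup>2 \<partial>M)" and "B = (\<integral>x. f x * g x \<partial>M)" and "C = (\<integral>x. (g x)\<^sup>2 \<partial>M)"
  have C: "C \<ge> 0" by (simp add: C_def)
  show ?thesis
  proof (cases "C = 0")
    case True
    then have "AE x in M. (g x)\<^sup>2 = 0"
      using g by (subst (asm) C_def, subst (asm) integral_nonneg_eq_0_iff_AE) auto
    then have "AE x in M. f x * g x = 0" by eventually_elim simp
    then have "B = 0" unfolding B_def by (rule integral_eq_zero_AE)
    with True show ?thesis by (simp add: A_def B_def C_def)
  next
    case False
    have "0 \<le> (\<integral>x. (C * f x - B * g x)\<^sup>2 \<partial>M)" by simp
    also have "\<dots> = (\<integral>x. C\<^sup>2 * (f x)\<^sup>2 - 2 * C * B * (f x * g x) + B\<^sup>2 * (g x)\<^sup>2 \<partial>M)"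
      by (intro Bochner_Integration.integral_cong refl) (simp add: power2_eq_square algebra_simps)
    also have "\<dots> = C\<^sup>2 * A - 2 * C * B * B + B\<^sup>2 * C"
      using f g fg by (simp add: A_def B_def C_def)
    also have "\<dots> = C * (A * C - B\<^sup>2)"
      by (simp add: power2_eq_square algebra_simps)
    finally have "B\<^sup>2 \<le> A * C"
      using C False by (simp add: zero_le_mult_iff)
    then show ?thesis by (simp add: A_def B_def C_def)
  qed
qed

text \<open>Cauchy-Schwarz against the indicator of A: on a set of finite measure L2 bounds give L1
  bounds.\<close>

lemma square_integrable_imp_integrable:
  fixes f :: "'a \<Rightarrow> 'b::{banach, second_countable_topology}"
  assumes f[measurable]: "f \<in> borel_measurable M" and A[measurable]: "A \<in> sets M" "emeasure M A < \<infinity>"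
    and supp: "\<And>x. x \<notin> A \<Longrightarrow> f x = 0" and f2: "integrable M (\<lambda>x. (norm (f x))\<^sup>2)"
  shows "integrable M f" "(\<integral>x. norm (f x) \<partial>M)\<^sup>2 \<le> measure M A * (\<integral>x. (norm (f x))\<^sup>2 \<partial>M)"
proof -
  have i2: "integrable M (\<lambda>x. (indicator A x :: real)\<^sup>2)" "(\<integral>x. (indicator A x :: real)\<^sup>2 \<partial>M) = measure M A"
  proof -
    have "(\<lambda>x. (indicator A x :: real)\<^sup>2) = indicator A" by (auto simp: indicator_def)
    then show "integrable M (\<lambda>x. (indicator A x :: real)\<^sup>2)" "(\<integral>x. (indicator A x :: real)\<^sup>2 \<partial>M) = measure M A"
      using A by (auto simp: less_top Int_absorb2 sets.sets_into_space)
  qed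
  have eq: "(\<lambda>x. norm (f x)) = (\<lambda>x. indicator A x * norm (f x))"
    using supp by (auto simp: fun_eq_iff indicator_def)
  have "integrable M (\<lambda>x. indicator A x * norm (f x))"
    using i2 f2 by (intro square_integrable_mult) auto
  then have "integrable M (\<lambda>x. norm (f x))" by (subst eq)
  then show "integrable M f" by (subst (asm) integrable_norm_iff) auto
  have "(\<integral>x. indicator A x * norm (f x) \<partial>M)\<^sup>2 \<le> measure M A * (\<integral>x. (norm (f x))\<^sup>2 \<partial>M)"
    using Cauchy_Schwarz_integral[of "indicator A" M "\<lambda>x. norm (f x)"] i2 f2 by simp
  then show "(\<integral>x. norm (f x) \<partial>M)\<^sup>2 \<le> measure M A * (\<integral>x. (norm (f x))\<^sup>2 \<partial>M)" by (subst eq)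
qed

lemma norm_add_square_le: "(norm (a + b))\<^sup>2 \<le> 2 * (norm a)\<^sup>2 + 2 * (norm (b :: 'a::real_normed_vector))\<^sup>2"
proof -
  have "(norm (a + b))\<^sup>2 \<le> (norm a + norm b)\<^sup>2"
    by (intro power_mono norm_triangle_ineq) simp
  also have "\<dots> \<le> 2 * (norm a)\<^sup>2 + 2 * (norm b)\<^sup>2"
    using sum_squares_bound[of "norm a" "norm b"] by (simp add: power2_sum)
  finally show ?thesis .
qed

lemma norm_diff_square_le: "(norm (a - b))\<^sup>2 \<le> 2 * (norm a)\<^sup>2 + 2 * (norm (b :: 'a::real_normed_vector))\<^sup>2"
  using norm_add_square_le[of a "- b"] by simp

lemma square_integrable_diff:
  fixes f g :: "'a \<Rightarrow> 'b::{banach, second_countable_topology}"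
  assumes [measurable]: "f \<in> borel_measurable M" "g \<in> borel_measurable M"
    and f: "integrable M (\<lambda>x. (norm (f x))\<^sup>2)" and g: "integrable M (\<lambda>x. (norm (g x))\<^sup>2)"
  shows "integrable M (\<lambda>x. (norm (f x - g x))\<^sup>2)"
proof (rule Bochner_Integration.integrable_bound)
  show "integrable M (\<lambda>x. 2 * (norm (f x))\<^sup>2 + 2 * (norm (g x))\<^sup>2)" using f g by simp
  show "AE x in M. norm ((norm (f x - g x))\<^sup>2) \<le> norm (2 * (norm (f x))\<^sup>2 + 2 * (norm (g x))\<^sup>2)"
    using norm_diff_square_le[of "f x" "g x" for x] by simp
qed measurable

text \<open>Completeness of L2 for functions supported in a set of finite measure. There an L2
  Cauchy sequence is L1 Cauchy and has an almost everywhere convergent subsequence; Fatou's lemma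
  returns the convergence in L2. The subsequence is exported because lower semicontinuity of the
  energy needs pointwise convergence.\<close>

lemma L2_Cauchy_limit:
  fixes f :: "nat \<Rightarrow> 'a \<Rightarrow> 'b::euclidean_space"
  assumes f[measurable]: "\<And>k. f k \<in> borel_measurable M" and A[measurable]: "A \<in> sets M" "emeasure M A < \<infinity>"
    and supp: "\<And>k x. x \<notin> A \<Longrightarrow> f k x = 0" and f2: "\<And>k. integrable M (\<lambda>x. (norm (f k x))\<^sup>2)"
    and C: "\<And>e. e > 0 \<Longrightarrow> \<exists>K. \<forall>m\<ge>K. \<forall>n\<ge>K. (\<integral>x. (norm (f m x - f n x))\<^sup>2 \<partial>M) < e"
  obtains g r where "g \<in> borel_measurable M" "\<And>x. x \<notin> A \<Longrightarrow> g x = 0" "integrable M (\<lambda>x. (norm (g x))\<^sup>2)"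
    "strict_mono (r :: nat \<Rightarrow> nat)" "AE x in M. (\<lambda>k. f (r k) x) \<longlonglongrightarrow> g x"
    "(\<lambda>k. \<integral>x. (norm (f k x - g x))\<^sup>2 \<partial>M) \<longlonglongrightarrow> 0"
proof -
  note d2 = square_integrable_diff[OF f f f2 f2]
  have f1: "integrable M (f k)" for k
    by (rule square_integrable_imp_integrable(1)[OF f A supp f2])
  have C1: "\<exists>K. \<forall>i\<ge>K. \<forall>j\<ge>K. (\<integral>x. norm (f i x - f j x) \<partial>M) < e" if e: "e > 0" for e
  proof -
    define m where "m = measure M A + 1"
    have m: "m > 0" by (simp add: m_def add_nonneg_pos)
    obtain K where K: "\<And>i j. i \<ge> K \<Longrightarrow> j \<ge> K \<Longrightarrow> (\<integral>x. (norm (f i x - f j x))\<^sup>2 \<partial>M) < e\<^sup>2 / m"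
      using C[of "e\<^sup>2 / m"] e m by auto
    have "(\<integral>x. norm (f i x - f j x) \<partial>M) < e" if "i \<ge> K" "j \<ge> K" for i j
    proof -
      have "(\<integral>x. norm (f i x - f j x) \<partial>M)\<^sup>2 \<le> measure M A * (\<integral>x. (norm (f i x - f j x))\<^sup>2 \<partial>M)"
        using supp by (intro square_integrable_imp_integrable(2)[OF _ A _ d2]) auto
      also have "\<dots> \<le> m * (\<integral>x. (norm (f i x - f j x))\<^sup>2 \<partial>M)"
        by (intro mult_right_mono) (auto simp: m_def)
      also have "\<dots> < m * (e\<^sup>2 / m)"
        using K[OF that] m by (intro mult_strict_left_mono) auto
      also have "\<dots> = e\<^sup>2" using m by simp
      finally show ?thesis using e by (intro power_less_imp_less_base[of _ 2 e]) auto
    qed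
    then show "\<exists>K. \<forall>i\<ge>K. \<forall>j\<ge>K. (\<integral>x. norm (f i x - f j x) \<partial>M) < e" by blast
  qed
  obtain r where r: "strict_mono r" and Cr: "AE x in M. Cauchy (\<lambda>i. f (r i) x)"
    by (rule cauchy_L1_AE_cauchy_subseq[OF f1 C1], assumption, rule that)
  define g where "g x = lim (\<lambda>i. f (r i) x)" for x
  have g[measurable]: "g \<in> borel_measurable M"
    unfolding g_def by (rule borel_measurable_lim_metric) simp
  have g0: "g x = 0" if "x \<notin> A" for x
    using that by (simp add: g_def supp)
  have conv: "AE x in M. (\<lambda>k. f (r k) x) \<longlonglongrightarrow> g x"
    using Cr by eventually_elim (simp add: g_def Cauchy_convergent_iff convergent_LIMSEQ_iff)
  \<comment> \<open>The distance to the limit g is the pointwise limit of the distances to f (r i);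
    since r i >= i, those are controlled by the Cauchy tail.\<close>
  have Fatou: "(\<integral>\<^sup>+x. ennreal ((norm (f k x - g x))\<^sup>2) \<partial>M) \<le> ennreal e"
    if K: "\<And>i. i \<ge> K \<Longrightarrow> (\<integral>x. (norm (f k x - f i x))\<^sup>2 \<partial>M) \<le> e" for k K e
  proof -
    have "(\<integral>\<^sup>+x. ennreal ((norm (f k x - g x))\<^sup>2) \<partial>M) = (\<integral>\<^sup>+x. liminf (\<lambda>i. ennreal ((norm (f k x - f (r i) x))\<^sup>2)) \<partial>M)"
      using conv
    proof (intro nn_integral_cong_AE, eventually_elim)
      case (elim x)
      then have "(\<lambda>i. ennreal ((norm (f k x - f (r i) x))\<^sup>2)) \<longlonglongrightarrow> ennreal ((norm (f k x - g x))\<^sup>2)"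
        by (intro tendsto_ennrealI tendsto_intros)
      then show ?case by (intro lim_imp_Liminf[symmetric] trivial_limit_sequentially)
    qed
    also have "\<dots> \<le> liminf (\<lambda>i. \<integral>\<^sup>+x. ennreal ((norm (f k x - f (r i) x))\<^sup>2) \<partial>M)"
      by (rule nn_integral_liminf) simp
    also have "\<dots> \<le> liminf (\<lambda>i. ennreal e)"
    proof (rule Liminf_mono)
      have "\<forall>\<^sub>F i in sequentially. i \<ge> K" by (rule eventually_ge_at_top)
      then show "\<forall>\<^sub>F i in sequentially. (\<integral>\<^sup>+x. ennreal ((norm (f k x - f (r i) x))\<^sup>2) \<partial>M) \<le> ennreal e"
      proof eventually_elim
        case (elim i)
        then have "r i \<ge> K" using seq_suble[OF r, of i] by linarith
        then show ?case using K[of "r i"] d2 by (subst nn_integral_eq_integral) (auto intro: ennreal_leI)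
      qed
    qed
    finally show ?thesis by (simp add: Liminf_const)
  qed
  have ev: "\<exists>K. \<forall>k\<ge>K. integrable M (\<lambda>x. (norm (f k x - g x))\<^sup>2) \<and> (\<integral>x. (norm (f k x - g x))\<^sup>2 \<partial>M) \<le> e" if e: "e > 0" for e
  proof -
    obtain K where K: "\<And>i j. i \<ge> K \<Longrightarrow> j \<ge> K \<Longrightarrow> (\<integral>x. (norm (f i x - f j x))\<^sup>2 \<partial>M) < e"
      using C[OF e] by auto
    have "integrable M (\<lambda>x. (norm (f k x - g x))\<^sup>2) \<and> (\<integral>x. (norm (f k x - g x))\<^sup>2 \<partial>M) \<le> e" if k: "k \<ge> K" for k
    proof
      have le: "(\<integral>\<^sup>+x. ennreal ((norm (f k x - g x))\<^sup>2) \<partial>M) \<le> ennreal e"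
        by (rule Fatou[of K]) (use K k in \<open>auto intro: less_imp_le\<close>)
      show I: "integrable M (\<lambda>x. (norm (f k x - g x))\<^sup>2)"
        by (rule integrableI_nonneg) (use le in \<open>auto intro: le_less_trans\<close>)
      show "(\<integral>x. (norm (f k x - g x))\<^sup>2 \<partial>M) \<le> e"
        using le e unfolding nn_integral_eq_integral[OF I AE_I2[OF zero_le_power2]] by simp
    qed
    then show ?thesis by blast
  qed
  have lim: "(\<lambda>k. \<integral>x. (norm (f k x - g x))\<^sup>2 \<partial>M) \<longlonglongrightarrow> 0"
  proof (rule LIMSEQ_I)
    fix e :: real assume e: "e > 0"
    then obtain K where "\<forall>k\<ge>K. (\<integral>x. (norm (f k x - g x))\<^sup>2 \<partial>M) \<le> e / 2"
      using ev[of "e / 2"] by auto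
    then show "\<exists>K. \<forall>k\<ge>K. norm ((\<integral>x. (norm (f k x - g x))\<^sup>2 \<partial>M) - 0) < e"
      using e by (intro exI[of _ K]) force
  qed
  obtain K where "integrable M (\<lambda>x. (norm (f K x - g x))\<^sup>2)" using ev[of 1] by auto
  from square_integrable_diff[OF f[of K] _ f2[of K] this]
  have "integrable M (\<lambda>x. (norm (g x))\<^sup>2)" by simp
  then show thesis using that g g0 r conv lim by blast
qed

text \<open>Continuous, compactly supported minorants of the near kernel: the tent factor cuts off
  at distance 1 and the shift by d removes the singularity. Letting d tend to 0 makes their mass
  arbitrarily large.\<close>

definition averaging_kernel :: "real \<Rightarrow> 'a::euclidean_space \<Rightarrow> real" where
  "averaging_kernel d z = max 0 (1 - norm z) / (norm z + d) ^ DIM('a)"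

lemma continuous_averaging_kernel:
  assumes "d > 0"
  shows "continuous_on UNIV (averaging_kernel d)"
proof -
  have "norm z + d \<noteq> 0" for z :: 'a using assms by (smt (verit) norm_ge_zero)
  then show ?thesis
    unfolding averaging_kernel_def by (intro continuous_intros) auto
qed

lemma averaging_kernel_eq_0: "norm z \<ge> 1 \<Longrightarrow> averaging_kernel d z = 0"
  by (simp add: averaging_kernel_def)

lemma averaging_kernel_nonneg: "d > 0 \<Longrightarrow> averaging_kernel d z \<ge> 0"
  unfolding averaging_kernel_def by (intro divide_nonneg_nonneg zero_le_power) auto

lemma averaging_kernel_bounded:
  assumes "d > 0"
  shows "averaging_kernel d (z :: 'a::euclidean_space) \<le> 1 / d ^ DIM('a)"
proof -
  have "max 0 (1 - norm z) / (norm z + d) ^ DIM('a) \<le> 1 / d ^ DIM('a)"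
    using assms by (intro frac_le power_mono) auto
  then show ?thesis by (simp add: averaging_kernel_def)
qed

lemma averaging_kernel_le_near_kernel:
  assumes "d > 0" "z \<noteq> 0"
  shows "averaging_kernel d z \<le> near_kernel (z :: 'a::euclidean_space)"
proof (cases "norm z \<le> 1")
  case True
  have "max 0 (1 - norm z) / (norm z + d) ^ DIM('a) \<le> 1 / norm z ^ DIM('a)"
    using assms by (intro frac_le power_mono) auto
  with True show ?thesis by (simp add: averaging_kernel_def near_kernel_def log_kernel_def)
qed (simp add: averaging_kernel_eq_0)

lemma averaging_kernel_even_kernel:
  assumes "d > 0"
  shows "even_kernel (averaging_kernel d :: 'a::euclidean_space \<Rightarrow> real)"
proof
  show "averaging_kernel d \<in> borel_measurable (borel :: 'a measure)"
    by (rule borel_measurable_continuous_onI[OF continuous_averaging_kernel[OF assms]])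
  show "integrable lborel (averaging_kernel d :: 'a \<Rightarrow> real)"
    by (rule integrable_continuous_compact_support[OF continuous_averaging_kernel[OF assms], of "cball 0 1"])
      (auto simp: averaging_kernel_eq_0)
  show "averaging_kernel d z \<ge> 0" for z :: 'a by (rule averaging_kernel_nonneg[OF assms])
qed (simp add: averaging_kernel_def)

lemma averaging_kernel_uniformly_continuous:
  fixes e :: real
  assumes d: "d > 0" and e: "e > 0"
  obtains r where "r > 0"
    "\<And>y z :: 'a::euclidean_space. norm (y - z) < r \<Longrightarrow> \<bar>averaging_kernel d y - averaging_kernel d z\<bar> < e"
proof -
  have "uniformly_continuous_on (cball 0 2 :: 'a set) (averaging_kernel d)"
    by (intro compact_uniformly_continuous continuous_on_subset[OF continuous_averaging_kernel[OF d]]) auto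
  then obtain r where r: "r > 0"
    "\<And>y z :: 'a. y \<in> cball 0 2 \<Longrightarrow> z \<in> cball 0 2 \<Longrightarrow> dist y z < r \<Longrightarrow> dist (averaging_kernel d y) (averaging_kernel d z) < e"
    using e unfolding uniformly_continuous_on_def by metis
  have "\<bar>averaging_kernel d y - averaging_kernel d z\<bar> < e" if yz: "norm (y - z) < min r 1" for y z :: 'a
  proof (cases "norm y \<le> 1 \<or> norm z \<le> 1")
    case True
    have "norm y \<le> norm z + norm (y - z)" "norm z \<le> norm y + norm (y - z)"
      using norm_triangle_sub[of y z] norm_triangle_sub[of z y] by (simp_all add: norm_minus_commute)
    with True yz have "norm y \<le> 2" "norm z \<le> 2" by linarith+
    then show ?thesis using r(2)[of y z] yz by (simp add: dist_norm)
  next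
    case False
    then show ?thesis using e by (simp add: averaging_kernel_eq_0)
  qed
  then show thesis using that[of "min r 1"] r(1) by simp
qed

text \<open>A quantitative form of the non-integrability of |z|^(-N) at 0. For d <= |z| <= 1/2 the
  tent is at least 1/2 and |z| + d <= 2 |z|, so the kernel exceeds a fixed multiple of |z|^(-N),
  whose integral over this shell is logarithmic in d.\<close>

lemma averaging_kernel_mass_unbounded:
  obtains d where "d > 0" "(\<integral>z. averaging_kernel d z \<partial>(lborel :: 'a::euclidean_space measure)) \<ge> R"
proof -
  define n where "n = DIM('a) / 2"
  have n: "n > 0" by (simp add: n_def)
  define C where "C = pi powr n / Gamma n"
  have C: "C > 0" using Gamma_real_pos[OF n] by (simp add: C_def)
  \<comment> \<open>With d = exp (-T) / 2, the logarithm of the ratio of 1/4 to d^2 is 2 T, and the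
    mass on the shell is at least C T / 2^N; hence the choice against R. The bound T >= 1 keeps d
    below 1/2.\<close>
  define T where "T = max 1 (R * 2 ^ DIM('a) / C)"
  define d where "d = exp (- T) / 2"
  have T: "T \<ge> 1" and d: "d > 0" by (auto simp: T_def d_def)
  have d2: "d < 1 / 2" using T by (simp add: d_def)
  have d4: "d\<^sup>2 \<le> 1 / 4"
    using power_mono[of d "1/2" 2] d d2 by (simp add: power_divide)
  interpret even_kernel "averaging_kernel d :: 'a \<Rightarrow> real" using d by (rule averaging_kernel_even_kernel)
  have lower: "indicator {d\<^sup>2..1/4} ((norm z)\<^sup>2) * (1 / (2 * 2 ^ DIM('a) * ((norm z)\<^sup>2) powr n)) \<le> averaging_kernel d z" for z :: 'a
  proof (cases "d\<^sup>2 \<le> (norm z)\<^sup>2 \<and> (norm z)\<^sup>2 \<le> 1 / 4")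
    case True
    then have z: "d \<le> norm z" "norm z \<le> 1 / 2"
      using d power2_le_imp_le[of d "norm z"] power2_le_imp_le[of "norm z" "1/2"] by (auto simp: power_divide)
    have "(1 / 2) / (2 * norm z) ^ DIM('a) \<le> max 0 (1 - norm z) / (norm z + d) ^ DIM('a)"
      using z d by (intro frac_le power_mono zero_less_power) auto
    with True show ?thesis
      by (simp add: averaging_kernel_def n_def norm_power_DIM[symmetric] power_mult_distrib)
  qed (use d averaging_kernel_nonneg[of d z] in auto)
  have FTC: "has_bochner_integral lborel (\<lambda>r::real. indicator {d\<^sup>2..1/4} r *\<^sub>R (1 / r)) (ln (1 / 4) - ln (d\<^sup>2))"
  proof (rule has_bochner_integral_FTC_Icc)
    have "x > 0" if "d\<^sup>2 \<le> x" for x using d that by (meson less_le_trans zero_less_power)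
    then show "(ln has_vector_derivative 1 / x) (at x within {d\<^sup>2..1/4})" if "d\<^sup>2 \<le> x" "x \<le> 1/4" for x
      using that by (auto intro!: derivative_eq_intros simp: has_real_derivative_iff_has_vector_derivative[symmetric])
    show "continuous_on {d\<^sup>2..1/4} (\<lambda>x::real. 1 / x)"
      using \<open>\<And>x. d\<^sup>2 \<le> x \<Longrightarrow> x > 0\<close> by (intro continuous_intros) force
  qed (use d4 in auto)
  have "ln (1 / 4) - ln (d\<^sup>2) = 2 * T"
  proof -
    have "ln d = - T - ln 2" by (simp add: d_def ln_div)
    moreover have "ln (d\<^sup>2) = 2 * ln d" using d by (simp add: ln_realpow)
    moreover have "ln (1 / 4 :: real) = - 2 * ln 2" using ln_powr[of 2 2] by (simp add: ln_div)
    ultimately show ?thesis by simp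
  qed
  with FTC have FTC: "has_bochner_integral lborel (\<lambda>r::real. indicator {d\<^sup>2..1/4} r * (1 / r)) (2 * T)" by simp
  have nn: "0 \<le> C / (2 * 2 ^ DIM('a)) * (indicator {d\<^sup>2..1/4} r * (1 / r))" for r :: real
  proof (cases "d\<^sup>2 \<le> r")
    case True
    then have "r \<ge> 0" by (rule order_trans[OF zero_le_power2])
    with C show ?thesis by (intro mult_nonneg_nonneg divide_nonneg_nonneg) auto
  qed simp
  have "ennreal (C / (2 * 2 ^ DIM('a)) * (2 * T)) =
      (\<integral>\<^sup>+r. ennreal (C / (2 * 2 ^ DIM('a)) * (indicator {d\<^sup>2..1/4} r * (1 / r))) \<partial>lborel)"
    using has_bochner_integral_mult_right[of "C / (2 * 2 ^ DIM('a))", OF FTC]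
    by (subst nn_integral_eq_integral[OF _ AE_I2[OF nn]]) (auto simp: has_bochner_integral_iff)
  also have "\<dots> = (\<integral>\<^sup>+r. ennreal (indicator {0<..} r * (C * r powr (n - 1))) *
       ennreal (indicator {d\<^sup>2..1/4} r * (1 / (2 * 2 ^ DIM('a) * r powr n))) \<partial>lborel)"
  proof (rule nn_integral_cong)
    fix r :: real
    show "ennreal (C / (2 * 2 ^ DIM('a)) * (indicator {d\<^sup>2..1/4} r * (1 / r))) = ennreal (indicator {0<..} r * (C * r powr (n - 1))) *
       ennreal (indicator {d\<^sup>2..1/4} r * (1 / (2 * 2 ^ DIM('a) * r powr n)))"
    proof (cases "d\<^sup>2 \<le> r \<and> r \<le> 1 / 4")
      case True
      then have r: "r > 0" using d by (meson less_le_trans zero_less_power)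
      show ?thesis
        using True r C by (simp add: ennreal_mult[symmetric] powr_diff)
    qed (auto simp: indicator_def)
  qed
  also have "\<dots> = (\<integral>\<^sup>+z. (\<lambda>r. ennreal (indicator {d\<^sup>2..1/4} r * (1 / (2 * 2 ^ DIM('a) * r powr n)))) ((norm z)\<^sup>2) \<partial>(lborel :: 'a measure))"
    unfolding C_def n_def by (rule nn_integral_radial[symmetric]) simp
  also have "\<dots> \<le> (\<integral>\<^sup>+z. ennreal (averaging_kernel d z) \<partial>(lborel :: 'a measure))"
    by (intro nn_integral_mono ennreal_leI lower)
  also have "\<dots> = ennreal (\<integral>z. averaging_kernel d z \<partial>(lborel :: 'a measure))"
    by (rule nn_integral_eq_integral[OF kernel_integrable]) (simp add: kernel_nonneg)
  finally have "C / (2 * 2 ^ DIM('a)) * (2 * T) \<le> (\<integral>z. averaging_kernel d z \<partial>(lborel :: 'a measure))"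
    by (subst (asm) ennreal_le_iff) (auto simp: kernel_nonneg)
  moreover have "R \<le> C / (2 * 2 ^ DIM('a)) * (2 * T)"
  proof -
    have "R * 2 ^ DIM('a) / C \<le> T" by (simp add: T_def)
    then show ?thesis using C by (simp add: field_simps)
  qed
  ultimately show thesis using that[OF d] by linarith
qed

lemma (in even_kernel) kernel_convolution:
  fixes w :: "'a \<Rightarrow> real"
  assumes [measurable]: "w \<in> borel_measurable borel" and w2: "integrable lborel (\<lambda>x. (w x)\<^sup>2)"
  shows "(\<integral>p. (case p of (x, y) \<Rightarrow> \<kappa> (x - y) * (w x * w y)) \<partial>lborel\<^sub>2) =
    (\<integral>x. w x * (\<integral>y. \<kappa> (x - y) * w y \<partial>lborel) \<partial>lborel)"
proof -
  have "(\<integral>p. (case p of (x, y) \<Rightarrow> \<kappa> (x - y) * (w x * w y)) \<partial>lborel\<^sub>2) =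
    (\<integral>x. \<integral>y. w x * (\<kappa> (x - y) * w y) \<partial>lborel \<partial>lborel)"
    using lborel_pair.integral_fst'[OF kernel_form_integrable[OF assms]] by (simp add: mult.left_commute)
  then show ?thesis by simp
qed

text \<open>Take an averaging kernel K of mass at least j below the near kernel. For a difference w
  of two members, \<open>kernel_form_diff\<close> gives j times the square norm of w at most half
  the near energy of w plus the pairing of w with its convolution by K. The first term is at most 2
  B uniformly. The convolutions are bounded and equicontinuous, so along a diagonal subsequence they
  converge pointwise, and in L2(\<Omega>) by dominated convergence, which bounds the pairing. Large
  j then makes w small.\<close>

lemma compactness_of_finite_energy:
  fixes u :: "nat \<Rightarrow> 'a::euclidean_space \<Rightarrow> real"
  assumes u[measurable]: "\<And>k. u k \<in> borel_measurable borel"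
    and \<Omega>[measurable]: "\<Omega> \<in> sets borel" and bd: "bounded \<Omega>"
    and supp: "\<And>k x. x \<notin> \<Omega> \<Longrightarrow> u k x = 0"
    and u2: "\<And>k. integrable lborel (\<lambda>x. (u k x)\<^sup>2)" and norm: "\<And>k. sq_int (u k) \<le> 1"
    and fin: "\<And>k. finite_energy (u k)" and B: "\<And>k. near_energy (u k) \<le> B"
  obtains r where "strict_mono (r :: nat \<Rightarrow> nat)"
    "\<And>e. e > 0 \<Longrightarrow> \<exists>K. \<forall>m\<ge>K. \<forall>n\<ge>K. (\<integral>x. (u (r m) x - u (r n) x)\<^sup>2 \<partial>lborel) < e"
proof -
  have fm: "emeasure lborel \<Omega> < \<infinity>" using emeasure_bounded_finite[OF bd] by simp
  define V where "V = sqrt (measure lborel \<Omega>)"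
  have u1: "integrable lborel (u k)" and u1V: "(\<integral>x. \<bar>u k x\<bar> \<partial>lborel) \<le> V" for k
  proof -
    show "integrable lborel (u k)"
      by (rule square_integrable_imp_integrable(1)[of _ _ \<Omega>]) (use supp u2 fm in auto)
    have "(\<integral>x. norm (u k x) \<partial>lborel)\<^sup>2 \<le> measure lborel \<Omega> * sq_norm (u k)"
      by (rule square_integrable_imp_integrable(2)) (use supp u2 fm in auto)
    also have "\<dots> \<le> measure lborel \<Omega> * 1"
      using norm by (intro mult_left_mono) auto
    finally show "(\<integral>x. \<bar>u k x\<bar> \<partial>lborel) \<le> V"
      unfolding V_def by (intro real_le_rsqrt) simp
  qed
  have V: "V \<ge> 0" by (simp add: V_def)
  have "\<exists>d. \<forall>j. d j > 0 \<and> (\<integral>z. averaging_kernel (d j) z \<partial>(lborel :: 'a measure)) \<ge> real j"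
  proof (rule choice, rule allI)
    fix j :: nat
    show "\<exists>d>0. (\<integral>z. averaging_kernel d z \<partial>(lborel :: 'a measure)) \<ge> real j"
      by (rule averaging_kernel_mass_unbounded[of "real j"]) blast
  qed
  then obtain d where d: "\<And>j. d j > 0" and mass: "\<And>j. (\<integral>z. averaging_kernel (d j) z \<partial>(lborel :: 'a measure)) \<ge> real j"
    by auto
  define K :: "nat \<Rightarrow> 'a \<Rightarrow> real" where "K j = averaging_kernel (d j)" for j
  define S where "S j = 1 / d j ^ DIM('a)" for j
  have S: "S j > 0" for j using d by (simp add: S_def)
  have K0: "K j z \<ge> 0" and KS: "K j z \<le> S j" for j z
    unfolding K_def S_def by (rule averaging_kernel_nonneg[OF d], rule averaging_kernel_bounded[OF d])
  have K_even: "even_kernel (K j)" for j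
    unfolding K_def by (rule averaging_kernel_even_kernel[OF d])
  have [measurable]: "K j \<in> borel_measurable borel" for j
    using K_even by (rule even_kernel.kernel_measurable)
  define h where "h j k x = (\<integral>y. K j (x - y) * u k y \<partial>lborel)" for j k x
  have Ku: "integrable lborel (\<lambda>y. K j (x - y) * u k y)" for j k x
  proof (rule Bochner_Integration.integrable_bound)
    show "integrable lborel (\<lambda>y. S j * u k y)" using u1 by simp
    show "AE y in lborel. norm (K j (x - y) * u k y) \<le> norm (S j * u k y)"
      using K0 KS S by (auto simp: abs_mult less_imp_le intro!: mult_right_mono)
  qed measurable
  have h_bound: "\<bar>h j k x\<bar> \<le> S j * V" for j k x
  proof -
    have "\<bar>h j k x\<bar> \<le> (\<integral>y. \<bar>K j (x - y) * u k y\<bar> \<partial>lborel)"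
      unfolding h_def by (rule integral_abs_bound)
    also have "\<dots> \<le> (\<integral>y. S j * \<bar>u k y\<bar> \<partial>lborel)"
      using Ku u1 K0 KS S by (intro integral_mono integrable_abs integrable_mult_right)
        (auto simp: abs_mult less_imp_le intro!: mult_right_mono)
    also have "\<dots> \<le> S j * V"
      using u1V S by (simp add: less_imp_le mult_left_mono)
    finally show ?thesis .
  qed
  have [measurable]: "h j k \<in> borel_measurable borel" for j k
    unfolding h_def[abs_def] by measurable
  obtain D :: "'a set" where D: "countable D" "\<And>X. open X \<Longrightarrow> X \<noteq> {} \<Longrightarrow> \<exists>d\<in>D. d \<in> X"
    using countable_dense_setE by metis
  \<comment> \<open>One extraction handles all kernels at all points of a dense countable set.
    Dividing by S j gives every j the common bound V.\<close>
  obtain r where r: "strict_mono (r :: nat \<Rightarrow> nat)"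
    and conv: "\<And>q. q \<in> (UNIV :: nat set) \<times> D \<Longrightarrow> \<exists>l. (\<lambda>n. (\<lambda>n (j, x). h j n x / S j) (r n) q) \<longlonglongrightarrow> l"
  proof (rule function_convergent_subsequence[of "UNIV \<times> D" "\<lambda>n (j, x). h j n x / S j" V])
    show "norm (case q of (j, x) \<Rightarrow> h j n x / S j) \<le> V" for n q
      using h_bound S by (auto simp: split_beta' divide_le_eq mult.commute less_imp_le)
  qed (use D in auto)
  have Cauchy: "Cauchy (\<lambda>n. h j (r n) x)" for j x
  proof (rule metric_CauchyI)
    fix e :: real assume e: "e > 0"
    \<comment> \<open>Moving from x to a nearby dense point x' changes each convolution by at most
      e' * V; V + 1 keeps the denominator positive and the cost below e/3.\<close>
    define e' where "e' = e / (3 * (V + 1))"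
    have e': "e' > 0" using e V by (simp add: e'_def)
    obtain \<rho> where \<rho>: "\<rho> > 0" "\<And>y z. norm (y - z) < \<rho> \<Longrightarrow> \<bar>K j y - K j z\<bar> < e'"
      unfolding K_def by (rule averaging_kernel_uniformly_continuous[OF d e']) blast
    obtain x' where x': "x' \<in> D" "x' \<in> ball x \<rho>"
      using D(2)[of "ball x \<rho>"] \<rho> by auto
    have close: "\<bar>h j k x - h j k x'\<bar> \<le> e / 3" for k
    proof -
      have "h j k x - h j k x' = (\<integral>y. K j (x - y) * u k y - K j (x' - y) * u k y \<partial>lborel)"
        unfolding h_def using Ku by simp
      also have "\<bar>\<dots>\<bar> \<le> (\<integral>y. \<bar>K j (x - y) * u k y - K j (x' - y) * u k y\<bar> \<partial>lborel)"
        by (rule integral_abs_bound)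
      also have "\<dots> \<le> (\<integral>y. e' * \<bar>u k y\<bar> \<partial>lborel)"
      proof (rule integral_mono)
        fix y
        have "\<bar>K j (x - y) - K j (x' - y)\<bar> \<le> e'"
          using \<rho>(2)[of "x - y" "x' - y"] x' by (simp add: dist_norm less_imp_le)
        then show "\<bar>K j (x - y) * u k y - K j (x' - y) * u k y\<bar> \<le> e' * \<bar>u k y\<bar>"
          unfolding left_diff_distrib[symmetric] abs_mult by (intro mult_right_mono) auto
      qed (use Ku u1 in auto)
      also have "\<dots> \<le> e' * V"
        using u1V e' by (simp add: mult_left_mono)
      also have "\<dots> \<le> e / 3"
        using e V by (simp add: e'_def field_simps)
      finally show ?thesis .
    qed
    obtain l where "(\<lambda>n. h j (r n) x' / S j) \<longlonglongrightarrow> l" using conv[of "(j, x')"] x' by auto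
    then have "(\<lambda>n. S j * (h j (r n) x' / S j)) \<longlonglongrightarrow> S j * l" by (intro tendsto_intros)
    then have "Cauchy (\<lambda>n. h j (r n) x')"
      using S[of j] by (intro LIMSEQ_imp_Cauchy[of _ "S j * l"]) simp
    then obtain M where M: "\<And>m n. m \<ge> M \<Longrightarrow> n \<ge> M \<Longrightarrow> dist (h j (r m) x') (h j (r n) x') < e / 3"
      using e metric_CauchyD[of "\<lambda>n. h j (r n) x'" "e / 3"] by auto
    have "dist (h j (r m) x) (h j (r n) x) < e" if "m \<ge> M" "n \<ge> M" for m n
      using M[OF that] close[of "r m"] close[of "r n"] unfolding dist_real_def by linarith
    then show "\<exists>M. \<forall>m\<ge>M. \<forall>n\<ge>M. dist (h j (r m) x) (h j (r n) x) < e" by blast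
  qed
  define H where "H j x = lim (\<lambda>n. h j (r n) x)" for j x
  have Hlim: "(\<lambda>n. h j (r n) x) \<longlonglongrightarrow> H j x" for j x
    using Cauchy by (simp add: H_def Cauchy_convergent_iff convergent_LIMSEQ_iff)
  have [measurable]: "H j \<in> borel_measurable borel" for j
    by (rule borel_measurable_LIMSEQ_real[OF Hlim]) measurable
  have H_bound: "\<bar>H j x\<bar> \<le> S j * V" for j x
    by (rule LIMSEQ_le_const2[OF tendsto_rabs[OF Hlim]]) (use h_bound in auto)
  have diff_bound: "(h j k x - H j x)\<^sup>2 \<le> (2 * (S j * V))\<^sup>2" for j k x
  proof -
    have "\<bar>h j k x - H j x\<bar> \<le> \<bar>2 * (S j * V)\<bar>"
      using h_bound[of j k x] H_bound[of j x] by linarith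
    then show ?thesis by (rule abs_le_square_iff[THEN iffD1])
  qed
  have dom: "integrable lborel (\<lambda>x. indicator \<Omega> x * (2 * (S j * V))\<^sup>2)" for j
    using fm by (intro integrable_mult_left integrable_real_indicator) auto
  have Iind: "integrable lborel (\<lambda>x. indicator \<Omega> x * (h j k x - H j x)\<^sup>2)" for j k
    by (rule Bochner_Integration.integrable_bound[OF dom[of j]])
      (use diff_bound in \<open>auto simp: indicator_def intro!: AE_I2\<close>)
  have DCT: "(\<lambda>n. \<integral>x. indicator \<Omega> x * (h j (r n) x - H j x)\<^sup>2 \<partial>lborel) \<longlonglongrightarrow> (\<integral>x. 0 \<partial>(lborel :: 'a measure))" for j
  proof (rule integral_dominated_convergence)
    show "integrable lborel (\<lambda>x. indicator \<Omega> x * (2 * (S j * V))\<^sup>2)" by (rule dom)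
    have "(\<lambda>n. indicator \<Omega> x * (h j (r n) x - H j x)\<^sup>2) \<longlonglongrightarrow> indicator \<Omega> x * (H j x - H j x)\<^sup>2" for x
      by (intro tendsto_intros Hlim)
    then show "AE x in lborel. (\<lambda>n. indicator \<Omega> x * (h j (r n) x - H j x)\<^sup>2) \<longlonglongrightarrow> 0" by simp
    show "AE x in lborel. norm (indicator \<Omega> x * (h j (r n) x - H j x)\<^sup>2) \<le> indicator \<Omega> x * (2 * (S j * V))\<^sup>2" for n
      using diff_bound by (auto simp: indicator_def)
  qed auto
  have B0: "B \<ge> 0" using B[of 0] near_energy_nonneg[of "u 0"] by linarith
  show thesis
  proof (rule that[OF r])
    fix e :: real assume e: "e > 0"
    \<comment> \<open>The final estimate is j times the square norm of w at most 2 B + 2.\<close>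
    obtain j where j: "real j > (2 * B + 2) / e" using reals_Archimedean2 by blast
    have j0: "real j > 0" using j e B0 by (meson add_nonneg_pos divide_pos_pos less_trans mult_nonneg_nonneg zero_le_numeral zero_less_numeral)
    interpret even_kernel "K j" by (rule K_even)
    from DCT[of j] have "(\<lambda>n. \<integral>x. indicator \<Omega> x * (h j (r n) x - H j x)\<^sup>2 \<partial>lborel) \<longlonglongrightarrow> 0" by simp
    \<comment> \<open>With 1/4 for each of the two terms, the square norm of g below is at most 1.
      Together with the bound 4 for w this keeps the pairing Q at most 2.\<close>
    from LIMSEQ_D[OF this, of "1/4"] obtain M where
      M: "\<And>n. n \<ge> M \<Longrightarrow> \<bar>\<integral>x. indicator \<Omega> x * (h j (r n) x - H j x)\<^sup>2 \<partial>lborel\<bar> < 1/4" by auto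
    have "(\<integral>x. (u (r m) x - u (r n) x)\<^sup>2 \<partial>lborel) < e" if mn: "m \<ge> M" "n \<ge> M" for m n
    proof -
      define w where "w x = u (r m) x - u (r n) x" for x
      \<comment> \<open>g is the convolution of w cut off to \<Omega>. The cut-off does not change
        the pairing, as w vanishes outside \<Omega>, and it is only on \<Omega> that the
        convolutions converge in L2.\<close>
      define g where "g x = indicator \<Omega> x * (h j (r m) x - h j (r n) x)" for x
      have [measurable]: "w \<in> borel_measurable borel" "g \<in> borel_measurable borel"
        unfolding w_def[abs_def] g_def[abs_def] by measurable
      have w2: "integrable lborel (\<lambda>x. (w x)\<^sup>2)"
        using square_integrable_diff[of "u (r m)" lborel "u (r n)"] u2 by (simp add: w_def)
      have wn: "sq_int w \<le> 4"
      proof -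
        have "sq_int w \<le> (\<integral>x. 2 * (u (r m) x)\<^sup>2 + 2 * (u (r n) x)\<^sup>2 \<partial>lborel)"
          using w2 u2 norm_diff_square_le[of "u (r m) x" "u (r n) x" for x]
          by (intro integral_mono) (auto simp: w_def)
        also have "\<dots> \<le> 4" using u2 norm[of "r m"] norm[of "r n"] by simp
        finally show ?thesis .
      qed
      have gb: "(g x)\<^sup>2 \<le> 2 * (indicator \<Omega> x * (h j (r m) x - H j x)\<^sup>2) + 2 * (indicator \<Omega> x * (h j (r n) x - H j x)\<^sup>2)" for x
        using norm_diff_square_le[of "h j (r m) x - H j x" "h j (r n) x - H j x"] by (auto simp: g_def indicator_def)
      have g2: "integrable lborel (\<lambda>x. (g x)\<^sup>2)"
      proof (rule Bochner_Integration.integrable_bound)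
        show "integrable lborel (\<lambda>x. 2 * (indicator \<Omega> x * (h j (r m) x - H j x)\<^sup>2) + 2 * (indicator \<Omega> x * (h j (r n) x - H j x)\<^sup>2))"
          using Iind by simp
        show "AE x in lborel. norm ((g x)\<^sup>2) \<le> norm (2 * (indicator \<Omega> x * (h j (r m) x - H j x)\<^sup>2) + 2 * (indicator \<Omega> x * (h j (r n) x - H j x)\<^sup>2))"
          using gb by (auto intro!: AE_I2 order_trans[OF gb] simp: abs_of_nonneg)
      qed measurable
      have gn: "sq_int g \<le> 1"
      proof -
        have "sq_int g \<le> (\<integral>x. 2 * (indicator \<Omega> x * (h j (r m) x - H j x)\<^sup>2) + 2 * (indicator \<Omega> x * (h j (r n) x - H j x)\<^sup>2) \<partial>lborel)"
          using g2 Iind gb by (intro integral_mono) auto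
        also have "\<dots> = 2 * (\<integral>x. indicator \<Omega> x * (h j (r m) x - H j x)\<^sup>2 \<partial>lborel) + 2 * (\<integral>x. indicator \<Omega> x * (h j (r n) x - H j x)\<^sup>2 \<partial>lborel)"
          using Iind by simp
        also have "\<dots> \<le> 1" using M[OF mn(1)] M[OF mn(2)] by linarith
        finally show ?thesis .
      qed
      have conv_w: "w x * (\<integral>y. K j (x - y) * w y \<partial>lborel) = w x * g x" for x
      proof -
        have "(\<integral>y. K j (x - y) * w y \<partial>lborel) = h j (r m) x - h j (r n) x"
          using Ku by (simp add: w_def h_def right_diff_distrib)
        then show ?thesis using supp by (auto simp: g_def w_def indicator_def)
      qed
      define Q where "Q = (\<integral>p. (case p of (x, y) \<Rightarrow> K j (x - y) * (w x * w y)) \<partial>lborel\<^sub>2)"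
      have "Q = (\<integral>x. w x * g x \<partial>lborel)"
        unfolding Q_def using w2 by (simp add: kernel_convolution conv_w)
      moreover have "(\<integral>x. w x * g x \<partial>lborel)\<^sup>2 \<le> 2\<^sup>2"
      proof -
        have "(\<integral>x. w x * g x \<partial>lborel)\<^sup>2 \<le> sq_int w * sq_int g"
          by (rule Cauchy_Schwarz_integral) (use w2 g2 in auto)
        also have "\<dots> \<le> 4 * 1" by (intro mult_mono wn gn) auto
        finally show ?thesis by simp
      qed
      ultimately have "Q\<^sup>2 \<le> 2\<^sup>2" by (simp only:)
      then have Q: "Q \<le> 2" by (rule power2_le_imp_le) simp
      have fw: "finite_energy w" and "near_energy w \<le> 4 * B"
      proof -
        show "finite_energy w"
          using near_energy_lincomb(1)[OF u u fin fin, of "r m" "-1" "r n"] by (simp add: w_def[abs_def])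
        show "near_energy w \<le> 4 * B"
          using near_energy_diff_le[OF u u fin fin, of "r m" "r n"] B[of "r m"] B[of "r n"]
          unfolding w_def by linarith
      qed
      moreover have "2 * (\<integral>z. K j z \<partial>lborel) * sq_int w - 2 * Q \<le> near_energy w"
      proof -
        have H: "has_bochner_integral lborel\<^sub>2 (\<lambda>(x, y). K j (x - y) * (w x - w y)\<^sup>2)
          (2 * (\<integral>z. K j z \<partial>lborel) * sq_int w - 2 * Q)"
          unfolding Q_def by (rule kernel_form_diff) (use w2 in auto)
        have le: "K j (x - y) * (w x - w y)\<^sup>2 \<le> near_kernel (x - y) * (w x - w y)\<^sup>2" for x y
        proof (cases "x = y")
          case False
          then show ?thesis unfolding K_def
            by (intro mult_right_mono averaging_kernel_le_near_kernel d) auto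
        qed simp
        have "(\<integral>p. (case p of (x, y) \<Rightarrow> K j (x - y) * (w x - w y)\<^sup>2) \<partial>lborel\<^sub>2) \<le> near_energy w"
          unfolding near_energy_def
        proof (rule integral_mono)
          show "integrable lborel\<^sub>2 (\<lambda>(x, y). K j (x - y) * (w x - w y)\<^sup>2)"
            using H by (simp only: has_bochner_integral_iff)
          show "integrable lborel\<^sub>2 (\<lambda>(x, y). near_kernel (x - y) * (w x - w y)\<^sup>2)"
            using fw by (simp only: finite_energy_def)
          show "(case p of (x, y) \<Rightarrow> K j (x - y) * (w x - w y)\<^sup>2) \<le> (case p of (x, y) \<Rightarrow> near_kernel (x - y) * (w x - w y)\<^sup>2)" for p
            using le by (cases p) simp
        qed
        with H show ?thesis by (simp add: has_bochner_integral_iff)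
      qed
      ultimately have "(\<integral>z. K j z \<partial>lborel) * sq_int w \<le> 2 * B + 2"
        using Q by linarith
      moreover have "real j * sq_int w \<le> (\<integral>z. K j z \<partial>lborel) * sq_int w"
        unfolding K_def by (intro mult_right_mono mass) auto
      ultimately have "real j * sq_int w \<le> 2 * B + 2" by linarith
      also have "\<dots> < real j * e" using j e by (simp add: field_simps)
      finally show ?thesis using j0 by (simp add: w_def)
    qed
    then show "\<exists>K. \<forall>m\<ge>K. \<forall>n\<ge>K. (\<integral>x. (u (r m) x - u (r n) x)\<^sup>2 \<partial>lborel) < e" by blast
  qed
qed

lemma square_integrable_inner:
  fixes f g :: "'a \<Rightarrow> 'b::euclidean_space"
  assumes [measurable]: "f \<in> borel_measurable M" "g \<in> borel_measurable M"
    and f: "integrable M (\<lambda>x. (norm (f x))\<^sup>2)" and g: "integrable M (\<lambda>x. (norm (g x))\<^sup>2)"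
  shows "integrable M (\<lambda>x. f x \<bullet> g x)"
    and "(\<integral>x. f x \<bullet> g x \<partial>M)\<^sup>2 \<le> (\<integral>x. (norm (f x))\<^sup>2 \<partial>M) * (\<integral>x. (norm (g x))\<^sup>2 \<partial>M)"
proof -
  have I: "integrable M (\<lambda>x. norm (f x) * norm (g x))"
    by (rule square_integrable_mult) (use f g in auto)
  show fg: "integrable M (\<lambda>x. f x \<bullet> g x)"
    by (rule Bochner_Integration.integrable_bound[OF I]) (auto intro: Cauchy_Schwarz_ineq2)
  have "\<bar>\<integral>x. f x \<bullet> g x \<partial>M\<bar> \<le> (\<integral>x. \<bar>f x \<bullet> g x\<bar> \<partial>M)" by (rule integral_abs_bound)
  also have "\<dots> \<le> (\<integral>x. norm (f x) * norm (g x) \<partial>M)"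
    using I fg by (intro integral_mono) (auto intro: Cauchy_Schwarz_ineq2)
  finally have "(\<integral>x. f x \<bullet> g x \<partial>M)\<^sup>2 \<le> (\<integral>x. norm (f x) * norm (g x) \<partial>M)\<^sup>2"
    by (subst power2_abs[symmetric]) (intro power_mono; simp)
  also have "\<dots> \<le> (\<integral>x. (norm (f x))\<^sup>2 \<partial>M) * (\<integral>x. (norm (g x))\<^sup>2 \<partial>M)"
    by (rule Cauchy_Schwarz_integral) (use f g in auto)
  finally show "(\<integral>x. f x \<bullet> g x \<partial>M)\<^sup>2 \<le> (\<integral>x. (norm (f x))\<^sup>2 \<partial>M) * (\<integral>x. (norm (g x))\<^sup>2 \<partial>M)" .
qed

section \<open>Passage to the limit in L2 pairings and norms\<close>

context
  fixes f :: "nat \<Rightarrow> 'a \<Rightarrow> 'b::euclidean_space" and g :: "'a \<Rightarrow> 'b" and M :: "'a measure"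
  assumes f[measurable]: "\<And>k. f k \<in> borel_measurable M" and g[measurable]: "g \<in> borel_measurable M"
    and f2: "\<And>k. integrable M (\<lambda>x. (norm (f k x))\<^sup>2)" and g2: "integrable M (\<lambda>x. (norm (g x))\<^sup>2)"
    and lim: "(\<lambda>k. \<integral>x. (norm (f k x - g x))\<^sup>2 \<partial>M) \<longlonglongrightarrow> 0"
begin

lemma L2_limit_inner:
  fixes h :: "'a \<Rightarrow> 'b"
  assumes h[measurable]: "h \<in> borel_measurable M" and h2: "integrable M (\<lambda>x. (norm (h x))\<^sup>2)"
  shows "(\<lambda>k. \<integral>x. f k x \<bullet> h x \<partial>M) \<longlonglongrightarrow> (\<integral>x. g x \<bullet> h x \<partial>M)"
proof -
  have d2: "integrable M (\<lambda>x. (norm (f k x - g x))\<^sup>2)" for k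
    by (rule square_integrable_diff) (use f2 g2 in auto)
  have "(\<lambda>k. (\<integral>x. (f k x - g x) \<bullet> h x \<partial>M)\<^sup>2) \<longlonglongrightarrow> 0"
  proof (rule tendsto_sandwich[of "\<lambda>_. 0"])
    have "(\<lambda>k. (\<integral>x. (norm (f k x - g x))\<^sup>2 \<partial>M) * (\<integral>x. (norm (h x))\<^sup>2 \<partial>M)) \<longlonglongrightarrow> 0 * (\<integral>x. (norm (h x))\<^sup>2 \<partial>M)"
      by (intro tendsto_intros lim)
    then show "(\<lambda>k. (\<integral>x. (norm (f k x - g x))\<^sup>2 \<partial>M) * (\<integral>x. (norm (h x))\<^sup>2 \<partial>M)) \<longlonglongrightarrow> 0" by simp
    show "\<forall>\<^sub>F k in sequentially. (\<integral>x. (f k x - g x) \<bullet> h x \<partial>M)\<^sup>2 \<le> (\<integral>x. (norm (f k x - g x))\<^sup>2 \<partial>M) * (\<integral>x. (norm (h x))\<^sup>2 \<partial>M)"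
      using d2 h2 by (intro always_eventually allI square_integrable_inner) auto
  qed auto
  then have "(\<lambda>k. sqrt ((\<integral>x. (f k x - g x) \<bullet> h x \<partial>M)\<^sup>2)) \<longlonglongrightarrow> sqrt 0" by (intro tendsto_intros)
  then have "(\<lambda>k. \<integral>x. (f k x - g x) \<bullet> h x \<partial>M) \<longlonglongrightarrow> 0"
    by (simp add: tendsto_rabs_zero_iff)
  moreover have "(\<integral>x. (f k x - g x) \<bullet> h x \<partial>M) = (\<integral>x. f k x \<bullet> h x \<partial>M) - (\<integral>x. g x \<bullet> h x \<partial>M)" for k
    using square_integrable_inner(1)[OF f h f2 h2] square_integrable_inner(1)[OF g h g2 h2]
    by (simp add: inner_diff_left)
  ultimately have "(\<lambda>k. (\<integral>x. f k x \<bullet> h x \<partial>M) - (\<integral>x. g x \<bullet> h x \<partial>M)) \<longlonglongrightarrow> 0" by simp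
  then show ?thesis by (simp add: LIM_zero_iff)
qed

lemma L2_limit_norm: "(\<lambda>k. \<integral>x. (norm (f k x))\<^sup>2 \<partial>M) \<longlonglongrightarrow> (\<integral>x. (norm (g x))\<^sup>2 \<partial>M)"
proof -
  have d2: "integrable M (\<lambda>x. (norm (f k x - g x))\<^sup>2)" for k
    by (rule square_integrable_diff) (use f2 g2 in auto)
  have eq: "(\<integral>x. (norm (f k x))\<^sup>2 \<partial>M) =
      (\<integral>x. (norm (f k x - g x))\<^sup>2 \<partial>M) + 2 * (\<integral>x. f k x \<bullet> g x \<partial>M) - (\<integral>x. (norm (g x))\<^sup>2 \<partial>M)" for k
  proof -
    have "(\<integral>x. (norm (f k x))\<^sup>2 \<partial>M) = (\<integral>x. (norm (f k x - g x))\<^sup>2 + 2 * (f k x \<bullet> g x) - (norm (g x))\<^sup>2 \<partial>M)"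
      by (intro Bochner_Integration.integral_cong refl) (simp add: power2_norm_eq_inner inner_diff inner_commute)
    also have "\<dots> = (\<integral>x. (norm (f k x - g x))\<^sup>2 \<partial>M) + 2 * (\<integral>x. f k x \<bullet> g x \<partial>M) - (\<integral>x. (norm (g x))\<^sup>2 \<partial>M)"
      using d2 g2 square_integrable_inner(1)[OF f g f2 g2] by simp
    finally show ?thesis .
  qed
  have "(\<lambda>k. (\<integral>x. (norm (f k x - g x))\<^sup>2 \<partial>M) + 2 * (\<integral>x. f k x \<bullet> g x \<partial>M) - (\<integral>x. (norm (g x))\<^sup>2 \<partial>M)) \<longlonglongrightarrow>
    0 + 2 * (\<integral>x. g x \<bullet> g x \<partial>M) - (\<integral>x. (norm (g x))\<^sup>2 \<partial>M)"
    by (intro tendsto_diff tendsto_add tendsto_mult tendsto_const lim L2_limit_inner[OF g g2])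
  then show ?thesis unfolding eq[symmetric] by (simp add: power2_norm_eq_inner)
qed

end

lemma minimizing_sequence:
  fixes F :: "'a \<Rightarrow> real"
  assumes "S \<noteq> {}"
  obtains f where "\<And>k. f k \<in> S" "\<And>k. F (f k) < Inf (F ` S) + 1 / real (Suc k)"
proof -
  have "\<exists>x. x \<in> S \<and> F x < Inf (F ` S) + 1 / real (Suc k)" for k
  proof -
    have "Inf (F ` S) < Inf (F ` S) + 1 / real (Suc k)" by simp
    from cInf_lessD[OF _ this] assms show ?thesis by blast
  qed
  then have "\<forall>k. \<exists>x. x \<in> S \<and> F x < Inf (F ` S) + 1 / real (Suc k)" by (rule allI)
  then obtain f where f: "\<forall>k. f k \<in> S \<and> F (f k) < Inf (F ` S) + 1 / real (Suc k)"
    by (rule choice[THEN exE])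
  show thesis
    by (rule that[of f]) (use f in blast)+
qed

text \<open>The first-order condition at a minimum, used for both Euler-Lagrange equations. At t =
  -b / (|a| + 1) the quadratic term is at most half the size of the linear one, which is negative
  unless b = 0.\<close>

lemma linear_term_zero:
  fixes a b :: real
  assumes "\<And>t. 0 \<le> 2 * t * b + t\<^sup>2 * a"
  shows "b = 0"
proof (rule ccontr)
  assume b: "b \<noteq> 0"
  define t where "t = - b / (\<bar>a\<bar> + 1)"
  have p: "\<bar>a\<bar> + 1 > 0" by (simp add: add_nonneg_pos)
  have tb: "t * b = - (b\<^sup>2 / (\<bar>a\<bar> + 1))" by (simp add: t_def power2_eq_square)
  have "t\<^sup>2 * a \<le> t\<^sup>2 * (\<bar>a\<bar> + 1)" by (intro mult_left_mono) auto
  also have "\<dots> = b\<^sup>2 / (\<bar>a\<bar> + 1)"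
    using p by (simp add: t_def power2_eq_square)
  finally have "2 * t * b + t\<^sup>2 * a \<le> - (b\<^sup>2 / (\<bar>a\<bar> + 1))" using tb by simp
  moreover have "b\<^sup>2 / (\<bar>a\<bar> + 1) > 0" using b p by simp
  ultimately show False using assms[of t] by linarith
qed

text \<open>By translation invariance a difference quotient can be moved from u to w at the price of
  reversing the shift. Both sides converge by dominated convergence, the derivatives being bounded
  on the compact supports.\<close>

lemma integration_by_parts:
  fixes u w :: "'a::euclidean_space \<Rightarrow> real"
  assumes "C1_function u G" "C1_function w H"
    and S: "compact S" "\<And>x. x \<notin> S \<Longrightarrow> u x = 0" "\<And>x. x \<notin> S \<Longrightarrow> G x = 0"
    and T: "compact T" "\<And>x. x \<notin> T \<Longrightarrow> w x = 0" "\<And>x. x \<notin> T \<Longrightarrow> H x = 0"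
  shows "(\<integral>x. u x * (H x \<bullet> e) \<partial>lborel) = - (\<integral>x. w x * (G x \<bullet> e) \<partial>lborel)"
proof -
  \<comment> \<open>The factor c covers both directions of the shift: c = 1 for the quotient of u
    and c = -1 for that of w.\<close>
  have quotient: "(\<lambda>n. \<integral>x. (u (x + (c / real (Suc n)) *\<^sub>R e) - u x) * real (Suc n) * w x \<partial>lborel) \<longlonglongrightarrow> (\<integral>x. c * (G x \<bullet> e) * w x \<partial>lborel)"
    if u: "C1_function u G" and S: "compact S" "\<And>x. x \<notin> S \<Longrightarrow> G x = 0"
      and w: "continuous_on UNIV w" "compact T" "\<And>x. x \<notin> T \<Longrightarrow> w x = 0"
    for u w :: "'a \<Rightarrow> real" and G S T and c :: real
  proof -
    interpret C1_function u G by fact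
    have [measurable]: "w \<in> borel_measurable borel" using w(1) by (rule borel_measurable_continuous_onI)
    have "bounded (G ` S)"
      using S(1) by (intro compact_imp_bounded compact_continuous_image continuous_on_subset[OF continuous_grad]) auto
    then obtain L where L: "\<And>x. x \<in> S \<Longrightarrow> norm (G x) \<le> L" "L > 0"
      unfolding bounded_pos by auto
    have GL: "norm (G x) \<le> L" for x using L S(2)[of x] by (cases "x \<in> S") auto
    have Lip: "norm (u (x + z) - u x) \<le> L * norm z" for x z
    proof -
      have "onorm (\<lambda>h. G y \<bullet> h) \<le> L" for y
        by (rule onorm_le, rule order_trans[OF _ mult_right_mono[OF GL[of y]]]) (auto simp: Cauchy_Schwarz_ineq2)
      then show ?thesis
        using differentiable_bound[of UNIV u "\<lambda>x h. G x \<bullet> h" L "x + z" x] deriv by auto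
    qed
    show ?thesis
    proof (rule integral_dominated_convergence)
      have "integrable lborel (\<lambda>x. norm (w x))"
        by (intro integrable_norm integrable_continuous_compact_support[OF w])
      then show "integrable lborel (\<lambda>x. L * \<bar>c\<bar> * norm e * norm (w x))" by simp
      show "AE x in lborel. (\<lambda>n. (u (x + (c / real (Suc n)) *\<^sub>R e) - u x) * real (Suc n) * w x) \<longlonglongrightarrow> c * (G x \<bullet> e) * w x"
      proof (rule AE_I2)
        fix x
        have "((\<lambda>t. u (x + t *\<^sub>R (c *\<^sub>R e))) has_derivative (\<lambda>d. G (x + 0 *\<^sub>R (c *\<^sub>R e)) \<bullet> (d *\<^sub>R (c *\<^sub>R e)))) (at 0)"
          by (rule has_derivative_compose[of "\<lambda>t. x + t *\<^sub>R (c *\<^sub>R e)" "\<lambda>d. d *\<^sub>R (c *\<^sub>R e)" 0 _ u, OF _ deriv])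
            (auto intro!: derivative_eq_intros)
        then have "((\<lambda>t. u (x + t *\<^sub>R (c *\<^sub>R e))) has_real_derivative c * (G x \<bullet> e)) (at 0)"
          unfolding has_field_derivative_def by (rule has_derivative_eq_rhs) (simp add: fun_eq_iff)
        then have "((\<lambda>t. (u (x + t *\<^sub>R (c *\<^sub>R e)) - u x) / t) \<longlongrightarrow> c * (G x \<bullet> e)) (at 0)"
          by (simp add: has_field_derivative_iff)
        moreover have "filterlim (\<lambda>n. 1 / real (Suc n)) (at 0) sequentially"
          unfolding filterlim_at using LIMSEQ_Suc[OF lim_1_over_n[where 'a=real]] by simp
        ultimately have "(\<lambda>n. (u (x + (1 / real (Suc n)) *\<^sub>R (c *\<^sub>R e)) - u x) / (1 / real (Suc n))) \<longlonglongrightarrow> c * (G x \<bullet> e)"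
          by (rule filterlim_compose)
        then have "(\<lambda>n. (u (x + (1 / real (Suc n)) *\<^sub>R (c *\<^sub>R e)) - u x) / (1 / real (Suc n)) * w x) \<longlonglongrightarrow> c * (G x \<bullet> e) * w x"
          by (intro tendsto_intros)
        then show "(\<lambda>n. (u (x + (c / real (Suc n)) *\<^sub>R e) - u x) * real (Suc n) * w x) \<longlonglongrightarrow> c * (G x \<bullet> e) * w x"
          by simp
      qed
      show "AE x in lborel. norm ((u (x + (c / real (Suc n)) *\<^sub>R e) - u x) * real (Suc n) * w x) \<le> L * \<bar>c\<bar> * norm e * norm (w x)" for n
      proof (rule AE_I2)
        fix x
        have "norm (u (x + (c / real (Suc n)) *\<^sub>R e) - u x) * real (Suc n) \<le> L * norm ((c / real (Suc n)) *\<^sub>R e) * real (Suc n)"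
          by (intro mult_right_mono Lip) auto
        also have "\<dots> = L * \<bar>c\<bar> * norm e" by simp
        finally have "norm (u (x + (c / real (Suc n)) *\<^sub>R e) - u x) * real (Suc n) * norm (w x) \<le> L * \<bar>c\<bar> * norm e * norm (w x)"
          by (intro mult_right_mono) auto
        then show "norm ((u (x + (c / real (Suc n)) *\<^sub>R e) - u x) * real (Suc n) * w x) \<le> L * \<bar>c\<bar> * norm e * norm (w x)"
          by (simp add: abs_mult)
      qed
    qed measurable
  qed
  interpret u: C1_function u G by fact
  interpret w: C1_function w H by fact
  have A: "(\<lambda>n. \<integral>x. (u (x + (1 / real (Suc n)) *\<^sub>R e) - u x) * real (Suc n) * w x \<partial>lborel) \<longlonglongrightarrow> (\<integral>x. 1 * (G x \<bullet> e) * w x \<partial>lborel)"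
    by (rule quotient[OF assms(1) S(1,3) w.continuous T(1,2)])
  have B: "(\<lambda>n. \<integral>x. (w (x + (- 1 / real (Suc n)) *\<^sub>R e) - w x) * real (Suc n) * u x \<partial>lborel) \<longlonglongrightarrow> (\<integral>x. - 1 * (H x \<bullet> e) * u x \<partial>lborel)"
    by (rule quotient[OF assms(2) T(1,3) u.continuous S(1,2)])
  have eq: "(\<integral>x. (u (x + (1 / real (Suc n)) *\<^sub>R e) - u x) * real (Suc n) * w x \<partial>lborel) =
      (\<integral>x. (w (x + (- 1 / real (Suc n)) *\<^sub>R e) - w x) * real (Suc n) * u x \<partial>lborel)" for n
  proof -
    define z where "z = (1 / real (Suc n)) *\<^sub>R e"
    have c: "continuous_on UNIV (\<lambda>x. u (x + z))" "continuous_on UNIV (\<lambda>x. w (x - z))"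
      by (intro continuous_intros continuous_on_compose2[OF u.continuous] continuous_on_compose2[OF w.continuous]; simp)+
    have I1: "integrable lborel (\<lambda>x. u (x + z) * w x)"
      by (rule integrable_continuous_compact_support[OF _ T(1)])
        (auto simp: T intro!: continuous_intros c w.continuous)
    have I2: "integrable lborel (\<lambda>x. u x * w x)"
      by (rule integrable_continuous_compact_support[OF _ T(1)])
        (auto simp: T intro!: continuous_intros u.continuous w.continuous)
    have I3: "integrable lborel (\<lambda>x. w (x - z) * u x)"
      by (rule integrable_continuous_compact_support[OF _ S(1)])
        (auto simp: S intro!: continuous_intros c u.continuous)
    have "has_bochner_integral lborel (\<lambda>x. w (x + z - z) * u (x + z)) (\<integral>x. w (x - z) * u x \<partial>lborel)"
      by (rule has_bochner_integral_lborel_translate[where f="\<lambda>x. w (x - z) * u x"])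
        (simp add: has_bochner_integral_iff I3)
    then have "(\<integral>x. u (x + z) * w x \<partial>lborel) = (\<integral>x. w (x - z) * u x \<partial>lborel)"
      by (simp add: has_bochner_integral_iff mult.commute)
    moreover have "(\<integral>x. (u (x + z) - u x) * real (Suc n) * w x \<partial>lborel) = real (Suc n) * ((\<integral>x. u (x + z) * w x \<partial>lborel) - (\<integral>x. u x * w x \<partial>lborel))"
    proof -
      have "(\<integral>x. (u (x + z) - u x) * real (Suc n) * w x \<partial>lborel) = (\<integral>x. real (Suc n) * (u (x + z) * w x - u x * w x) \<partial>lborel)"
        by (intro Bochner_Integration.integral_cong refl) (simp only: left_diff_distrib right_diff_distrib mult_ac)
      also have "\<dots> = real (Suc n) * ((\<integral>x. u (x + z) * w x \<partial>lborel) - (\<integral>x. u x * w x \<partial>lborel))"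
        by (subst integral_mult_right_zero, subst Bochner_Integration.integral_diff[OF I1 I2]) simp
      finally show ?thesis .
    qed
    moreover have "(\<integral>x. (w (x - z) - w x) * real (Suc n) * u x \<partial>lborel) = real (Suc n) * ((\<integral>x. w (x - z) * u x \<partial>lborel) - (\<integral>x. u x * w x \<partial>lborel))"
    proof -
      have "(\<integral>x. (w (x - z) - w x) * real (Suc n) * u x \<partial>lborel) = (\<integral>x. real (Suc n) * (w (x - z) * u x - u x * w x) \<partial>lborel)"
        by (intro Bochner_Integration.integral_cong refl) (simp only: left_diff_distrib right_diff_distrib mult_ac)
      also have "\<dots> = real (Suc n) * ((\<integral>x. w (x - z) * u x \<partial>lborel) - (\<integral>x. u x * w x \<partial>lborel))"
        by (subst integral_mult_right_zero, subst Bochner_Integration.integral_diff[OF I3 I2]) simp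
      finally show ?thesis .
    qed
    ultimately show ?thesis by (simp add: z_def)
  qed
  have "(\<integral>x. 1 * (G x \<bullet> e) * w x \<partial>lborel) = (\<integral>x. - 1 * (H x \<bullet> e) * u x \<partial>lborel)"
    by (rule LIMSEQ_unique[OF A]) (unfold eq, rule B)
  then show ?thesis by (simp add: mult.commute)
qed

subsection \<open>The Rayleigh quotients\<close>

lemma c_const_pos: "n > 0 \<Longrightarrow> c_const n > 0"
  by (simp add: c_const_def Gamma_real_pos)

definition log_energy :: "('a::euclidean_space \<Rightarrow> real) \<Rightarrow> real" where
  "log_energy u = c_const DIM('a) / 2 * near_energy u - c_const DIM('a) * far_form u u
    + rho_const DIM('a) * sq_int u"

locale bounded_open_set =
  fixes \<Omega> :: "(real ^ 'n) set"
  assumes open_\<Omega>: "open \<Omega>" and bounded_\<Omega>: "bounded \<Omega>" and nonempty: "\<Omega> \<noteq> {}"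
begin

lemma c_pos: "c_const CARD('n) > 0"
  by (rule c_const_pos) simp

lemma \<Omega>_borel [measurable]: "\<Omega> \<in> sets borel"
  using open_\<Omega> by simp

lemma emeasure_\<Omega>: "emeasure lborel \<Omega> < \<infinity>"
  using emeasure_bounded_finite[OF bounded_\<Omega>] by simp

text \<open>The Borel version of \<open>H_space\<close>. Square integrability is recorded
  explicitly; for normalized members of \<open>H_space\<close> it comes from the normalization
  itself.\<close>

definition energy_space :: "(real ^ 'n \<Rightarrow> real) set" where
  "energy_space = {u. u \<in> borel_measurable borel \<and> (\<forall>x. x \<notin> \<Omega> \<longrightarrow> u x = 0) \<and> finite_energy u \<and>
     integrable lborel (\<lambda>x. (u x)\<^sup>2)}"

lemma energy_spaceD:
  assumes "u \<in> energy_space"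
  shows "u \<in> borel_measurable borel" "\<And>x. x \<notin> \<Omega> \<Longrightarrow> u x = 0" "finite_energy u" "integrable lborel (\<lambda>x. (u x)\<^sup>2)"
  using assms by (auto simp: energy_space_def)

lemma energy_space_L1:
  assumes "u \<in> energy_space"
  shows "integrable lborel u" "(\<integral>x. \<bar>u x\<bar> \<partial>lborel)\<^sup>2 \<le> measure lborel \<Omega> * sq_int u"
proof -
  note u = energy_spaceD[OF assms]
  show "integrable lborel u"
    by (rule square_integrable_imp_integrable(1)[of _ _ \<Omega>]) (use u emeasure_\<Omega> in auto)
  have "(\<integral>x. norm (u x) \<partial>lborel)\<^sup>2 \<le> measure lborel \<Omega> * sq_norm u"
    by (rule square_integrable_imp_integrable(2)) (use u emeasure_\<Omega> in auto)
  then show "(\<integral>x. \<bar>u x\<bar> \<partial>lborel)\<^sup>2 \<le> measure lborel \<Omega> * sq_int u" by simp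
qed

lemma abs_far_form_self_le:
  assumes "u \<in> energy_space"
  shows "\<bar>far_form u u\<bar> \<le> measure lborel \<Omega> * sq_int u"
  using abs_far_form_le[OF energy_space_L1(1) energy_space_L1(1), OF assms assms] energy_space_L1(2)[OF assms]
  by (simp add: power2_eq_square)

lemma E_L_self_AE:
  assumes "u' \<in> borel_measurable borel" "AE x in lborel. u x = u' x"
  shows "E_L u u = log_energy u'"
  using E_L_eq_AE[OF assms(1,1,2,2)] by (simp add: log_energy_def near_form_self power2_eq_square)

lemma L2_norm_AE:
  fixes f :: "real ^ 'n \<Rightarrow> 'b::euclidean_space"
  assumes "f' \<in> borel_measurable borel" "\<And>x. x \<notin> \<Omega> \<Longrightarrow> f' x = 0" "AE x in lborel. x \<in> \<Omega> \<longrightarrow> f x = f' x"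
  shows "L2_norm \<Omega> f = sqrt (sq_norm f')"
proof -
  have "AE x in lborel. indicator \<Omega> x *\<^sub>R (norm (f x))\<^sup>2 = (norm (f' x))\<^sup>2"
    using assms(3) by eventually_elim (use assms(2) in \<open>auto simp: indicator_def\<close>)
  then show ?thesis
    unfolding L2_norm_def set_lebesgue_integral_def
    using assms(1) by (subst lebesgue_eq_borel_AE(3)) auto
qed

lemma first_log_eigenvalue_eq:
  "first_log_eigenvalue \<Omega> = Inf (log_energy ` {u \<in> energy_space. sq_int u = 1})"
proof -
  have "{E_L u u |u. u \<in> H_space \<Omega> \<and> L2_norm \<Omega> u = 1} = log_energy ` {u \<in> energy_space. sq_int u = 1}" (is "?L = ?R")
  proof (rule set_eqI, rule iffI)
    fix t assume "t \<in> ?L"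
    then obtain u where u: "t = E_L u u" "u \<in> H_space \<Omega>" "L2_norm \<Omega> u = 1" by auto
    obtain u' where u': "u' \<in> borel_measurable borel" "\<And>x. x \<notin> \<Omega> \<Longrightarrow> u' x = 0" "finite_energy u'"
      "AE x in lborel. u x = u' x"
      by (rule H_space_borel_representative[OF u(2) open_\<Omega>], rule that)
    have "L2_norm \<Omega> u = sqrt (sq_norm u')"
      using u'(4) by (intro L2_norm_AE u') (auto elim: eventually_mono)
    with u have 1: "sq_int u' = 1" by (simp add: real_sqrt_eq_1_iff)
    \<comment> \<open>An integral that does not exist would be 0, so the value 1 certifies
      integrability.\<close>
    then have "integrable lborel (\<lambda>x. (u' x)\<^sup>2)"
      using not_integrable_integral_eq by fastforce
    then have "u' \<in> energy_space" using u' by (simp add: energy_space_def)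
    moreover have "t = log_energy u'" unfolding u(1) by (rule E_L_self_AE[OF u'(1,4)])
    ultimately show "t \<in> ?R" using 1 by auto
  next
    fix t assume "t \<in> ?R"
    then obtain u where u: "t = log_energy u" "u \<in> energy_space" "sq_int u = 1" by auto
    note ud = energy_spaceD[OF u(2)]
    have "u \<in> H_space \<Omega>" using ud by (simp add: H_space_borel_iff)
    moreover have "L2_norm \<Omega> u = 1"
      using L2_norm_AE[OF ud(1,2), of u] u(3) by simp
    moreover have "t = E_L u u" unfolding u(1) by (rule E_L_self_AE[symmetric]) (auto intro: ud)
    ultimately show "t \<in> ?L" by blast
  qed
  then show ?thesis by (simp add: first_log_eigenvalue_def)
qed

text \<open>Coercivity: the far form is bounded by the volume of \<Omega> times the square norm. The
  energy is therefore bounded below on the unit sphere, and a bound on the energy bounds its near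
  part.\<close>

lemma log_energy_bounds:
  assumes "u \<in> energy_space"
  shows "(rho_const CARD('n) - c_const CARD('n) * measure lborel \<Omega>) * sq_int u + c_const CARD('n) / 2 * near_energy u \<le> log_energy u"
proof -
  have "c_const CARD('n) * far_form u u \<le> c_const CARD('n) * (measure lborel \<Omega> * sq_int u)"
    using abs_far_form_self_le[OF assms] c_pos by (intro mult_left_mono) auto
  then show ?thesis by (simp add: log_energy_def algebra_simps)
qed

lemma bdd_below_log_energy: "bdd_below (log_energy ` {u \<in> energy_space. sq_int u = 1})"
proof (rule bdd_belowI2)
  fix u assume "u \<in> {u \<in> energy_space. sq_int u = 1}"
  then have u: "u \<in> energy_space" "sq_int u = 1" by auto
  have "0 \<le> c_const CARD('n) / 2 * near_energy u"
    using c_pos near_energy_nonneg[of u] by (intro mult_nonneg_nonneg) auto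
  then show "rho_const CARD('n) - c_const CARD('n) * measure lborel \<Omega> \<le> log_energy u"
    using log_energy_bounds[OF u(1)] u(2) by simp
qed

lemma energy_space_scale:
  assumes "u \<in> energy_space"
  shows "(\<lambda>x. t * u x) \<in> energy_space" "log_energy (\<lambda>x. t * u x) = t\<^sup>2 * log_energy u"
proof -
  note u = energy_spaceD[OF assms]
  have sq: "(\<lambda>(x, y). near_kernel (x - y) * (t * u x - t * u y)\<^sup>2) = (\<lambda>p. t\<^sup>2 * (case p of (x, y) \<Rightarrow> near_kernel (x - y) * (u x - u y)\<^sup>2))"
    by (auto simp: fun_eq_iff power2_eq_square algebra_simps)
  show "(\<lambda>x. t * u x) \<in> energy_space"
    using u by (auto simp: energy_space_def finite_energy_def sq power_mult_distrib)
  have "near_energy (\<lambda>x. t * u x) = t\<^sup>2 * near_energy u"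
    unfolding near_energy_def sq by simp
  moreover have "far_form (\<lambda>x. t * u x) (\<lambda>x. t * u x) = t\<^sup>2 * far_form u u"
  proof -
    have "(\<lambda>(x, y). far_kernel (x - y) * (t * u x * (t * u y))) = (\<lambda>p. t\<^sup>2 * (case p of (x, y) \<Rightarrow> far_kernel (x - y) * (u x * u y)))"
      by (auto simp: fun_eq_iff power2_eq_square algebra_simps)
    then show ?thesis unfolding far_form_def by simp
  qed
  ultimately show "log_energy (\<lambda>x. t * u x) = t\<^sup>2 * log_energy u"
    by (simp add: log_energy_def power_mult_distrib algebra_simps)
qed

lemma log_energy_ge:
  assumes u: "u \<in> energy_space"
  shows "first_log_eigenvalue \<Omega> * sq_int u \<le> log_energy u"
proof (cases "sq_int u = 0")
  case True
  have "0 \<le> c_const CARD('n) / 2 * near_energy u"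
    using c_pos near_energy_nonneg[of u] by (intro mult_nonneg_nonneg) auto
  with True show ?thesis using log_energy_bounds[OF u] by simp
next
  case False
  define a where "a = sq_int u"
  have "a \<ge> 0" by (simp add: a_def)
  with False have a: "a > 0" unfolding a_def by linarith
  define t where "t = 1 / sqrt a"
  have t2: "t\<^sup>2 = 1 / a" using a by (simp add: t_def power_divide)
  have "(\<integral>x. (t * u x)\<^sup>2 \<partial>lborel) = 1"
    using a by (simp add: power_mult_distrib t2 a_def[symmetric])
  then have "log_energy (\<lambda>x. t * u x) \<in> log_energy ` {u \<in> energy_space. sq_int u = 1}"
    using energy_space_scale(1)[OF u] by auto
  then have "first_log_eigenvalue \<Omega> \<le> log_energy (\<lambda>x. t * u x)"
    unfolding first_log_eigenvalue_eq by (rule cInf_lower[OF _ bdd_below_log_energy])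
  also have "\<dots> = log_energy u / a" by (simp add: energy_space_scale(2)[OF u] t2)
  finally show ?thesis using a by (simp add: a_def[symmetric] field_simps)
qed

lemma Cc_energy_space:
  assumes "\<phi> \<in> Cc_infinity \<Omega>"
  shows "\<phi> \<in> energy_space"
proof -
  interpret C1_function \<phi> "grad \<phi>" using assms by (rule Cc_infinity_C1_function)
  obtain S where S: "compact S" "S \<subseteq> \<Omega>" "\<And>x. x \<notin> S \<Longrightarrow> \<phi> x = 0" "\<And>x. x \<notin> S \<Longrightarrow> grad \<phi> x = 0"
    by (rule Cc_infinity_support[OF assms], rule that)
  note I = Cc_infinity_integrable[OF assms]
  have "finite_energy \<phi>"
    using near_energy_bound(1)[OF I] by (simp only: finite_energy_def)
  moreover have "\<phi> x = 0" if "x \<notin> \<Omega>" for x using S(2) S(3)[of x] that by blast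
  ultimately show ?thesis using I by (simp add: energy_space_def)
qed

lemma grad_scale:
  assumes "\<phi> \<in> Cc_infinity \<Omega>"
  shows "(\<lambda>x. t * \<phi> x) \<in> Cc_infinity \<Omega>" "grad (\<lambda>x. t * \<phi> x) = (\<lambda>x. t *\<^sub>R grad \<phi> x)"
proof -
  interpret C1_function \<phi> "grad \<phi>" using assms by (rule Cc_infinity_C1_function)
  have d: "\<phi> differentiable (at x)" for x using deriv by (auto simp: differentiable_def)
  show "(\<lambda>x. t * \<phi> x) \<in> Cc_infinity \<Omega>" using Cc_infinity_lincomb[OF assms assms, of t 0] by simp
  show "grad (\<lambda>x. t * \<phi> x) = (\<lambda>x. t *\<^sub>R grad \<phi> x)"
    using grad_lincomb[OF d d, of t 0] by (simp add: fun_eq_iff)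
qed

lemma normalize_Cc:
  assumes \<phi>: "\<phi> \<in> Cc_infinity \<Omega>" and a: "sq_int \<phi> = a" "a > 0"
  shows "(\<lambda>x. (1 / sqrt a) * \<phi> x) \<in> {\<phi> \<in> Cc_infinity \<Omega>. sq_int \<phi> = 1}"
    "(\<integral>x. (norm (grad (\<lambda>x. (1 / sqrt a) * \<phi> x) x))\<^sup>2 \<partial>lborel) = sq_norm (grad \<phi>) / a"
  using grad_scale[OF \<phi>, of "1 / sqrt a"] a by (simp_all add: power_mult_distrib power_divide)

text \<open>The logarithmic bound for normalized test functions, exponentiated. In this homogeneous
  form it passes to limits and makes sense without positivity of the Dirichlet integral.\<close>

lemma first_log_eigenvalue_le_Rayleigh:
  assumes \<phi>: "\<phi> \<in> Cc_infinity \<Omega>"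
  shows "exp (first_log_eigenvalue \<Omega>) * sq_int \<phi> \<le> sq_norm (grad \<phi>)"
proof (cases "sq_int \<phi> = 0")
  case False
  define a where "a = sq_int \<phi>"
  have "a \<ge> 0" by (simp add: a_def)
  with False have a: "a > 0" unfolding a_def by linarith
  define \<psi> where "\<psi> = (\<lambda>x. (1 / sqrt a) * \<phi> x)"
  have \<psi>: "\<psi> \<in> Cc_infinity \<Omega>" and n: "sq_int \<psi> = 1"
    using normalize_Cc(1)[OF \<phi> a_def[symmetric] a] by (simp_all only: \<psi>_def mem_Collect_eq)
  have G: "sq_norm (grad \<psi>) = sq_norm (grad \<phi>) / a" (is "?G = ?H / a")
    unfolding \<psi>_def by (rule normalize_Cc(2)[OF \<phi> a_def[symmetric] a])
  interpret C1_function \<psi> "grad \<psi>" using \<psi> by (rule Cc_infinity_C1_function)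
  \<comment> \<open>\<open>nonlocal_energy_le_log\<close> asks for a positive bound, and the
    Dirichlet integral is only known to be nonnegative here, hence the added e.\<close>
  have "exp (first_log_eigenvalue \<Omega>) \<le> ?G + e" if e: "e > 0" for e
  proof -
    have p: "?G + e > 0" using e by (intro add_nonneg_pos) auto
    have "log_energy \<psi> \<le> ln (?G + e)"
      using nonlocal_energy_le_log[OF Cc_infinity_integrable[OF \<psi>] n p] e by (simp add: log_energy_def n)
    moreover have "first_log_eigenvalue \<Omega> \<le> log_energy \<psi>"
      using log_energy_ge[OF Cc_energy_space[OF \<psi>]] n by simp
    ultimately have "exp (first_log_eigenvalue \<Omega>) \<le> exp (ln (?G + e))" by simp
    with p show ?thesis by simp
  qed
  then have "exp (first_log_eigenvalue \<Omega>) \<le> ?G" by (rule field_le_epsilon)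
  then show ?thesis unfolding G using a by (simp add: a_def[symmetric] field_simps)
qed simp

section \<open>Borel representatives on \<Omega> and comparison with weak eigenvalues\<close>

lemma set_integral_AE:
  fixes f :: "real ^ 'n \<Rightarrow> 'b::euclidean_space"
  assumes "f' \<in> borel_measurable borel" "\<And>x. x \<notin> \<Omega> \<Longrightarrow> f' x = 0" "AE x in lborel. x \<in> \<Omega> \<longrightarrow> f x = f' x"
  shows "set_lebesgue_integral lebesgue \<Omega> f = (\<integral>x. f' x \<partial>lborel)"
    and "set_integrable lebesgue \<Omega> f \<longleftrightarrow> integrable lborel f'"
    and "set_borel_measurable lebesgue \<Omega> f"
proof -
  have *: "AE x in lborel. indicator \<Omega> x *\<^sub>R f x = f' x"
    using assms(3) by eventually_elim (use assms(2) in \<open>auto simp: indicator_def\<close>)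
  show "set_lebesgue_integral lebesgue \<Omega> f = (\<integral>x. f' x \<partial>lborel)"
    unfolding set_lebesgue_integral_def by (rule lebesgue_eq_borel_AE(3)[OF assms(1) *])
  show "set_integrable lebesgue \<Omega> f \<longleftrightarrow> integrable lborel f'"
    unfolding set_integrable_def by (rule lebesgue_eq_borel_AE(2)[OF assms(1) *])
  show "set_borel_measurable lebesgue \<Omega> f"
    unfolding set_borel_measurable_def by (rule lebesgue_eq_borel_AE(1)[OF assms(1) *])
qed

lemma Cc_outside:
  assumes "\<phi> \<in> Cc_infinity \<Omega>" "x \<notin> \<Omega>"
  shows "\<phi> x = 0" "grad \<phi> x = 0"
proof -
  obtain S where S: "compact S" "S \<subseteq> \<Omega>" "\<And>x. x \<notin> S \<Longrightarrow> \<phi> x = 0" "\<And>x. x \<notin> S \<Longrightarrow> grad \<phi> x = 0"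
    by (rule Cc_infinity_support[OF assms(1)], rule that)
  have "x \<notin> S" using S(2) assms(2) by (rule contra_subsetD)
  then show "\<phi> x = 0" "grad \<phi> x = 0" by (rule S(3), rule S(4))
qed

lemma Cc_measurable:
  assumes "\<phi> \<in> Cc_infinity \<Omega>"
  shows "\<phi> \<in> borel_measurable borel" "grad \<phi> \<in> borel_measurable borel"
proof -
  interpret C1_function \<phi> "grad \<phi>" using assms by (rule Cc_infinity_C1_function)
  show "\<phi> \<in> borel_measurable borel" "grad \<phi> \<in> borel_measurable borel" by measurable
qed

lemma L2_representative:
  fixes f :: "real ^ 'n \<Rightarrow> real"
  assumes "f \<in> L2 \<Omega>"
  obtains f' where "f' \<in> borel_measurable borel" "\<And>x. x \<notin> \<Omega> \<Longrightarrow> f' x = 0" "AE x in lborel. x \<in> \<Omega> \<longrightarrow> f x = f' x"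
    "integrable lborel (\<lambda>x. (f' x)\<^sup>2)"
proof -
  have "(\<lambda>x. indicator \<Omega> x *\<^sub>R f x) \<in> borel_measurable lebesgue"
    using assms by (simp add: L2_def set_borel_measurable_def)
  then obtain v where v: "v \<in> borel_measurable lborel" and AE: "AE x in lborel. indicator \<Omega> x *\<^sub>R f x = v x"
    using completion_ex_borel_measurable_real[of _ lborel] by blast
  define f' where "f' x = indicator \<Omega> x * v x" for x
  have m: "f' \<in> borel_measurable borel" unfolding f'_def using v by simp
  have 0: "f' x = 0" if "x \<notin> \<Omega>" for x using that by (simp add: f'_def)
  have AE': "AE x in lborel. x \<in> \<Omega> \<longrightarrow> f x = f' x"
    using AE by eventually_elim (auto simp: f'_def)
  have AE'': "AE x in lborel. x \<in> \<Omega> \<longrightarrow> (norm (f x))\<^sup>2 = (f' x)\<^sup>2"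
    using AE' by eventually_elim auto
  have I: "integrable lborel (\<lambda>x. (f' x)\<^sup>2)"
    using assms set_integral_AE(2)[OF _ _ AE''] m 0 by (simp add: L2_def)
  show thesis by (rule that[OF m 0 AE' I])
qed

lemma L2_vec_representative:
  fixes f :: "real ^ 'n \<Rightarrow> real ^ 'm"
  assumes "f \<in> L2 \<Omega>"
  obtains f' where "f' \<in> borel_measurable borel" "\<And>x. x \<notin> \<Omega> \<Longrightarrow> f' x = 0" "AE x in lborel. x \<in> \<Omega> \<longrightarrow> f x = f' x"
    "integrable lborel (\<lambda>x. (norm (f' x))\<^sup>2)"
proof -
  have "(\<lambda>x. indicator \<Omega> x *\<^sub>R f x) \<in> borel_measurable lebesgue"
    using assms by (simp add: L2_def set_borel_measurable_def)
  then have "(\<lambda>x. (indicator \<Omega> x *\<^sub>R f x) $ i) \<in> borel_measurable lebesgue" for i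
    by (rule measurable_compose) (rule borel_measurable_continuous_onI, intro continuous_intros)
  then have "\<forall>i. \<exists>v\<in>borel_measurable lborel. AE x in lborel. (indicator \<Omega> x *\<^sub>R f x) $ i = v x"
    using completion_ex_borel_measurable_real[of _ lborel] by blast
  then obtain v where vA: "\<forall>i. v i \<in> borel_measurable lborel \<and> (AE x in lborel. (indicator \<Omega> x *\<^sub>R f x) $ i = v i x)"
    unfolding Bex_def by (rule choice[THEN exE])
  then have v: "\<And>i. v i \<in> borel_measurable lborel" and AE: "\<And>i. AE x in lborel. (indicator \<Omega> x *\<^sub>R f x) $ i = v i x"
    by simp_all
  define f' where "f' x = indicator \<Omega> x *\<^sub>R (\<chi> i. v i x)" for x
  have m: "f' \<in> borel_measurable borel"
  proof -
    have "(\<lambda>x. \<chi> i. v i x) \<in> borel_measurable borel"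
    proof (rule borel_measurable_euclidean_space[THEN iffD2, rule_format])
      fix b :: "real ^ 'm" assume "b \<in> Basis"
      then obtain i where "b = axis i 1" by (auto simp: Basis_vec_def)
      then show "(\<lambda>x. (\<chi> i. v i x) \<bullet> b) \<in> borel_measurable borel" using v by (simp add: inner_axis)
    qed
    then show ?thesis unfolding f'_def[abs_def] by simp
  qed
  have 0: "f' x = 0" if "x \<notin> \<Omega>" for x using that by (simp add: f'_def)
  have "AE x in lborel. \<forall>i. (indicator \<Omega> x *\<^sub>R f x) $ i = v i x"
    unfolding AE_all_countable using AE by (rule allI)
  then have AE': "AE x in lborel. x \<in> \<Omega> \<longrightarrow> f x = f' x"
    by eventually_elim (auto simp: f'_def vec_eq_iff)
  have AE'': "AE x in lborel. x \<in> \<Omega> \<longrightarrow> (norm (f x))\<^sup>2 = (norm (f' x))\<^sup>2"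
    using AE' by eventually_elim auto
  have I: "integrable lborel (\<lambda>x. (norm (f' x))\<^sup>2)"
    using assms set_integral_AE(2)[OF _ _ AE''] m 0 by (simp add: L2_def)
  show thesis by (rule that[OF m 0 AE' I])
qed

text \<open>Test the weak equation with the smooth approximants of the eigenfunction: in the limit
  the square norm of its gradient is \<mu> times that of the function. The Rayleigh inequality
  passes to the same limit, and the square norm of the eigenfunction cancels.\<close>

lemma exp_first_log_eigenvalue_le_dirichlet_eigenvalue:
  assumes "dirichlet_eigenvalue \<Omega> \<mu>"
  shows "exp (first_log_eigenvalue \<Omega>) \<le> \<mu>"
proof -
  obtain u g where H: "H10_grad \<Omega> u g" and nz: "\<not> (AE x in lebesgue. x \<in> \<Omega> \<longrightarrow> u x = 0)"
    and weak: "\<And>\<phi>. \<phi> \<in> Cc_infinity \<Omega> \<Longrightarrow>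
          set_lebesgue_integral lebesgue \<Omega> (\<lambda>x. g x \<bullet> grad \<phi> x)
          = \<mu> * set_lebesgue_integral lebesgue \<Omega> (\<lambda>x. u x * \<phi> x)"
    using assms unfolding dirichlet_eigenvalue_def by blast
  from H obtain \<phi> where \<phi>: "\<And>k. \<phi> k \<in> Cc_infinity \<Omega>"
    and lim: "(\<lambda>k. L2_norm \<Omega> (\<lambda>x. \<phi> k x - u x)) \<longlonglongrightarrow> 0" "(\<lambda>k. L2_norm \<Omega> (\<lambda>x. grad (\<phi> k) x - g x)) \<longlonglongrightarrow> 0"
    and L2: "u \<in> L2 \<Omega>" "g \<in> L2 \<Omega>"
    unfolding H10_grad_def by blast
  obtain v where v: "v \<in> borel_measurable borel" "\<And>x. x \<notin> \<Omega> \<Longrightarrow> v x = 0" "AE x in lborel. x \<in> \<Omega> \<longrightarrow> u x = v x"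
    "integrable lborel (\<lambda>x. (v x)\<^sup>2)"
    by (rule L2_representative[OF L2(1)], rule that)
  obtain h where h: "h \<in> borel_measurable borel" "\<And>x. x \<notin> \<Omega> \<Longrightarrow> h x = 0" "AE x in lborel. x \<in> \<Omega> \<longrightarrow> g x = h x"
    "integrable lborel (\<lambda>x. (norm (h x))\<^sup>2)"
    by (rule L2_vec_representative[OF L2(2)], rule that)
  note \<phi>m = Cc_measurable[OF \<phi>] and \<phi>0 = Cc_outside[OF \<phi>] and \<phi>I = Cc_infinity_integrable[OF \<phi>]
  have n1: "L2_norm \<Omega> (\<lambda>x. \<phi> k x - u x) = sqrt (\<integral>x. (norm (\<phi> k x - v x))\<^sup>2 \<partial>lborel)" for k
  proof (rule L2_norm_AE)
    show "AE x in lborel. x \<in> \<Omega> \<longrightarrow> \<phi> k x - u x = \<phi> k x - v x"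
      using v(3) by eventually_elim simp
  qed (use \<phi>m v \<phi>0 in auto)
  have n2: "L2_norm \<Omega> (\<lambda>x. grad (\<phi> k) x - g x) = sqrt (\<integral>x. (norm (grad (\<phi> k) x - h x))\<^sup>2 \<partial>lborel)" for k
  proof (rule L2_norm_AE)
    show "AE x in lborel. x \<in> \<Omega> \<longrightarrow> grad (\<phi> k) x - g x = grad (\<phi> k) x - h x"
      using h(3) by eventually_elim simp
  qed (use \<phi>m h \<phi>0 in auto)
  have l1: "(\<lambda>k. \<integral>x. (norm (\<phi> k x - v x))\<^sup>2 \<partial>lborel) \<longlonglongrightarrow> 0"
    using tendsto_power[OF lim(1), of 2] unfolding n1 by simp
  have l2: "(\<lambda>k. \<integral>x. (norm (grad (\<phi> k) x - h x))\<^sup>2 \<partial>lborel) \<longlonglongrightarrow> 0"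
    using tendsto_power[OF lim(2), of 2] unfolding n2 by simp
  have weak': "(\<integral>x. h x \<bullet> grad (\<phi> k) x \<partial>lborel) = \<mu> * (\<integral>x. v x * \<phi> k x \<partial>lborel)" for k
  proof -
    have 1: "AE x in lborel. x \<in> \<Omega> \<longrightarrow> g x \<bullet> grad (\<phi> k) x = h x \<bullet> grad (\<phi> k) x"
      using h(3) by eventually_elim simp
    have 2: "AE x in lborel. x \<in> \<Omega> \<longrightarrow> u x * \<phi> k x = v x * \<phi> k x"
      using v(3) by eventually_elim simp
    have m: "(\<lambda>x. h x \<bullet> grad (\<phi> k) x) \<in> borel_measurable borel" "(\<lambda>x. v x * \<phi> k x) \<in> borel_measurable borel"
      using h(1) v(1) \<phi>m by auto
    show ?thesis
      using weak[OF \<phi>[of k]] set_integral_AE(1)[OF m(1) _ 1] set_integral_AE(1)[OF m(2) _ 2] h(2) v(2) by simp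
  qed
  have v2: "integrable lborel (\<lambda>x. (norm (v x))\<^sup>2)" and \<phi>2: "integrable lborel (\<lambda>x. (norm (\<phi> k x))\<^sup>2)" for k
    using v \<phi>I by auto
  have "v \<in> borel_measurable lborel" "h \<in> borel_measurable lborel" "\<phi> k \<in> borel_measurable lborel" "grad (\<phi> k) \<in> borel_measurable lborel" for k
    using v h \<phi>m by auto
  note m = this
  have A: "(\<lambda>k. \<integral>x. grad (\<phi> k) x \<bullet> h x \<partial>lborel) \<longlonglongrightarrow> (\<integral>x. h x \<bullet> h x \<partial>lborel)"
    by (rule L2_limit_inner[OF m(4) m(2) \<phi>I(3) h(4) l2 m(2) h(4)])
  have B: "(\<lambda>k. \<integral>x. \<phi> k x \<bullet> v x \<partial>lborel) \<longlonglongrightarrow> (\<integral>x. v x \<bullet> v x \<partial>lborel)"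
    by (rule L2_limit_inner[OF m(3) m(1) \<phi>2 v2 l1 m(1) v2])
  have C: "(\<lambda>k. sq_norm (\<phi> k)) \<longlonglongrightarrow> (sq_norm v)"
    by (rule L2_limit_norm[OF m(3) m(1) \<phi>2 v2 l1])
  have D: "(\<lambda>k. sq_norm (grad (\<phi> k))) \<longlonglongrightarrow> (sq_norm h)"
    by (rule L2_limit_norm[OF m(4) m(2) \<phi>I(3) h(4) l2])
  have "(\<lambda>k. \<integral>x. grad (\<phi> k) x \<bullet> h x \<partial>lborel) \<longlonglongrightarrow> \<mu> * (\<integral>x. v x \<bullet> v x \<partial>lborel)"
    using tendsto_mult_left[OF B, of \<mu>] weak' by (simp add: inner_commute mult.commute)
  then have eq: "(\<integral>x. h x \<bullet> h x \<partial>lborel) = \<mu> * (\<integral>x. v x \<bullet> v x \<partial>lborel)"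
    by (rule LIMSEQ_unique[OF A])
  have "exp (first_log_eigenvalue \<Omega>) * sq_norm v \<le> sq_norm h"
    using first_log_eigenvalue_le_Rayleigh[OF \<phi>]
    by (intro LIMSEQ_le[OF tendsto_mult_left[OF C] D]) auto
  then have le: "exp (first_log_eigenvalue \<Omega>) * sq_int v \<le> \<mu> * sq_int v"
  proof -
    have "(\<lambda>x. (v x)\<^sup>2) = (\<lambda>x. v x \<bullet> v x)"
      by (simp only: power2_eq_square inner_real_def)
    moreover have "(\<lambda>x. (norm (v x))\<^sup>2) = (\<lambda>x. v x \<bullet> v x)" "(\<lambda>x. (norm (h x))\<^sup>2) = (\<lambda>x. h x \<bullet> h x)"
      by (simp_all only: power2_norm_eq_inner)
    ultimately show ?thesis
      using \<open>exp _ * _ \<le> _\<close> eq by simp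
  qed
  have "sq_int v \<noteq> 0"
  proof
    assume "sq_int v = 0"
    then have "AE x in lborel. (v x)\<^sup>2 = 0"
      using v(4) by (subst (asm) integral_nonneg_eq_0_iff_AE) auto
    with v(3) have "AE x in lborel. x \<in> \<Omega> \<longrightarrow> u x = 0" by eventually_elim auto
    then have "AE x in lebesgue. x \<in> \<Omega> \<longrightarrow> u x = 0" by (rule AE_completion)
    with nz show False ..
  qed
  moreover have "sq_int v \<ge> 0" by simp
  ultimately have "sq_int v > 0" by linarith
  with le show ?thesis by simp
qed

text \<open>The infimum of the Rayleigh quotient over test functions. Showing that it is a weak
  eigenvalue makes the set behind \<open>first_dirichlet_eigenvalue\<close> nonempty.\<close>

definition dirichlet_infimum :: real where
  "dirichlet_infimum = Inf ((\<lambda>\<phi>. sq_norm (grad \<phi>)) ` {\<phi> \<in> Cc_infinity \<Omega>. sq_int \<phi> = 1})"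

lemma dirichlet_infimum_le:
  assumes \<phi>: "\<phi> \<in> Cc_infinity \<Omega>"
  shows "dirichlet_infimum * sq_int \<phi> \<le> sq_norm (grad \<phi>)"
proof (cases "sq_int \<phi> = 0")
  case False
  define a where "a = sq_int \<phi>"
  have "a \<ge> 0" by (simp add: a_def)
  with False have a: "a > 0" unfolding a_def by linarith
  have "dirichlet_infimum \<le> sq_norm (grad \<phi>) / a"
    unfolding dirichlet_infimum_def normalize_Cc(2)[OF \<phi> a_def[symmetric] a, symmetric]
  proof (rule cInf_lower)
    show "bdd_below ((\<lambda>\<phi>. sq_norm (grad \<phi>)) ` {\<phi> \<in> Cc_infinity \<Omega>. sq_int \<phi> = 1})"
      by (rule bdd_belowI2[of _ 0]) simp
  qed (use normalize_Cc(1)[OF \<phi> a_def[symmetric] a] in blast)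
  then show ?thesis using a by (simp add: a_def[symmetric] field_simps)
qed simp

lemma normalized_Cc_exists: "{\<phi> \<in> Cc_infinity \<Omega>. sq_int \<phi> = 1} \<noteq> {}"
proof -
  obtain \<psi> where \<psi>: "\<psi> \<in> Cc_infinity \<Omega>" "sq_int \<psi> > 0"
    by (rule bump_function_exists[OF open_\<Omega> nonempty], rule that)
  then show ?thesis using normalize_Cc(1)[OF \<psi>(1) refl \<psi>(2)] by blast
qed

subsection \<open>The first Dirichlet eigenvalue\<close>

lemma Cc_add:
  assumes "\<phi> \<in> Cc_infinity \<Omega>" "\<psi> \<in> Cc_infinity \<Omega>"
  shows "(\<lambda>x. \<phi> x + t * \<psi> x) \<in> Cc_infinity \<Omega>"
    "grad (\<lambda>x. \<phi> x + t * \<psi> x) x = grad \<phi> x + t *\<^sub>R grad \<psi> x"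
proof -
  interpret p: C1_function \<phi> "grad \<phi>" using assms(1) by (rule Cc_infinity_C1_function)
  interpret q: C1_function \<psi> "grad \<psi>" using assms(2) by (rule Cc_infinity_C1_function)
  have d: "\<phi> differentiable (at x)" "\<psi> differentiable (at x)" for x
    using p.deriv q.deriv by (auto simp: differentiable_def)
  show "(\<lambda>x. \<phi> x + t * \<psi> x) \<in> Cc_infinity \<Omega>" using Cc_infinity_lincomb[OF assms, of 1 t] by simp
  show "grad (\<lambda>x. \<phi> x + t * \<psi> x) x = grad \<phi> x + t *\<^sub>R grad \<psi> x"
    using grad_lincomb[OF d, of 1 t] by simp
qed

lemma norm_add_scaleR_square:
  fixes a b :: "'b::real_inner"
  shows "(norm (a + t *\<^sub>R b))\<^sup>2 = (norm a)\<^sup>2 + 2 * t * (a \<bullet> b) + t\<^sup>2 * (norm b)\<^sup>2"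
  unfolding power2_norm_eq_inner by (simp add: inner_add inner_commute power2_eq_square algebra_simps)

text \<open>
  A minimizing sequence converges in \<open>L\<^sup>2\<close> along a subsequence by compactness; the parallelogram
  identity for \<open>\<integral> \<bar>\<nabla>\<phi>\<bar>\<^sup>2\<close> then makes the gradients Cauchy as well.
\<close>

lemma dirichlet_minimizer:
  obtains \<psi> u g where "\<And>k :: nat. \<psi> k \<in> Cc_infinity \<Omega>"
    "u \<in> borel_measurable borel" "\<And>x. x \<notin> \<Omega> \<Longrightarrow> u x = 0" "integrable lborel (\<lambda>x. (norm (u x))\<^sup>2)"
    "(\<lambda>k. \<integral>x. (norm (\<psi> k x - u x))\<^sup>2 \<partial>lborel) \<longlonglongrightarrow> 0"
    "g \<in> borel_measurable borel" "\<And>x. x \<notin> \<Omega> \<Longrightarrow> g x = 0" "integrable lborel (\<lambda>x. (norm (g x))\<^sup>2)"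
    "(\<lambda>k. \<integral>x. (norm (grad (\<psi> k) x - g x))\<^sup>2 \<partial>lborel) \<longlonglongrightarrow> 0"
    "sq_norm u = 1" "sq_norm g = dirichlet_infimum"
proof -
  let ?l = dirichlet_infimum
  obtain \<phi> where \<phi>S: "\<And>k. \<phi> k \<in> {\<phi> \<in> Cc_infinity \<Omega>. sq_int \<phi> = 1}"
    and \<phi>l: "\<And>k. sq_norm (grad (\<phi> k)) < ?l + 1 / real (Suc k)"
    by (rule minimizing_sequence[OF normalized_Cc_exists, of "\<lambda>\<phi>. sq_norm (grad \<phi>)",
        folded dirichlet_infimum_def], rule that)
  have \<phi>: "\<phi> k \<in> Cc_infinity \<Omega>" "sq_int (\<phi> k) = 1"
    "sq_norm (grad (\<phi> k)) < ?l + 1 / real (Suc k)" for k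
    using \<phi>S[of k] \<phi>l[of k] by simp_all
  note \<phi>m = Cc_measurable[OF \<phi>(1)] and \<phi>0 = Cc_outside[OF \<phi>(1)] and \<phi>I = Cc_infinity_integrable[OF \<phi>(1)]
  have lower: "?l \<le> sq_norm (grad (\<phi> k))" for k
    using dirichlet_infimum_le[OF \<phi>(1)[of k]] \<phi>(2)[of k] by simp
  define C where "C = pi powr (DIM(real^'n) / 2) / Gamma (DIM(real^'n) / 2)"
  have C: "C \<ge> 0" by (simp add: C_def Gamma_real_pos less_imp_le)
  \<comment> \<open>Bounded Dirichlet integral implies bounded near energy, so
    \<open>compactness_of_finite_energy\<close> takes the place of the Rellich theorem.\<close>
  have near: "near_energy (\<phi> k) \<le> C * (?l + 1)" for k
  proof -
    interpret C1_function "\<phi> k" "grad (\<phi> k)" by (rule Cc_infinity_C1_function[OF \<phi>(1)])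
    have "near_energy (\<phi> k) \<le> C * sq_norm (grad (\<phi> k))"
      unfolding C_def by (rule near_energy_bound(2)[OF \<phi>I])
    also have "\<dots> \<le> C * (?l + 1)"
    proof (rule mult_left_mono[OF _ C])
      have "1 / real (Suc k) \<le> 1" by simp
      then show "sq_norm (grad (\<phi> k)) \<le> ?l + 1" using \<phi>(3)[of k] by linarith
    qed
    finally show ?thesis .
  qed
  have n1: "sq_int (\<phi> k) \<le> 1" for k using \<phi>(2)[of k] by simp
  obtain r where r: "strict_mono (r :: nat \<Rightarrow> nat)"
    and Cau: "\<And>e. e > 0 \<Longrightarrow> \<exists>K. \<forall>m\<ge>K. \<forall>n\<ge>K. (\<integral>x. (\<phi> (r m) x - \<phi> (r n) x)\<^sup>2 \<partial>lborel) < e"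
    by (rule compactness_of_finite_energy[OF \<phi>m(1) \<Omega>_borel bounded_\<Omega> \<phi>0(1) \<phi>I(2) n1
         energy_spaceD(3)[OF Cc_energy_space[OF \<phi>(1)]] near], assumption) (rule that)
  define \<psi> where "\<psi> k = \<phi> (r k)" for k
  have \<psi>: "\<psi> k \<in> Cc_infinity \<Omega>" for k unfolding \<psi>_def by (rule \<phi>(1))
  note \<psi>m = Cc_measurable[OF \<psi>] and \<psi>0 = Cc_outside[OF \<psi>] and \<psi>I = Cc_infinity_integrable[OF \<psi>]
  have \<psi>n: "sq_int (\<psi> k) = 1" for k by (simp add: \<psi>_def \<phi>(2))
  have \<psi>m': "\<psi> k \<in> borel_measurable lborel" "grad (\<psi> k) \<in> borel_measurable lborel" for k using \<psi>m by auto
  have \<psi>2: "integrable lborel (\<lambda>x. (norm (\<psi> k x))\<^sup>2)" for k using \<psi>I(2) by simp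
  have upper: "sq_norm (grad (\<psi> k)) < ?l + 1 / real (Suc k)" for k
  proof -
    have "1 / real (Suc (r k)) \<le> 1 / real (Suc k)"
      using seq_suble[OF r, of k] by (intro divide_left_mono) auto
    with \<phi>(3)[of "r k"] show ?thesis unfolding \<psi>_def by linarith
  qed
  have \<psi>low: "?l \<le> sq_norm (grad (\<psi> k))" for k unfolding \<psi>_def by (rule lower)
  have dI: "integrable lborel (\<lambda>x. (norm (\<psi> m x - \<psi> n x))\<^sup>2)" for m n
    by (rule square_integrable_diff[OF \<psi>m'(1) \<psi>m'(1) \<psi>2 \<psi>2])
  have gI: "integrable lborel (\<lambda>x. (norm (grad (\<psi> m) x - grad (\<psi> n) x))\<^sup>2)" for m n
    by (rule square_integrable_diff[OF \<psi>m'(2) \<psi>m'(2) \<psi>I(3) \<psi>I(3)])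
  have para: "(\<integral>x. (norm (grad (\<psi> m) x - grad (\<psi> n) x))\<^sup>2 \<partial>lborel) \<le>
      2 / real (Suc m) + 2 / real (Suc n) + ?l * (\<integral>x. (norm (\<psi> m x - \<psi> n x))\<^sup>2 \<partial>lborel)" for m n
  proof -
    have S: "(\<lambda>x. \<psi> m x + 1 * \<psi> n x) \<in> Cc_infinity \<Omega>" by (rule Cc_add(1)[OF \<psi> \<psi>])
    note SI = Cc_infinity_integrable[OF S]
    have p: "(norm (a - b))\<^sup>2 = 2 * (norm a)\<^sup>2 + 2 * (norm b)\<^sup>2 - (norm (a + b))\<^sup>2" for a b :: "'b::real_inner"
      by (simp add: power2_norm_eq_inner inner_add inner_diff inner_commute)
    have 1: "(\<integral>x. (norm (grad (\<psi> m) x - grad (\<psi> n) x))\<^sup>2 \<partial>lborel) =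
       2 * sq_norm (grad (\<psi> m)) + 2 * sq_norm (grad (\<psi> n)) -
       (\<integral>x. (norm (grad (\<lambda>x. \<psi> m x + 1 * \<psi> n x) x))\<^sup>2 \<partial>lborel)"
      unfolding p using \<psi>I(3)[of m] \<psi>I(3)[of n] SI(3) Cc_add(2)[OF \<psi> \<psi>, of m 1 n] by simp
    have 2: "(\<integral>x. (norm (\<psi> m x - \<psi> n x))\<^sup>2 \<partial>lborel) =
       2 * sq_norm (\<psi> m) + 2 * sq_norm (\<psi> n) -
       (\<integral>x. (norm (\<psi> m x + \<psi> n x))\<^sup>2 \<partial>lborel)"
      unfolding p using \<psi>2[of m] \<psi>2[of n] SI(2) by simp
    \<comment> \<open>The sum is a test function of square norm 4 minus that of the difference, so
      the Rayleigh bound makes its gradient nearly as large as possible and leaves little for the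
      gradient of the difference.\<close>
    have "?l * (\<integral>x. (\<psi> m x + 1 * \<psi> n x)\<^sup>2 \<partial>lborel) \<le> (\<integral>x. (norm (grad (\<lambda>x. \<psi> m x + 1 * \<psi> n x) x))\<^sup>2 \<partial>lborel)"
      by (rule dirichlet_infimum_le[OF S])
    moreover have "(\<integral>x. (\<psi> m x + 1 * \<psi> n x)\<^sup>2 \<partial>lborel) = 4 - (\<integral>x. (norm (\<psi> m x - \<psi> n x))\<^sup>2 \<partial>lborel)"
      using 2 \<psi>n by simp
    ultimately have "?l * (4 - (\<integral>x. (norm (\<psi> m x - \<psi> n x))\<^sup>2 \<partial>lborel)) \<le> (\<integral>x. (norm (grad (\<lambda>x. \<psi> m x + 1 * \<psi> n x) x))\<^sup>2 \<partial>lborel)"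
      by (simp only:)
    then have "?l * 4 - ?l * (\<integral>x. (norm (\<psi> m x - \<psi> n x))\<^sup>2 \<partial>lborel) \<le> (\<integral>x. (norm (grad (\<lambda>x. \<psi> m x + 1 * \<psi> n x) x))\<^sup>2 \<partial>lborel)"
      by (simp only: right_diff_distrib)
    then show ?thesis using 1 upper[of m] upper[of n] by simp
  qed
  have l0: "?l \<ge> 0"
  proof (rule field_le_epsilon)
    fix e :: real assume "e > 0"
    then obtain k where "1 / real (Suc k) < e" using nat_approx_posE by blast
    moreover have "0 \<le> sq_norm (grad (\<psi> k))" by simp
    ultimately show "0 \<le> ?l + e" using upper[of k] by linarith
  qed
  have CauN: "\<exists>K. \<forall>m\<ge>K. \<forall>n\<ge>K. (\<integral>x. (norm (\<psi> m x - \<psi> n x))\<^sup>2 \<partial>lborel) < e" if "e > 0" for e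
    using Cau[OF that] by (simp add: \<psi>_def)
  have CauG: "\<exists>K. \<forall>m\<ge>K. \<forall>n\<ge>K. (\<integral>x. (norm (grad (\<psi> m) x - grad (\<psi> n) x))\<^sup>2 \<partial>lborel) < e" if e: "e > 0" for e
  proof -
    \<comment> \<open>The three terms of \<open>para\<close> get e/3 each; ?l + 1 avoids dividing by
      0 in case ?l = 0.\<close>
    obtain K where K: "\<And>m n. m \<ge> K \<Longrightarrow> n \<ge> K \<Longrightarrow> (\<integral>x. (norm (\<psi> m x - \<psi> n x))\<^sup>2 \<partial>lborel) < e / (3 * (?l + 1))"
      using CauN[of "e / (3 * (?l + 1))"] e l0 by auto
    obtain K' where K': "1 / real (Suc K') < e / 6" using nat_approx_posE[of "e / 6"] e by auto
    have "(\<integral>x. (norm (grad (\<psi> m) x - grad (\<psi> n) x))\<^sup>2 \<partial>lborel) < e" if mn: "m \<ge> max K K'" "n \<ge> max K K'" for m n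
    proof -
      have inv: "2 / real (Suc k) < e / 3" if "k \<ge> max K K'" for k
      proof -
        have "1 / real (Suc k) \<le> 1 / real (Suc K')" using that by (intro divide_left_mono) auto
        then have "1 / real (Suc k) < e / 6" using K' by linarith
        then show ?thesis by simp
      qed
      have "?l * (\<integral>x. (norm (\<psi> m x - \<psi> n x))\<^sup>2 \<partial>lborel) \<le> ?l * (e / (3 * (?l + 1)))"
        using K[of m n] mn l0 by (intro mult_left_mono) auto
      also have "\<dots> \<le> e / 3" using l0 e by (simp add: field_simps)
      finally show ?thesis using para[of m n] inv[OF mn(1)] inv[OF mn(2)] by linarith
    qed
    then show ?thesis by blast
  qed
  have \<Omega>s: "\<Omega> \<in> sets lborel" by simp
  obtain u r1 where u: "u \<in> borel_measurable lborel" "\<And>x. x \<notin> \<Omega> \<Longrightarrow> u x = 0" "integrable lborel (\<lambda>x. (norm (u x))\<^sup>2)"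
    "strict_mono (r1 :: nat \<Rightarrow> nat)" "AE x in lborel. (\<lambda>k. \<psi> (r1 k) x) \<longlonglongrightarrow> u x"
    "(\<lambda>k. \<integral>x. (norm (\<psi> k x - u x))\<^sup>2 \<partial>lborel) \<longlonglongrightarrow> 0"
    by (rule L2_Cauchy_limit[OF \<psi>m'(1) \<Omega>s emeasure_\<Omega> \<psi>0(1) \<psi>2 CauN], assumption, assumption) (rule that)
  obtain g r2 where g: "g \<in> borel_measurable lborel" "\<And>x. x \<notin> \<Omega> \<Longrightarrow> g x = 0" "integrable lborel (\<lambda>x. (norm (g x))\<^sup>2)"
    "strict_mono (r2 :: nat \<Rightarrow> nat)" "AE x in lborel. (\<lambda>k. grad (\<psi> (r2 k)) x) \<longlonglongrightarrow> g x"
    "(\<lambda>k. \<integral>x. (norm (grad (\<psi> k) x - g x))\<^sup>2 \<partial>lborel) \<longlonglongrightarrow> 0"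
    by (rule L2_Cauchy_limit[OF \<psi>m'(2) \<Omega>s emeasure_\<Omega> \<psi>0(2) \<psi>I(3) CauG], assumption, assumption) (rule that)
  have un: "sq_norm u = 1"
  proof (rule LIMSEQ_unique)
    show "(\<lambda>k. sq_norm (\<psi> k)) \<longlonglongrightarrow> (sq_norm u)"
      by (rule L2_limit_norm[OF \<psi>m'(1) u(1) \<psi>2 u(3) u(6)])
    show "(\<lambda>k. sq_norm (\<psi> k)) \<longlonglongrightarrow> 1" using \<psi>n by simp
  qed
  have gn: "sq_norm g = ?l"
  proof (rule LIMSEQ_unique)
    show "(\<lambda>k. sq_norm (grad (\<psi> k))) \<longlonglongrightarrow> (sq_norm g)"
      by (rule L2_limit_norm[OF \<psi>m'(2) g(1) \<psi>I(3) g(3) g(6)])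
    show "(\<lambda>k. sq_norm (grad (\<psi> k))) \<longlonglongrightarrow> ?l"
    proof (rule tendsto_sandwich[OF _ _ tendsto_const])
      show "(\<lambda>k. ?l + 1 / real (Suc k)) \<longlonglongrightarrow> ?l"
        using tendsto_add[OF tendsto_const LIMSEQ_Suc[OF lim_1_over_n[where 'a=real]], of ?l] by simp
    qed (use \<psi>low upper in \<open>auto intro!: always_eventually less_imp_le\<close>)
  qed
  have um: "u \<in> borel_measurable borel" "g \<in> borel_measurable borel" using u(1) g(1) by simp_all
  show thesis
    by (rule that[OF \<psi> um(1) u(2) u(3) u(6) um(2) g(2) g(3) g(6) un gn])
qed

text \<open>The Rayleigh inequality is available for test functions only, so the variation in
  direction \<theta> is performed on the approximants \<psi> k and the limit in k is taken at fixed
  t. The resulting quadratic in t yields the weak equation. The weak gradient is likewise inherited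
  from the approximants.\<close>

lemma dirichlet_eigenvalue_infimum: "dirichlet_eigenvalue \<Omega> dirichlet_infimum"
proof -
  let ?l = dirichlet_infimum
  obtain \<psi> u g where \<psi>: "\<And>k :: nat. \<psi> k \<in> Cc_infinity \<Omega>"
    and u: "u \<in> borel_measurable borel" "\<And>x. x \<notin> \<Omega> \<Longrightarrow> u x = 0" "integrable lborel (\<lambda>x. (norm (u x))\<^sup>2)"
    "(\<lambda>k. \<integral>x. (norm (\<psi> k x - u x))\<^sup>2 \<partial>lborel) \<longlonglongrightarrow> 0"
    and g: "g \<in> borel_measurable borel" "\<And>x. x \<notin> \<Omega> \<Longrightarrow> g x = 0" "integrable lborel (\<lambda>x. (norm (g x))\<^sup>2)"
    "(\<lambda>k. \<integral>x. (norm (grad (\<psi> k) x - g x))\<^sup>2 \<partial>lborel) \<longlonglongrightarrow> 0"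
    and un: "sq_norm u = 1" and gn: "sq_norm g = ?l"
    by (rule dirichlet_minimizer, rule that)
  note \<psi>m = Cc_measurable[OF \<psi>] and \<psi>0 = Cc_outside[OF \<psi>] and \<psi>I = Cc_infinity_integrable[OF \<psi>]
  have \<psi>2: "integrable lborel (\<lambda>x. (norm (\<psi> k x))\<^sup>2)" for k using \<psi>I(2) by simp
  have m: "\<psi> k \<in> borel_measurable lborel" "grad (\<psi> k) \<in> borel_measurable lborel" "u \<in> borel_measurable lborel" "g \<in> borel_measurable lborel" for k
    using \<psi>m u(1) g(1) by auto
  have L2: "u \<in> L2 \<Omega>" "g \<in> L2 \<Omega>"
    using set_integral_AE(3)[OF u(1,2), of u] set_integral_AE(3)[OF g(1,2), of g] u g
      set_integral_AE(2)[of "\<lambda>x. (norm (u x))\<^sup>2" "\<lambda>x. (norm (u x))\<^sup>2"] set_integral_AE(2)[of "\<lambda>x. (norm (g x))\<^sup>2" "\<lambda>x. (norm (g x))\<^sup>2"]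
    by (simp_all add: L2_def)
  have lims: "(\<lambda>k. L2_norm \<Omega> (\<lambda>x. \<psi> k x - u x)) \<longlonglongrightarrow> 0" "(\<lambda>k. L2_norm \<Omega> (\<lambda>x. grad (\<psi> k) x - g x)) \<longlonglongrightarrow> 0"
  proof -
    have 1: "L2_norm \<Omega> (\<lambda>x. \<psi> k x - u x) = sqrt (\<integral>x. (norm (\<psi> k x - u x))\<^sup>2 \<partial>lborel)"
      and 2: "L2_norm \<Omega> (\<lambda>x. grad (\<psi> k) x - g x) = sqrt (\<integral>x. (norm (grad (\<psi> k) x - g x))\<^sup>2 \<partial>lborel)" for k
      by (rule L2_norm_AE; use \<psi>m \<psi>0 u g in simp)+
    show "(\<lambda>k. L2_norm \<Omega> (\<lambda>x. \<psi> k x - u x)) \<longlonglongrightarrow> 0" "(\<lambda>k. L2_norm \<Omega> (\<lambda>x. grad (\<psi> k) x - g x)) \<longlonglongrightarrow> 0"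
      unfolding 1 2 using tendsto_real_sqrt[OF u(4)] tendsto_real_sqrt[OF g(4)] by simp_all
  qed
  have pairing: "(\<lambda>k. \<integral>x. \<psi> k x \<bullet> w x \<partial>lborel) \<longlonglongrightarrow> (\<integral>x. u x \<bullet> w x \<partial>lborel)"
    if "w \<in> borel_measurable lborel" "integrable lborel (\<lambda>x. (norm (w x))\<^sup>2)" for w
    by (rule L2_limit_inner[OF m(1) m(3) \<psi>2 u(3) u(4) that])
  have pairing_grad: "(\<lambda>k. \<integral>x. grad (\<psi> k) x \<bullet> w x \<partial>lborel) \<longlonglongrightarrow> (\<integral>x. g x \<bullet> w x \<partial>lborel)"
    if "w \<in> borel_measurable lborel" "integrable lborel (\<lambda>x. (norm (w x))\<^sup>2)" for w
    by (rule L2_limit_inner[OF m(2) m(4) \<psi>I(3) g(3) g(4) that])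
  have "weak_gradient \<Omega> u g"
    unfolding weak_gradient_def
  proof
    fix \<theta> assume \<theta>: "\<theta> \<in> Cc_infinity \<Omega>"
    note \<theta>m = Cc_measurable[OF \<theta>] and \<theta>0 = Cc_outside[OF \<theta>] and \<theta>I = Cc_infinity_integrable[OF \<theta>]
    interpret \<theta>: C1_function \<theta> "grad \<theta>" using \<theta> by (rule Cc_infinity_C1_function)
    obtain S where S: "compact S" "S \<subseteq> \<Omega>" "\<And>x. x \<notin> S \<Longrightarrow> \<theta> x = 0" "\<And>x. x \<notin> S \<Longrightarrow> grad \<theta> x = 0"
      by (rule Cc_infinity_support[OF \<theta>], rule that)
    have e2: "integrable lborel (\<lambda>x. (norm (grad \<theta> x \<bullet> e))\<^sup>2)" for e
      by (rule integrable_continuous_compact_support[OF _ S(1)])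
        (auto simp: S intro!: continuous_intros \<theta>.continuous_grad)
    have e2': "integrable lborel (\<lambda>x. (norm (\<theta> x *\<^sub>R e))\<^sup>2)" for e :: "real ^ 'n"
      by (rule integrable_continuous_compact_support[OF _ S(1)])
        (auto simp: S intro!: continuous_intros \<theta>.continuous)
    have \<theta>m': "grad \<theta> \<in> borel_measurable lborel" "\<theta> \<in> borel_measurable lborel" using \<theta>m by auto
    have em: "(\<lambda>x. grad \<theta> x \<bullet> e) \<in> borel_measurable lborel" "(\<lambda>x. \<theta> x *\<^sub>R e) \<in> borel_measurable lborel" for e :: "real ^ 'n"
      using \<theta>m' by auto
    \<comment> \<open>Integration by parts is available in one direction e at a time; the vector
      identity is recovered from its components.\<close>
    have key: "(\<integral>x. u x * (grad \<theta> x \<bullet> e) \<partial>lborel) = - (\<integral>x. g x \<bullet> (\<theta> x *\<^sub>R e) \<partial>lborel)" for e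
    proof (rule LIMSEQ_unique)
      show "(\<lambda>k. \<integral>x. \<psi> k x \<bullet> (grad \<theta> x \<bullet> e) \<partial>lborel) \<longlonglongrightarrow> (\<integral>x. u x * (grad \<theta> x \<bullet> e) \<partial>lborel)"
        using pairing[OF em(1) e2] by simp
      have "(\<integral>x. \<psi> k x \<bullet> (grad \<theta> x \<bullet> e) \<partial>lborel) = - (\<integral>x. grad (\<psi> k) x \<bullet> (\<theta> x *\<^sub>R e) \<partial>lborel)" for k
      proof -
        obtain T where T: "compact T" "T \<subseteq> \<Omega>" "\<And>x. x \<notin> T \<Longrightarrow> \<psi> k x = 0" "\<And>x. x \<notin> T \<Longrightarrow> grad (\<psi> k) x = 0"
          by (rule Cc_infinity_support[OF \<psi>[of k]], rule that)
        show ?thesis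
          using integration_by_parts[OF Cc_infinity_C1_function[OF \<psi>[of k]] Cc_infinity_C1_function[OF \<theta>] T(1,3,4) S(1,3,4), of e]
          by simp
      qed
      then show "(\<lambda>k. \<integral>x. \<psi> k x \<bullet> (grad \<theta> x \<bullet> e) \<partial>lborel) \<longlonglongrightarrow> - (\<integral>x. g x \<bullet> (\<theta> x *\<^sub>R e) \<partial>lborel)"
        using tendsto_minus[OF pairing_grad[OF em(2) e2']] by simp
    qed
    have I1: "integrable lborel (\<lambda>x. u x *\<^sub>R grad \<theta> x)"
    proof -
      have "integrable lborel (\<lambda>x. \<bar>u x\<bar> * norm (grad \<theta> x))"
        by (rule square_integrable_mult) (use u \<theta>m \<theta>I in auto)
      then have "integrable lborel (\<lambda>x. norm (u x *\<^sub>R grad \<theta> x))" by simp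
      then show ?thesis using u(1) \<theta>m by (subst (asm) integrable_norm_iff) auto
    qed
    have I2: "integrable lborel (\<lambda>x. \<theta> x *\<^sub>R g x)"
    proof -
      have "integrable lborel (\<lambda>x. \<bar>\<theta> x\<bar> * norm (g x))"
        by (rule square_integrable_mult) (use g \<theta>m \<theta>I in auto)
      then have "integrable lborel (\<lambda>x. norm (\<theta> x *\<^sub>R g x))" by simp
      then show ?thesis using g(1) \<theta>m by (subst (asm) integrable_norm_iff) auto
    qed
    have "(\<integral>x. u x *\<^sub>R grad \<theta> x \<partial>lborel) = - (\<integral>x. \<theta> x *\<^sub>R g x \<partial>lborel)"
    proof (rule euclidean_eqI)
      fix e :: "real ^ 'n"
      have "(\<integral>x. u x *\<^sub>R grad \<theta> x \<partial>lborel) \<bullet> e = (\<integral>x. u x * (grad \<theta> x \<bullet> e) \<partial>lborel)"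
        using I1 by (subst integral_inner_left[symmetric]) auto
      moreover have "(\<integral>x. \<theta> x *\<^sub>R g x \<partial>lborel) \<bullet> e = (\<integral>x. g x \<bullet> (\<theta> x *\<^sub>R e) \<partial>lborel)"
        using I2 by (subst integral_inner_left[symmetric]) auto
      ultimately show "(\<integral>x. u x *\<^sub>R grad \<theta> x \<partial>lborel) \<bullet> e = - (\<integral>x. \<theta> x *\<^sub>R g x \<partial>lborel) \<bullet> e"
        using key[of e] by simp
    qed
    moreover have "(\<lambda>x. u x *\<^sub>R grad \<theta> x) \<in> borel_measurable borel" "(\<lambda>x. \<theta> x *\<^sub>R g x) \<in> borel_measurable borel"
      using u(1) g(1) \<theta>m by auto
    ultimately show "set_lebesgue_integral lebesgue \<Omega> (\<lambda>x. u x *\<^sub>R grad \<theta> x) = - set_lebesgue_integral lebesgue \<Omega> (\<lambda>x. \<theta> x *\<^sub>R g x)"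
      using set_integral_AE(1)[of "\<lambda>x. u x *\<^sub>R grad \<theta> x" "\<lambda>x. u x *\<^sub>R grad \<theta> x"]
        set_integral_AE(1)[of "\<lambda>x. \<theta> x *\<^sub>R g x" "\<lambda>x. \<theta> x *\<^sub>R g x"] u(2) g(2) by simp
  qed
  then have H: "H10_grad \<Omega> u g"
    using L2 \<psi> lims unfolding H10_grad_def by blast
  have nz: "\<not> (AE x in lebesgue. x \<in> \<Omega> \<longrightarrow> u x = 0)"
  proof
    assume "AE x in lebesgue. x \<in> \<Omega> \<longrightarrow> u x = 0"
    then have "AE x in lborel. x \<in> \<Omega> \<longrightarrow> u x = 0" by (simp only: AE_completion_iff)
    then have "AE x in lborel. (norm (u x))\<^sup>2 = 0" by eventually_elim (use u(2) in auto)
    then have "sq_norm u = 0" by (rule integral_eq_zero_AE)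
    with un show False by simp
  qed
  have weak: "(\<integral>x. g x \<bullet> grad \<theta> x \<partial>lborel) = ?l * (\<integral>x. u x * \<theta> x \<partial>lborel)" if \<theta>: "\<theta> \<in> Cc_infinity \<Omega>" for \<theta>
  proof -
    note \<theta>m = Cc_measurable[OF \<theta>] and \<theta>I = Cc_infinity_integrable[OF \<theta>]
    have \<theta>m': "grad \<theta> \<in> borel_measurable lborel" "\<theta> \<in> borel_measurable lborel" using \<theta>m by auto
    have \<theta>2: "integrable lborel (\<lambda>x. (norm (\<theta> x))\<^sup>2)" using \<theta>I(2) by simp
    let ?A = "\<integral>x. g x \<bullet> grad \<theta> x \<partial>lborel" and ?B = "\<integral>x. u x \<bullet> \<theta> x \<partial>lborel"
    let ?a = "sq_norm (grad \<theta>)" and ?b = "sq_norm \<theta>"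
    \<comment> \<open>The constant terms of the two expansions both converge to ?l and cancel,
      because u has norm 1 and g has square norm ?l.\<close>
    have "0 \<le> 2 * t * (?A - ?l * ?B) + t\<^sup>2 * (?a - ?l * ?b)" for t
    proof -
      have exp1: "(\<integral>x. (norm (grad (\<lambda>x. \<psi> k x + t * \<theta> x) x))\<^sup>2 \<partial>lborel) =
         sq_norm (grad (\<psi> k)) + 2 * t * (\<integral>x. grad (\<psi> k) x \<bullet> grad \<theta> x \<partial>lborel) + t\<^sup>2 * ?a" for k
        unfolding Cc_add(2)[OF \<psi> \<theta>] norm_add_scaleR_square
        using \<psi>I(3)[of k] \<theta>I(3) square_integrable_inner(1)[OF m(2) \<theta>m'(1) \<psi>I(3) \<theta>I(3), of k] by simp
      have exp2: "(\<integral>x. (\<psi> k x + t * \<theta> x)\<^sup>2 \<partial>lborel) =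
         sq_norm (\<psi> k) + 2 * t * (\<integral>x. \<psi> k x \<bullet> \<theta> x \<partial>lborel) + t\<^sup>2 * ?b" for k
      proof -
        have "(\<integral>x. (\<psi> k x + t * \<theta> x)\<^sup>2 \<partial>lborel) = (\<integral>x. (norm (\<psi> k x + t *\<^sub>R \<theta> x))\<^sup>2 \<partial>lborel)" by simp
        also have "\<dots> = sq_norm (\<psi> k) + 2 * t * (\<integral>x. \<psi> k x \<bullet> \<theta> x \<partial>lborel) + t\<^sup>2 * ?b"
          unfolding norm_add_scaleR_square
          using \<psi>2[of k] \<theta>2 square_integrable_inner(1)[OF m(1) \<theta>m'(2) \<psi>2 \<theta>2, of k] by simp
        finally show ?thesis .
      qed
      have "?l * (1 + 2 * t * ?B + t\<^sup>2 * ?b) \<le> ?l + 2 * t * ?A + t\<^sup>2 * ?a"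
      proof (rule LIMSEQ_le)
        have "(\<lambda>k. sq_norm (\<psi> k)) \<longlonglongrightarrow> 1"
          using L2_limit_norm[OF m(1) m(3) \<psi>2 u(3) u(4)] un by simp
        then show "(\<lambda>k. ?l * (\<integral>x. (\<psi> k x + t * \<theta> x)\<^sup>2 \<partial>lborel)) \<longlonglongrightarrow> ?l * (1 + 2 * t * ?B + t\<^sup>2 * ?b)"
          unfolding exp2
          by (intro tendsto_mult tendsto_add tendsto_const pairing \<theta>m' \<theta>2)
        have "(\<lambda>k. sq_norm (grad (\<psi> k))) \<longlonglongrightarrow> ?l"
          using L2_limit_norm[OF m(2) m(4) \<psi>I(3) g(3) g(4)] gn by simp
        then show "(\<lambda>k. \<integral>x. (norm (grad (\<lambda>x. \<psi> k x + t * \<theta> x) x))\<^sup>2 \<partial>lborel) \<longlonglongrightarrow> ?l + 2 * t * ?A + t\<^sup>2 * ?a"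
          unfolding exp1
          by (intro tendsto_mult tendsto_add tendsto_const pairing_grad \<theta>m' \<theta>I)
        show "\<exists>K. \<forall>k\<ge>K. ?l * (\<integral>x. (\<psi> k x + t * \<theta> x)\<^sup>2 \<partial>lborel) \<le> (\<integral>x. (norm (grad (\<lambda>x. \<psi> k x + t * \<theta> x) x))\<^sup>2 \<partial>lborel)"
          using dirichlet_infimum_le[OF Cc_add(1)[OF \<psi> \<theta>]] by blast
      qed
      then show ?thesis by (simp only: algebra_simps)
    qed
    then have "?A - ?l * ?B = 0" by (rule linear_term_zero)
    then show ?thesis by simp
  qed
  have "set_lebesgue_integral lebesgue \<Omega> (\<lambda>x. g x \<bullet> grad \<theta> x) = ?l * set_lebesgue_integral lebesgue \<Omega> (\<lambda>x. u x * \<theta> x)"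
    if \<theta>: "\<theta> \<in> Cc_infinity \<Omega>" for \<theta>
  proof -
    have "(\<lambda>x. g x \<bullet> grad \<theta> x) \<in> borel_measurable borel" "(\<lambda>x. u x * \<theta> x) \<in> borel_measurable borel"
      using u(1) g(1) Cc_measurable[OF \<theta>] by auto
    then show ?thesis
      using set_integral_AE(1)[of "\<lambda>x. g x \<bullet> grad \<theta> x" "\<lambda>x. g x \<bullet> grad \<theta> x"]
        set_integral_AE(1)[of "\<lambda>x. u x * \<theta> x" "\<lambda>x. u x * \<theta> x"] u(2) g(2) weak[OF \<theta>] by simp
  qed
  with H nz show ?thesis unfolding dirichlet_eigenvalue_def by blast
qed

subsection \<open>The first eigenfunction of the logarithmic Laplacian\<close>

lemma energy_space_add:
  assumes u: "u \<in> energy_space" and w: "w \<in> energy_space"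
  shows "(\<lambda>x. u x + t * w x) \<in> energy_space"
    and "(\<integral>x. (u x + t * w x)\<^sup>2 \<partial>lborel) = sq_int u + 2 * t * (\<integral>x. u x * w x \<partial>lborel) + t\<^sup>2 * sq_int w"
    and "log_energy (\<lambda>x. u x + t * w x) = log_energy u + 2 * t * E_L u w + t\<^sup>2 * log_energy w"
proof -
  note ud = energy_spaceD[OF u] and wd = energy_spaceD[OF w]
  have uw: "integrable lborel (\<lambda>x. u x * w x)"
    by (rule square_integrable_mult) (use ud wd in auto)
  have sq: "(\<lambda>x. (u x + t * w x)\<^sup>2) = (\<lambda>x. (u x)\<^sup>2 + 2 * t * (u x * w x) + t\<^sup>2 * (w x)\<^sup>2)"
    by (simp add: fun_eq_iff power2_eq_square algebra_simps)
  have "(\<lambda>x. u x + t * w x) \<in> borel_measurable borel" using ud(1) wd(1) by simp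
  then show "(\<lambda>x. u x + t * w x) \<in> energy_space"
    using ud wd uw near_energy_lincomb(1)[OF ud(1) wd(1) ud(3) wd(3), of t]
    by (simp add: energy_space_def sq)
  show I: "(\<integral>x. (u x + t * w x)\<^sup>2 \<partial>lborel) = sq_int u + 2 * t * (\<integral>x. u x * w x \<partial>lborel) + t\<^sup>2 * sq_int w"
    unfolding sq using ud wd uw by simp
  show "log_energy (\<lambda>x. u x + t * w x) = log_energy u + 2 * t * E_L u w + t\<^sup>2 * log_energy w"
    unfolding log_energy_def I E_L_eq[OF ud(1) wd(1)]
      near_energy_lincomb(2)[OF ud(1) wd(1) ud(3) wd(3)] far_form_lincomb[OF energy_space_L1(1)[OF u] energy_space_L1(1)[OF w]]
    by (simp add: algebra_simps)
qed

text \<open>On \<Omega>, of finite measure, L2 convergence implies L1 convergence, under which the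
  far form is continuous.\<close>

lemma far_form_limit:
  assumes f: "\<And>k. f k \<in> borel_measurable lborel" "\<And>k x. x \<notin> \<Omega> \<Longrightarrow> f k x = 0" "\<And>k. integrable lborel (\<lambda>x. (f k x)\<^sup>2)"
    and u: "u \<in> borel_measurable lborel" "\<And>x. x \<notin> \<Omega> \<Longrightarrow> u x = 0" "integrable lborel (\<lambda>x. (u x)\<^sup>2)"
    and lim: "(\<lambda>k. \<integral>x. (norm (f k x - u x))\<^sup>2 \<partial>lborel) \<longlonglongrightarrow> 0"
  shows "(\<lambda>k. far_form (f k) (f k)) \<longlonglongrightarrow> far_form u u"
proof -
  define d where "d k x = f k x - u x" for k x
  have \<Omega>s: "\<Omega> \<in> sets lborel" by simp
  have u2: "integrable lborel (\<lambda>x. (norm (u x))\<^sup>2)" and f2: "integrable lborel (\<lambda>x. (norm (f k x))\<^sup>2)" for k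
    using u f by simp_all
  have dm: "d k \<in> borel_measurable lborel" for k unfolding d_def[abs_def] using f(1) u(1) by simp
  have d0: "d k x = 0" if "x \<notin> \<Omega>" for k x using that f(2) u(2) by (simp add: d_def)
  have d2: "integrable lborel (\<lambda>x. (norm (d k x))\<^sup>2)" for k
    unfolding d_def by (rule square_integrable_diff[OF f(1) u(1) f2 u2])
  have dI: "integrable lborel (d k)" for k
    by (rule square_integrable_imp_integrable(1)[OF dm \<Omega>s emeasure_\<Omega> d0 d2])
  have dle: "(\<integral>x. norm (d k x) \<partial>lborel)\<^sup>2 \<le> measure lborel \<Omega> * sq_norm (d k)" for k
    by (rule square_integrable_imp_integrable(2)[OF dm \<Omega>s emeasure_\<Omega> d0 d2])
  have uI: "integrable lborel u"
    by (rule square_integrable_imp_integrable(1)[OF u(1) \<Omega>s emeasure_\<Omega> u(2) u2])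
  have "(\<lambda>k. (\<integral>x. norm (d k x) \<partial>lborel)\<^sup>2) \<longlonglongrightarrow> 0"
  proof (rule tendsto_sandwich[OF always_eventually always_eventually tendsto_const])
    show "(\<lambda>k. measure lborel \<Omega> * sq_norm (d k)) \<longlonglongrightarrow> 0"
      using tendsto_mult[OF tendsto_const lim, of "measure lborel \<Omega>"] by (simp add: d_def)
  qed (use dle in auto)
  from tendsto_real_sqrt[OF this] have dlim: "(\<lambda>k. \<integral>x. \<bar>d k x\<bar> \<partial>lborel) \<longlonglongrightarrow> 0"
    by simp
  have eq: "far_form (f k) (f k) = far_form u u + 2 * far_form u (d k) + far_form (d k) (d k)" for k
  proof -
    have "f k = (\<lambda>x. u x + 1 * d k x)" by (simp add: d_def)
    then show ?thesis using far_form_lincomb[OF uI dI, of 1 k] by simp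
  qed
  have ud: "(\<lambda>k. far_form u (d k)) \<longlonglongrightarrow> 0"
  proof (rule tendsto_rabs_zero_cancel, rule tendsto_sandwich[OF always_eventually always_eventually tendsto_const])
    show "(\<lambda>k. (\<integral>x. \<bar>u x\<bar> \<partial>lborel) * (\<integral>x. \<bar>d k x\<bar> \<partial>lborel)) \<longlonglongrightarrow> 0"
      using tendsto_mult[OF tendsto_const dlim, of "\<integral>x. \<bar>u x\<bar> \<partial>lborel"] by simp
  qed (use abs_far_form_le[OF uI dI] in auto)
  have dd: "(\<lambda>k. far_form (d k) (d k)) \<longlonglongrightarrow> 0"
  proof (rule tendsto_rabs_zero_cancel, rule tendsto_sandwich[OF always_eventually always_eventually tendsto_const])
    show "(\<lambda>k. (\<integral>x. \<bar>d k x\<bar> \<partial>lborel) * (\<integral>x. \<bar>d k x\<bar> \<partial>lborel)) \<longlonglongrightarrow> 0"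
      using tendsto_mult[OF dlim dlim] by simp
  qed (use abs_far_form_le[OF dI dI] in auto)
  have "(\<lambda>k. far_form u u + 2 * far_form u (d k) + far_form (d k) (d k)) \<longlonglongrightarrow> far_form u u + 2 * 0 + 0"
    by (intro tendsto_add tendsto_mult tendsto_const ud dd)
  then show ?thesis unfolding eq by simp
qed

text \<open>Fatou's lemma on pairs: convergence almost everywhere of the functions gives convergence
  of the integrands almost everywhere on the product.\<close>

lemma near_energy_lower_semicontinuous:
  fixes f :: "nat \<Rightarrow> real ^ 'n \<Rightarrow> real"
  assumes f[measurable]: "\<And>k. f k \<in> borel_measurable borel" and u[measurable]: "u \<in> borel_measurable borel"
    and fin: "\<And>k. finite_energy (f k)" and AE: "AE x in lborel. (\<lambda>k. f k x) \<longlonglongrightarrow> u x"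
    and lim: "(\<lambda>k. near_energy (f k)) \<longlonglongrightarrow> e"
  shows "finite_energy u" "near_energy u \<le> e"
proof -
  let ?N = "\<lambda>u p. (case p of (x, y) \<Rightarrow> near_kernel (x - y) * (u x - u y :: real)\<^sup>2)"
  have e: "e \<ge> 0" by (rule LIMSEQ_le_const[OF lim]) (auto intro: near_energy_nonneg)
  have AE2: "AE p in lborel\<^sub>2. (\<lambda>k. f k (fst p)) \<longlonglongrightarrow> u (fst p) \<and> (\<lambda>k. f k (snd p)) \<longlonglongrightarrow> u (snd p)"
    by (rule AE_pair_lborel[OF AE AE])
  have "(\<integral>\<^sup>+p. ennreal (?N u p) \<partial>lborel\<^sub>2) = (\<integral>\<^sup>+p. liminf (\<lambda>k. ennreal (?N (f k) p)) \<partial>lborel\<^sub>2)"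
    using AE2
  proof (intro nn_integral_cong_AE, eventually_elim)
    case (elim p)
    then have "(\<lambda>k. ennreal (near_kernel (fst p - snd p) * (f k (fst p) - f k (snd p))\<^sup>2)) \<longlonglongrightarrow>
        ennreal (near_kernel (fst p - snd p) * (u (fst p) - u (snd p))\<^sup>2)"
      by (intro tendsto_ennrealI tendsto_intros) auto
    then have "(\<lambda>k. ennreal (?N (f k) p)) \<longlonglongrightarrow> ennreal (?N u p)" by (simp only: split_beta)
    then show ?case by (intro lim_imp_Liminf[symmetric] trivial_limit_sequentially)
  qed
  also have "\<dots> \<le> liminf (\<lambda>k. \<integral>\<^sup>+p. ennreal (?N (f k) p) \<partial>lborel\<^sub>2)"
    by (rule nn_integral_liminf) measurable
  also have "(\<lambda>k. \<integral>\<^sup>+p. ennreal (?N (f k) p) \<partial>lborel\<^sub>2) = (\<lambda>k. ennreal (near_energy (f k)))"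
  proof
    fix k
    show "(\<integral>\<^sup>+p. ennreal (?N (f k) p) \<partial>lborel\<^sub>2) = ennreal (near_energy (f k))"
      unfolding near_energy_def using fin[of k] by (intro nn_integral_eq_integral) (auto simp: finite_energy_def split_beta')
  qed
  also have "liminf (\<lambda>k. ennreal (near_energy (f k))) = ennreal e"
    by (intro lim_imp_Liminf trivial_limit_sequentially tendsto_ennrealI lim)
  finally have le: "(\<integral>\<^sup>+p. ennreal (?N u p) \<partial>lborel\<^sub>2) \<le> ennreal e" .
  show I: "finite_energy u"
    unfolding finite_energy_def
    by (rule integrableI_nonneg) (use le in \<open>auto simp: split_beta' intro: le_less_trans\<close>)
  have "(\<integral>\<^sup>+p. ennreal (?N u p) \<partial>lborel\<^sub>2) = ennreal (near_energy u)"
    unfolding near_energy_def using I by (intro nn_integral_eq_integral) (auto simp: finite_energy_def split_beta')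
  with le e show "near_energy u \<le> e" by simp
qed

text \<open>The direct method: coercivity bounds the near energies, compactness gives a limit in L2,
  the norm and the far form are continuous there, and the near energy is lower
  semicontinuous.\<close>

lemma log_minimizer:
  obtains u where "u \<in> energy_space" "sq_int u = 1" "log_energy u \<le> first_log_eigenvalue \<Omega>"
proof -
  let ?l = "first_log_eigenvalue \<Omega>"
  let ?S = "{u \<in> energy_space. sq_int u = 1}"
  have ne: "?S \<noteq> {}" using normalized_Cc_exists Cc_energy_space by blast
  obtain f where fS: "\<And>k. f k \<in> ?S" and fl: "\<And>k. log_energy (f k) < ?l + 1 / real (Suc k)"
    by (rule minimizing_sequence[OF ne, of log_energy, folded first_log_eigenvalue_eq], rule that)
  have f: "f k \<in> energy_space" "sq_int (f k) = 1"
    "log_energy (f k) < ?l + 1 / real (Suc k)" for k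
    using fS[of k] fl[of k] by simp_all
  note fd = energy_spaceD[OF f(1)]
  \<comment> \<open>\<open>log_energy_bounds\<close> solved for the near energy, using that the
    energies stay below ?l + 1.\<close>
  define B where "B = (?l + 1 - (rho_const CARD('n) - c_const CARD('n) * measure lborel \<Omega>)) * (2 / c_const CARD('n))"
  have B: "near_energy (f k) \<le> B" for k
  proof -
    have "1 / real (Suc k) \<le> 1" by simp
    with f(3)[of k] have "log_energy (f k) \<le> ?l + 1" by linarith
    then have "(rho_const CARD('n) - c_const CARD('n) * measure lborel \<Omega>) + c_const CARD('n) / 2 * near_energy (f k) \<le> ?l + 1"
      using log_energy_bounds[OF f(1)[of k], unfolded f(2) mult_1_right] by linarith
    then show ?thesis using c_pos by (simp add: B_def field_simps)
  qed
  have n1: "sq_int (f k) \<le> 1" for k using f(2)[of k] by simp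
  obtain r where r: "strict_mono (r :: nat \<Rightarrow> nat)"
    and Cau: "\<And>e. e > 0 \<Longrightarrow> \<exists>K. \<forall>m\<ge>K. \<forall>n\<ge>K. (\<integral>x. (f (r m) x - f (r n) x)\<^sup>2 \<partial>lborel) < e"
    by (rule compactness_of_finite_energy[OF fd(1) \<Omega>_borel bounded_\<Omega> fd(2) fd(4) n1 fd(3) B], assumption) (rule that)
  have fm: "f k \<in> borel_measurable lborel" for k using fd(1) by simp
  have f2: "integrable lborel (\<lambda>x. (norm (f k x))\<^sup>2)" for k using fd(4) by simp
  have Cau': "\<exists>K. \<forall>m\<ge>K. \<forall>n\<ge>K. (\<integral>x. (norm (f (r m) x - f (r n) x))\<^sup>2 \<partial>lborel) < e" if "e > 0" for e
    using Cau[OF that] by simp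
  have \<Omega>s: "\<Omega> \<in> sets lborel" by simp
  obtain u r' where u: "u \<in> borel_measurable lborel" "\<And>x. x \<notin> \<Omega> \<Longrightarrow> u x = 0" "integrable lborel (\<lambda>x. (norm (u x))\<^sup>2)"
    "strict_mono (r' :: nat \<Rightarrow> nat)" "AE x in lborel. (\<lambda>k. f (r (r' k)) x) \<longlonglongrightarrow> u x"
    "(\<lambda>k. \<integral>x. (norm (f (r k) x - u x))\<^sup>2 \<partial>lborel) \<longlonglongrightarrow> 0"
    by (rule L2_Cauchy_limit[OF fm \<Omega>s emeasure_\<Omega> fd(2) f2 Cau'], assumption, assumption) (rule that)
  \<comment> \<open>Norm convergence holds along r, but pointwise convergence only along the further
    subsequence r'; Fatou needs the latter.\<close>
  define q where "q k = r (r' k)" for k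
  have q: "strict_mono q" unfolding q_def using r u(4) by (simp add: strict_mono_def)
  have lim: "(\<lambda>k. \<integral>x. (norm (f (q k) x - u x))\<^sup>2 \<partial>lborel) \<longlonglongrightarrow> 0"
    using LIMSEQ_subseq_LIMSEQ[OF u(6) u(4)] by (simp add: q_def comp_def)
  have u2: "integrable lborel (\<lambda>x. (u x)\<^sup>2)" using u(3) by simp
  have un: "sq_int u = 1"
  proof (rule LIMSEQ_unique)
    show "(\<lambda>k. sq_norm (f (q k))) \<longlonglongrightarrow> (sq_int u)"
      using L2_limit_norm[OF fm u(1) f2 u(3) lim] by simp
    show "(\<lambda>k. sq_norm (f (q k))) \<longlonglongrightarrow> 1" using f(2) by simp
  qed
  have far: "(\<lambda>k. far_form (f (q k)) (f (q k))) \<longlonglongrightarrow> far_form u u"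
    by (rule far_form_limit[OF fm fd(2) fd(4) u(1,2) u2 lim])
  have loglim: "(\<lambda>k. log_energy (f (q k))) \<longlonglongrightarrow> ?l"
  proof (rule tendsto_sandwich[OF always_eventually always_eventually tendsto_const])
    have "?l \<le> log_energy (f (q k))" for k
      using log_energy_ge[OF f(1)[of "q k"]] f(2)[of "q k"] by simp
    then show "\<forall>k. ?l \<le> log_energy (f (q k))" by blast
    have "log_energy (f (q k)) \<le> ?l + 1 / real (Suc k)" for k
    proof -
      have "1 / real (Suc (q k)) \<le> 1 / real (Suc k)"
        using seq_suble[OF q, of k] by (intro divide_left_mono) auto
      with f(3)[of "q k"] show ?thesis by linarith
    qed
    then show "\<forall>k. log_energy (f (q k)) \<le> ?l + 1 / real (Suc k)" by blast
    show "(\<lambda>k. ?l + 1 / real (Suc k)) \<longlonglongrightarrow> ?l"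
      using tendsto_add[OF tendsto_const LIMSEQ_Suc[OF lim_1_over_n[where 'a=real]], of ?l] by simp
  qed
  \<comment> \<open>The formula for \<open>log_energy\<close> solved for its near part. Since all
    other terms converge, so do the near energies, and their limit e makes the energy of u come out
    as at most ?l.\<close>
  define e where "e = (2 / c_const CARD('n)) * (?l + c_const CARD('n) * far_form u u - rho_const CARD('n))"
  have near_eq: "near_energy (f (q k)) = (2 / c_const CARD('n)) * (log_energy (f (q k)) + c_const CARD('n) * far_form (f (q k)) (f (q k)) - rho_const CARD('n))" for k
    using c_pos f(2)[of "q k"] by (simp add: log_energy_def field_simps)
  have nlim: "(\<lambda>k. near_energy (f (q k))) \<longlonglongrightarrow> e"
    unfolding near_eq e_def
    by (intro tendsto_mult tendsto_add tendsto_diff tendsto_const loglim far)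
  have um: "u \<in> borel_measurable borel" using u(1) by simp
  have AE: "AE x in lborel. (\<lambda>k. f (q k) x) \<longlonglongrightarrow> u x" using u(5) by (simp add: q_def)
  note lsc = near_energy_lower_semicontinuous[OF fd(1) um fd(3) AE nlim]
  have uE: "u \<in> energy_space" using um u(2) lsc(1) u2 by (simp add: energy_space_def)
  have "c_const CARD('n) / 2 * near_energy u \<le> c_const CARD('n) / 2 * e"
    using lsc(2) c_pos by (intro mult_left_mono) auto
  also have "\<dots> = ?l + c_const CARD('n) * far_form u u - rho_const CARD('n)"
    using c_pos by (simp add: e_def)
  finally have "log_energy u \<le> ?l" by (simp add: log_energy_def un)
  with uE un show thesis by (rule that)
qed

text \<open>Passing to |u| shrinks differences in the near part and enlarges products in the far
  part, which enters with a minus sign; the energy does not increase and the norm is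
  unchanged.\<close>

lemma log_minimizer_nonneg:
  obtains v where "v \<in> energy_space" "sq_int v = 1" "log_energy v \<le> first_log_eigenvalue \<Omega>" "\<And>x. v x \<ge> 0"
proof -
  obtain u where u: "u \<in> energy_space" "sq_int u = 1" "log_energy u \<le> first_log_eigenvalue \<Omega>"
    by (rule log_minimizer, rule that)
  note ud = energy_spaceD[OF u(1)]
  note [measurable] = ud(1)
  define v where "v x = \<bar>u x\<bar>" for x
  have vm[measurable]: "v \<in> borel_measurable borel" unfolding v_def[abs_def] by measurable
  have le: "near_kernel (x - y) * (v x - v y)\<^sup>2 \<le> near_kernel (x - y) * (u x - u y)\<^sup>2" for x y
  proof (rule mult_left_mono)
    have "\<bar>v x - v y\<bar> \<le> \<bar>u x - u y\<bar>" by (simp add: v_def abs_triangle_ineq3)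
    then show "(v x - v y)\<^sup>2 \<le> (u x - u y)\<^sup>2" by (rule abs_le_square_iff[THEN iffD1])
  qed simp
  have fin: "finite_energy v"
    unfolding finite_energy_def
  proof (rule Bochner_Integration.integrable_bound[OF ud(3)[unfolded finite_energy_def]])
    show "AE p in lborel\<^sub>2. norm (case p of (x, y) \<Rightarrow> near_kernel (x - y) * (v x - v y)\<^sup>2) \<le>
       norm (case p of (x, y) \<Rightarrow> near_kernel (x - y) * (u x - u y)\<^sup>2)"
      using le by (auto simp: split_beta' abs_mult)
  qed measurable
  have near: "near_energy v \<le> near_energy u"
    unfolding near_energy_def
    by (rule integral_mono[OF fin[unfolded finite_energy_def] ud(3)[unfolded finite_energy_def]]) (use le in \<open>auto simp: split_beta'\<close>)
  have v2: "(\<lambda>x. (v x)\<^sup>2) = (\<lambda>x. (u x)\<^sup>2)" by (simp add: v_def)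
  have vE: "v \<in> energy_space"
    using vm fin ud(2,4) by (simp add: energy_space_def v2) (simp add: v_def)
  have far: "far_form u u \<le> far_form v v"
    unfolding far_form_def
  proof (rule integral_mono[OF far_form_integrable far_form_integrable])
    show "(case p of (x, y) \<Rightarrow> far_kernel (x - y) * (u x * u y)) \<le> (case p of (x, y) \<Rightarrow> far_kernel (x - y) * (v x * v y))" for p
      by (cases p) (auto simp: v_def abs_mult[symmetric] intro!: mult_left_mono)
  qed (use energy_space_L1(1)[OF u(1)] energy_space_L1(1)[OF vE] in auto)
  have "log_energy v \<le> log_energy u"
  proof -
    have "c_const CARD('n) / 2 * near_energy v \<le> c_const CARD('n) / 2 * near_energy u"
      "c_const CARD('n) * far_form u u \<le> c_const CARD('n) * far_form v v"
      using near far c_pos by (intro mult_left_mono; simp)+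
    then show ?thesis unfolding log_energy_def v2 by simp
  qed
  with u have "log_energy v \<le> first_log_eigenvalue \<Omega>" by linarith
  moreover have "sq_int v = 1" using u(2) by (simp only: v2)
  ultimately show thesis using vE that[of v] by (simp add: v_def)
qed

text \<open>Compare the energy of v + t w with the eigenvalue times its square norm for all real t;
  the linear coefficient of the nonnegative quadratic must vanish.\<close>

lemma log_minimizer_Euler_Lagrange:
  assumes v: "v \<in> energy_space" "sq_int v = 1" "log_energy v \<le> first_log_eigenvalue \<Omega>"
    and w: "w \<in> energy_space"
  shows "E_L v w = first_log_eigenvalue \<Omega> * (\<integral>x. v x * w x \<partial>lborel)"
proof -
  let ?l = "first_log_eigenvalue \<Omega>"
  let ?b = "\<integral>x. v x * w x \<partial>lborel" and ?a = "\<integral>x. (w x)\<^sup>2 \<partial>lborel"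
  have "0 \<le> 2 * t * (E_L v w - ?l * ?b) + t\<^sup>2 * (log_energy w - ?l * ?a)" for t
  proof -
    have "?l * (1 + 2 * t * ?b + t\<^sup>2 * ?a) \<le> log_energy v + 2 * t * E_L v w + t\<^sup>2 * log_energy w"
      using log_energy_ge[OF energy_space_add(1)[OF v(1) w, of t]]
      unfolding energy_space_add(2,3)[OF v(1) w] v(2) .
    also have "\<dots> \<le> ?l + 2 * t * E_L v w + t\<^sup>2 * log_energy w" using v(3) by simp
    finally show ?thesis by (simp only: algebra_simps)
  qed
  then have "E_L v w - ?l * ?b = 0" by (rule linear_term_zero)
  then show ?thesis by simp
qed

section \<open>Failure of the maximum principle\<close>

lemma energy_space_V_space:
  assumes "u \<in> energy_space"
  shows "u \<in> V_space \<Omega>"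
proof -
  note ud = energy_spaceD[OF assms]
  note [measurable] = ud(1)
  have u1: "integrable lborel u" by (rule energy_space_L1(1)[OF assms])
  have um: "u \<in> borel_measurable lebesgue" by (simp add: measurable_completion)
  have uL: "integrable lebesgue u" using u1 by (simp add: integrable_completion)
  have K: "set_integrable lebesgue K u" if "compact K" for K
    unfolding set_integrable_def
    by (rule integrable_mult_indicator[OF _ uL]) (use that in \<open>auto intro: lmeasurable_compact fmeasurableD\<close>)
  have weight: "integrable lebesgue (\<lambda>x. \<bar>u x\<bar> / (1 + norm x) ^ CARD('n))"
  proof (rule Bochner_Integration.integrable_bound[OF uL])
    show "(\<lambda>x. \<bar>u x\<bar> / (1 + norm x) ^ CARD('n)) \<in> borel_measurable lebesgue"
      by (rule measurable_completion) measurable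
    have "\<bar>u x\<bar> / (1 + norm x) ^ CARD('n) \<le> \<bar>u x\<bar>" for x
      using frac_le[of "\<bar>u x\<bar>" "\<bar>u x\<bar>" 1 "(1 + norm x) ^ CARD('n)"] by (simp add: one_le_power)
    then show "AE x in lebesgue. norm (\<bar>u x\<bar> / (1 + norm x) ^ CARD('n)) \<le> norm (u x)"
      by (auto simp: abs_of_nonneg)
  qed
  have "set_integrable lebesgue near_pairs (\<lambda>(x, y). (u x - u y)\<^sup>2 / dist x y ^ CARD('n))"
    using near_pairs_integrable_iff[OF ud(1), of u] ud(3) by simp
  moreover have "near_pairs \<inter> \<Omega> \<times> \<Omega> \<in> sets lebesgue"
  proof -
    have "closed (near_pairs :: ((real ^ 'n) \<times> (real ^ 'n)) set)"
      unfolding near_pairs_def split_beta' by (intro closed_Collect_le continuous_intros)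
    moreover have "open (\<Omega> \<times> \<Omega>)" using open_\<Omega> by (intro open_Times)
    ultimately have "near_pairs \<inter> \<Omega> \<times> \<Omega> \<in> sets borel" by (intro sets.Int borel_closed borel_open)
    then show ?thesis by (metis sets_completionI_sets sets_lborel)
  qed
  ultimately have near: "set_integrable lebesgue (near_pairs \<inter> \<Omega> \<times> \<Omega>) (\<lambda>(x, y). (u x - u y)\<^sup>2 / dist x y ^ CARD('n))"
    by (rule set_integrable_subset) auto
  have "set_integrable lebesgue \<Omega> (\<lambda>x. (u x)\<^sup>2)"
    using set_integral_AE(2)[of "\<lambda>x. (u x)\<^sup>2" "\<lambda>x. (u x)\<^sup>2"] ud by simp
  with K weight near show ?thesis by (simp add: V_space_def L10_def)
qed

lemma not_log_maximum_principle:
  assumes l: "first_log_eigenvalue \<Omega> \<le> 0"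
  shows "\<not> log_maximum_principle \<Omega>"
proof
  assume MP: "log_maximum_principle \<Omega>"
  obtain v where v: "v \<in> energy_space" "sq_int v = 1" "log_energy v \<le> first_log_eigenvalue \<Omega>" "\<And>x. v x \<ge> 0"
    by (rule log_minimizer_nonneg, rule that)
  have neg: "(\<lambda>x. - 1 * v x) \<in> energy_space" by (rule energy_space_scale(1)[OF v(1)])
  have "weakly_log_superharmonic \<Omega> (\<lambda>x. - 1 * v x)"
    unfolding weakly_log_superharmonic_def
  proof (intro ballI impI)
    fix \<phi> assume \<phi>: "\<phi> \<in> Cc_infinity \<Omega>" "\<forall>x. \<phi> x \<ge> 0"
    have \<phi>E: "\<phi> \<in> energy_space" by (rule Cc_energy_space[OF \<phi>(1)])
    have m: "v \<in> borel_measurable borel" "\<phi> \<in> borel_measurable borel" "(\<lambda>x. - 1 * v x) \<in> borel_measurable borel"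
      using energy_spaceD(1)[OF v(1)] energy_spaceD(1)[OF \<phi>E] energy_spaceD(1)[OF neg] by auto
    have "E_L (\<lambda>x. - 1 * v x) \<phi> = - E_L v \<phi>"
    proof -
      have "(\<lambda>(x, y). near_kernel (x - y) * ((- 1 * v x - - 1 * v y) * (\<phi> x - \<phi> y))) =
          (\<lambda>p. - (case p of (x, y) \<Rightarrow> near_kernel (x - y) * ((v x - v y) * (\<phi> x - \<phi> y))))"
        by (auto simp: fun_eq_iff algebra_simps)
      then have "near_form (\<lambda>x. - 1 * v x) \<phi> = - near_form v \<phi>" unfolding near_form_def by simp
      moreover have "(\<lambda>(x, y). far_kernel (x - y) * (- 1 * v x * \<phi> y)) =
          (\<lambda>p. - (case p of (x, y) \<Rightarrow> far_kernel (x - y) * (v x * \<phi> y)))"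
        by (auto simp: fun_eq_iff)
      then have "far_form (\<lambda>x. - 1 * v x) \<phi> = - far_form v \<phi>" unfolding far_form_def by simp
      ultimately show ?thesis unfolding E_L_eq[OF m(3,2)] E_L_eq[OF m(1,2)] by simp
    qed
    also have "\<dots> = - first_log_eigenvalue \<Omega> * (\<integral>x. v x * \<phi> x \<partial>lborel)"
      using log_minimizer_Euler_Lagrange[OF v(1-3) \<phi>E] by simp
    also have "\<dots> \<ge> 0"
      using l v(4) \<phi>(2) by (intro mult_nonneg_nonneg integral_nonneg_AE) auto
    finally show "E_L (\<lambda>x. - 1 * v x) \<phi> \<ge> 0" .
  qed
  moreover have "- 1 * v x \<ge> 0" if "x \<notin> \<Omega>" for x using energy_spaceD(2)[OF v(1) that] by simp
  ultimately have "AE x in lebesgue. - 1 * v x \<ge> 0"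
    using MP energy_space_V_space[OF neg] unfolding log_maximum_principle_def by blast
  then have "AE x in lborel. - 1 * v x \<ge> 0" by (simp only: AE_completion_iff)
  then have "AE x in lborel. (v x)\<^sup>2 = 0" by eventually_elim (use v(4) in \<open>auto intro: antisym\<close>)
  then have "sq_int v = 0" by (rule integral_eq_zero_AE)
  with v(2) show False by simp
qed

end

theorem corollary1p10:
  fixes \<Omega> :: "(real ^ 'n) set"
  assumes "bounded_lipschitz_domain \<Omega>"
  shows "first_log_eigenvalue \<Omega> \<le> ln (first_dirichlet_eigenvalue \<Omega>)
    \<and> (first_dirichlet_eigenvalue \<Omega> \<le> 1 \<longrightarrow> \<not> log_maximum_principle \<Omega>)"
proof -
  interpret bounded_open_set \<Omega>
    using assms by unfold_locales (auto simp: bounded_lipschitz_domain_def)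
  let ?l = "first_dirichlet_eigenvalue \<Omega>"
  \<comment> \<open>The greatest-lower-bound rule for a real infimum requires a nonempty set;
    \<open>dirichlet_eigenvalue_infimum\<close> supplies an element.\<close>
  have exp: "exp (first_log_eigenvalue \<Omega>) \<le> ?l"
    unfolding first_dirichlet_eigenvalue_def
    using dirichlet_eigenvalue_infimum exp_first_log_eigenvalue_le_dirichlet_eigenvalue
    by (intro cInf_greatest) auto
  \<comment> \<open>Positivity of the first Dirichlet eigenvalue comes for free from the exponential
    form of the bound, and it makes its logarithm meaningful.\<close>
  then have pos: "?l > 0" by (rule less_le_trans[OF exp_gt_zero])
  have le: "first_log_eigenvalue \<Omega> \<le> ln ?l"
    using exp pos by (simp add: ln_ge_iff)
  moreover have "\<not> log_maximum_principle \<Omega>" if "?l \<le> 1"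
  proof (rule not_log_maximum_principle)
    have "ln ?l \<le> 0" using that pos by simp
    with le show "first_log_eigenvalue \<Omega> \<le> 0" by linarith
  qed
  ultimately show ?thesis by blast
qed

end
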